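(* The $\mathbb{Z}^2$-subshifts $X_{T_1},\ldots,X_{T_8}$ induced by the following bicolor Wang tilesets are ramified and mixing, and therefore do not belong to $\mathcal{L}^0$: $T_1=\{0000,1010,1100,0011\}$, $T_2=\{0000,1010,0101,1100,0011\}$, $T_3=\{0000,1010,1100,0011,0110\}$, $T_4=\{0000,1100,0110,0011,1001\}$, $T_5=\{0000,1010,0101,1111,1100,0011\}$, $T_6=\{0000,1010,0101,1100,0011,0110\}$, $T_7=\{0000,1111,1100,0110,0011,1001\}$, $T_8=\{0000,1010,0101,1111,1100,0011,0110\}$.
   Context: **Tilesets.** A bicolor Wang tile assigns to each edge of the unit square a color, $0$ (white) or $1$ (black). It is written as a word of four bits giving the colors of its left, upper, right and lower edges, in this order. A tileset $T$ induces the subshift $X_T\subseteq T^{\mathbb{Z}^2}$ of configurations $x$ such that the right edge of $x(i,j)$ has the same color as the left edge of $x(i+1,j)$ and the upper edge of $x(i,j)$ has the same color as the lower edge of $x(i,j+1)$, for all $i,j$. **Subshifts.** For a finite alphabet $\Sigma$, $\Sigma^{\mathbb{Z}^d}$ has the product topology and the shift action $(p\cdot x)(q)=\sigma^p(x)(q)=x(p+q)$. A $\mathbb{Z}^d$-subshift is a closed shift-invariant subset. $\mathbb{Z}^d$ has the metric $d(p,q)=\max_i|p_i-q_i|$; $\mathrm{diam}(F)=\max_{p,q\in F}d(p,q)$ ($\infty$ if $F$ is infinite) and $d(F,G)=\min_{p\in F,q\in G}d(p,q)$. An $F$-pattern is an element of $\Sigma^F$, $F\subseteq\mathbb{Z}^d$.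 A pattern $\pi\in\Sigma^F$ appears at position $p$ in $x$ if $x(p+q)=\pi(q)$ for all $q\in F$. A pattern is valid (relative to a subshift $X$) if it appears in some element of $X$. Disjoint regions $F,G\subseteq\mathbb{Z}^d$ are independent if for all valid $F$-patterns $\pi$ and valid $G$-patterns $\pi'$, $\pi\cup\pi'$ is valid. **Mixing.** $X$ is mixing if for every $m\in\mathbb{N}$ there is $n\in\mathbb{N}$ such that all regions $F,G\subseteq\mathbb{Z}^d$ with $\mathrm{diam}(F)\le m$, $\mathrm{diam}(G)\le m$ and $d(F,G)\ge n$ are independent. **Ramified.** Let $X$ be a $\mathbb{Z}^2$-subshift. For $F\subseteq\mathbb{Z}^2$, $r\in\mathbb{N}$, let $\mathcal{N}(F,r)=\{p:\exists q\in F,\ d(p,q)\le r\}$. An $F$-pattern $\pi$ can be $r$-grafted into $x\in X$ at position $p$ if there is $y\in X$ coinciding with $x$ outside $\mathcal{N}(p+F,r)$ such that $\pi$ appears at position $p$ in $y$. A ramification of radius $r$ and support $v$ (an $(r,v)$-ramification) is a configuration $x\in X$ together with $r\in\mathbb{N}$, $u,v\in\mathbb{Z}^2$ and $F\subseteq\mathbb{Z}^2$ such that for all $\lambda,\mu\in\mathbb{Z}$ with $\mu>0$, the $F$-pattern appearing at position $\mu u+\lambda v$ in $x$ cannot be $r$-grafted into $x$ at position $\lambda v$. Vectors $v_1,v_2\in\mathbb{Z}^2$ are independent if $\lambda_1v_1+\lambda_2v_2=0$ with $\lambda_1,\lambda_2\in\mathbb{Z}$ implies $\lambda_1=\lambda_2=0$.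 $X$ is ramified if for every $r\in\mathbb{N}$ there exist infinitely many pairwise independent vectors $v$ such that $X$ admits a ramification of radius $r$ and support $v$. **Class $\mathcal{L}^0$.** The $\mathbb{Z}^d$-fullshifts are the sets $\Sigma^{\mathbb{Z}^d}$, $\Sigma$ finite. For a subgroup $H$ of $\mathbb{Z}^d$, the $H$-periodic shift over $\Sigma$ is the set of $x\in\Sigma^{\mathbb{Z}^d}$ with $x(p+h)=x(p)$ for all $p\in\mathbb{Z}^d,h\in H$; these are the periodic $\mathbb{Z}^d$-shifts. $Y$ is a factor of $X$ if there is a continuous surjective shift-commuting map $X\to Y$. $\mathcal{L}^0_d$ is the smallest class of subshifts containing the $\mathbb{Z}^d$-fullshifts, the periodic $\mathbb{Z}^d$-shifts and the countable $\mathbb{Z}^d$-subshifts, and closed under finite products and factors; $\mathcal{L}^0=\bigsqcup_{d\ge1}\mathcal{L}^0_d$. *)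

theory Defs
  imports "HOL-Analysis.Analysis" "HOL-Library.Extended_Nat"
begin

section \<open>Subshifts\<close>

text \<open>
  The lattice of dimension d is the type \<open>int ^ 'd\<close> with d the cardinality of \<open>'d\<close>; index types
  are nonempty, so d is at least 1. Alphabets are finite sets of symbols.
\<close>

definition shift :: "int ^ 'd \<Rightarrow> (int ^ 'd \<Rightarrow> 'a) \<Rightarrow> int ^ 'd \<Rightarrow> 'a" where
  "shift p x = (\<lambda>q. x (p + q))"

definition fullshift :: "'a set \<Rightarrow> (int ^ 'd \<Rightarrow> 'a) set" where
  "fullshift \<Sigma> = {x. \<forall>p. x p \<in> \<Sigma>}"

text \<open>
  The alphabet is left unspecified here: for every \<open>\<Sigma>\<close>, the subspace topology induced on
  \<open>fullshift \<Sigma>\<close> is the product of the discrete topologies on \<open>\<Sigma>\<close>, and \<open>fullshift \<Sigma>\<close> is closed.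
\<close>

definition config_topology :: "(int ^ 'd \<Rightarrow> 'a) topology" where
  "config_topology = product_topology (\<lambda>_. discrete_topology UNIV) UNIV"

definition subshift :: "(int ^ 'd \<Rightarrow> 'a) set \<Rightarrow> bool" where
  "subshift X \<longleftrightarrow>
     (\<exists>\<Sigma>. finite \<Sigma> \<and> X \<subseteq> fullshift \<Sigma>) \<and> closedin config_topology X \<and> (\<forall>p. shift p ` X \<subseteq> X)"

definition factor_of :: "(int ^ 'd \<Rightarrow> 'b) set \<Rightarrow> (int ^ 'd \<Rightarrow> 'a) set \<Rightarrow> bool" where
  "factor_of Y X \<longleftrightarrow>
     (\<exists>f. continuous_map (subtopology config_topology X) (subtopology config_topology Y) f \<and>
          f ` X = Y \<and> (\<forall>x\<in>X. \<forall>p. f (shift p x) = shift p (f x)))"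


section \<open>Regions and patterns\<close>

definition zdist :: "int ^ 'd \<Rightarrow> int ^ 'd \<Rightarrow> nat" where
  "zdist p q = (MAX i. nat \<bar>p $ i - q $ i\<bar>)"

definition diam :: "(int ^ 'd) set \<Rightarrow> enat" where
  "diam F = (SUP p\<in>F. SUP q\<in>F. enat (zdist p q))"

definition region_dist :: "(int ^ 'd) set \<Rightarrow> (int ^ 'd) set \<Rightarrow> enat" where
  "region_dist F G = (INF p\<in>F. INF q\<in>G. enat (zdist p q))"

definition nbhd :: "(int ^ 'd) set \<Rightarrow> nat \<Rightarrow> (int ^ 'd) set" where
  "nbhd F r = {p. \<exists>q\<in>F. zdist p q \<le> r}"

text \<open>An F-pattern is a partial map with domain F, so the union of patterns is \<open>++\<close>.\<close>

type_synonym ('d, 'a) pattern = "int ^ 'd \<rightharpoonup> 'a"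

definition appears :: "('d, 'a) pattern \<Rightarrow> int ^ 'd \<Rightarrow> (int ^ 'd \<Rightarrow> 'a) \<Rightarrow> bool" where
  "appears \<pi> p x \<longleftrightarrow> (\<forall>q\<in>dom \<pi>. \<pi> q = Some (x (p + q)))"

definition pattern_at :: "(int ^ 'd \<Rightarrow> 'a) \<Rightarrow> (int ^ 'd) set \<Rightarrow> int ^ 'd \<Rightarrow> ('d, 'a) pattern" where
  "pattern_at x F p = (\<lambda>q. if q \<in> F then Some (x (p + q)) else None)"

definition valid :: "(int ^ 'd \<Rightarrow> 'a) set \<Rightarrow> ('d, 'a) pattern \<Rightarrow> bool" where
  "valid X \<pi> \<longleftrightarrow> (\<exists>x\<in>X. \<exists>p. appears \<pi> p x)"

definition independent_regions ::
    "(int ^ 'd \<Rightarrow> 'a) set \<Rightarrow> (int ^ 'd) set \<Rightarrow> (int ^ 'd) set \<Rightarrow> bool" where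
  "independent_regions X F G \<longleftrightarrow>
     F \<inter> G = {} \<and>
     (\<forall>\<pi> \<pi>'. dom \<pi> = F \<and> dom \<pi>' = G \<and> valid X \<pi> \<and> valid X \<pi>' \<longrightarrow> valid X (\<pi> ++ \<pi>'))"

definition mixing :: "(int ^ 'd \<Rightarrow> 'a) set \<Rightarrow> bool" where
  "mixing X \<longleftrightarrow>
     (\<forall>m::nat. \<exists>n::nat. \<forall>F G. diam F \<le> enat m \<and> diam G \<le> enat m \<and> region_dist F G \<ge> enat n
        \<longrightarrow> independent_regions X F G)"


section \<open>Ramified subshifts\<close>

definition graftable ::
    "(int ^ 2 \<Rightarrow> 'a) set \<Rightarrow> nat \<Rightarrow> (2, 'a) pattern \<Rightarrow> (int ^ 2 \<Rightarrow> 'a) \<Rightarrow> int ^ 2 \<Rightarrow> bool" where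
  "graftable X r \<pi> x p \<longleftrightarrow>
     (\<exists>y\<in>X. (\<forall>q. q \<notin> nbhd ((+) p ` dom \<pi>) r \<longrightarrow> y q = x q) \<and> appears \<pi> p y)"

definition ramification ::
    "(int ^ 2 \<Rightarrow> 'a) set \<Rightarrow> nat \<Rightarrow> int ^ 2 \<Rightarrow> (int ^ 2 \<Rightarrow> 'a) \<Rightarrow> int ^ 2 \<Rightarrow> (int ^ 2) set \<Rightarrow> bool" where
  "ramification X r v x u F \<longleftrightarrow>
     x \<in> X \<and>
     (\<forall>l m. m > 0 \<longrightarrow> \<not> graftable X r (pattern_at x F (m *s u + l *s v)) x (l *s v))"

definition independent_vectors :: "int ^ 2 \<Rightarrow> int ^ 2 \<Rightarrow> bool" where
  "independent_vectors v w \<longleftrightarrow> (\<forall>l m. l *s v + m *s w = 0 \<longrightarrow> l = 0 \<and> m = 0)"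

definition ramified :: "(int ^ 2 \<Rightarrow> 'a) set \<Rightarrow> bool" where
  "ramified X \<longleftrightarrow>
     (\<forall>r. \<exists>V. infinite V \<and> pairwise independent_vectors V \<and>
        (\<forall>v\<in>V. \<exists>x u F. ramification X r v x u F))"


section \<open>The class L0\<close>

text \<open>
  A universe of symbols closed under forming finite words, so that a single type hosts all finite
  alphabets up to renaming of symbols, products of alphabets, and tiles written as words of bits.
  Renaming symbols is a conjugacy, hence a factor map, so the choice of universe is immaterial.
\<close>

datatype symbol = Num nat | Word (letters: "symbol list")

definition zsubgroup :: "(int ^ 'd) set \<Rightarrow> bool" where
  "zsubgroup H \<longleftrightarrow> 0 \<in> H \<and> (\<forall>g\<in>H. \<forall>h\<in>H. g + h \<in> H) \<and> (\<forall>h\<in>H. - h \<in> H)"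

definition periodic_shift :: "(int ^ 'd) set \<Rightarrow> 'a set \<Rightarrow> (int ^ 'd \<Rightarrow> 'a) set" where
  "periodic_shift H \<Sigma> = {x \<in> fullshift \<Sigma>. \<forall>p. \<forall>h\<in>H. x (p + h) = x p}"

definition product_shift :: "(int ^ 'd \<Rightarrow> symbol) set list \<Rightarrow> (int ^ 'd \<Rightarrow> symbol) set" where
  "product_shift Xs = {(\<lambda>p. Word (map (\<lambda>x. x p) xs)) | xs. list_all2 (\<in>) xs Xs}"

text \<open>
  At type \<open>'d\<close> this is the d-dimensional part of the class. The whole class is the disjoint union
  over d, so a subshift of dimension d belongs to it iff it belongs to the part of dimension d.
\<close>

inductive_set L0 :: "(int ^ 'd \<Rightarrow> symbol) set set" where
  full: "finite \<Sigma> \<Longrightarrow> fullshift \<Sigma> \<in> L0"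
| periodic: "finite \<Sigma> \<Longrightarrow> zsubgroup H \<Longrightarrow> periodic_shift H \<Sigma> \<in> L0"
| countable: "subshift X \<Longrightarrow> countable X \<Longrightarrow> X \<in> L0"
| product: "(\<And>X. X \<in> set Xs \<Longrightarrow> X \<in> L0) \<Longrightarrow> product_shift Xs \<in> L0"
| factor: "X \<in> L0 \<Longrightarrow> subshift Y \<Longrightarrow> factor_of Y X \<Longrightarrow> Y \<in> L0"


section \<open>Bicolor Wang tilesets\<close>

definition tile :: "nat \<Rightarrow> nat \<Rightarrow> nat \<Rightarrow> nat \<Rightarrow> symbol" where
  "tile l u r d = Word [Num l, Num u, Num r, Num d]"

definition left_edge :: "symbol \<Rightarrow> symbol" where "left_edge t = letters t ! 0"
definition upper_edge :: "symbol \<Rightarrow> symbol" where "upper_edge t = letters t ! 1"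
definition right_edge :: "symbol \<Rightarrow> symbol" where "right_edge t = letters t ! 2"
definition lower_edge :: "symbol \<Rightarrow> symbol" where "lower_edge t = letters t ! 3"

definition wang_shift :: "symbol set \<Rightarrow> (int ^ 2 \<Rightarrow> symbol) set" where
  "wang_shift T =
     {x \<in> fullshift T. \<forall>i j.
        right_edge (x (vector [i, j])) = left_edge (x (vector [i + 1, j])) \<and>
        upper_edge (x (vector [i, j])) = lower_edge (x (vector [i, j + 1]))}"

lemma closedin_config_local:
  "closedin config_topology {x :: int ^ 'd \<Rightarrow> 'a. P (x p) (x q)}"
proof -
  have "continuous_map config_topology (discrete_topology UNIV) (\<lambda>x :: int ^ 'd \<Rightarrow> 'a. x r)" for r
    unfolding config_topology_def by (rule continuous_map_product_projection) simp
  then have "continuous_map config_topology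
      (prod_topology (discrete_topology UNIV) (discrete_topology UNIV))
      (\<lambda>x :: int ^ 'd \<Rightarrow> 'a. (x p, x q))"
    by (simp add: continuous_map_paired)
  then have "continuous_map config_topology (discrete_topology UNIV)
      (\<lambda>x :: int ^ 'd \<Rightarrow> 'a. (x p, x q))"
    by (simp flip: prod_topology_discrete_topology)
  then have "closedin config_topology
      {x \<in> topspace config_topology. (\<lambda>x :: int ^ 'd \<Rightarrow> 'a. (x p, x q)) x \<in> {(a, b). P a b}}"
    by (rule closedin_continuous_map_preimage) simp
  then show ?thesis
    by (simp add: config_topology_def)
qed

lemma subshift_wang_shift:
  assumes "finite T"
  shows "subshift (wang_shift T)"
proof -
  let ?C = "\<lambda>P p q. {x :: int ^ 2 \<Rightarrow> symbol. P (x p) (x q)}"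
  let ?H = "\<lambda>i j. ?C (\<lambda>s t. right_edge s = left_edge t) (vector [i, j]) (vector [i + 1, j])"
  let ?V = "\<lambda>i j. ?C (\<lambda>s t. upper_edge s = lower_edge t) (vector [i, j]) (vector [i, j + 1])"
  have eq: "wang_shift T =
      \<Inter> (range (\<lambda>p. ?C (\<lambda>s t. s \<in> T) p p) \<union> range (\<lambda>(i, j). ?H i j) \<union> range (\<lambda>(i, j). ?V i j))"
    by (simp add: set_eq_iff wang_shift_def fullshift_def ball_Un) blast
  have "closedin config_topology (wang_shift T)"
    unfolding eq by (rule closedin_Inter) (auto intro: closedin_config_local)
  moreover have "shift p ` wang_shift T \<subseteq> wang_shift T" for p
  proof
    fix y assume "y \<in> shift p ` wang_shift T"
    then obtain x where x: "x \<in> wang_shift T" and y: "y = shift p x" by auto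
    have v: "p + vector [i, j] = vector [p $ 1 + i, p $ 2 + j]" for i j
      by (simp add: vec_eq_iff forall_2)
    show "y \<in> wang_shift T"
      using x unfolding y wang_shift_def shift_def fullshift_def
      by (simp add: v flip: add.assoc)
  qed
  ultimately show ?thesis
    using assms by (auto simp: subshift_def wang_shift_def)
qed

definition T1 :: "symbol set" where
  "T1 = {tile 0 0 0 0, tile 1 0 1 0, tile 1 1 0 0, tile 0 0 1 1}"

definition T2 :: "symbol set" where
  "T2 = {tile 0 0 0 0, tile 1 0 1 0, tile 0 1 0 1, tile 1 1 0 0, tile 0 0 1 1}"

definition T3 :: "symbol set" where
  "T3 = {tile 0 0 0 0, tile 1 0 1 0, tile 1 1 0 0, tile 0 0 1 1, tile 0 1 1 0}"

definition T4 :: "symbol set" where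
  "T4 = {tile 0 0 0 0, tile 1 1 0 0, tile 0 1 1 0, tile 0 0 1 1, tile 1 0 0 1}"

definition T5 :: "symbol set" where
  "T5 = {tile 0 0 0 0, tile 1 0 1 0, tile 0 1 0 1, tile 1 1 1 1, tile 1 1 0 0, tile 0 0 1 1}"

definition T6 :: "symbol set" where
  "T6 = {tile 0 0 0 0, tile 1 0 1 0, tile 0 1 0 1, tile 1 1 0 0, tile 0 0 1 1, tile 0 1 1 0}"

definition T7 :: "symbol set" where
  "T7 = {tile 0 0 0 0, tile 1 1 1 1, tile 1 1 0 0, tile 0 1 1 0, tile 0 0 1 1, tile 1 0 0 1}"

definition T8 :: "symbol set" where
  "T8 = {tile 0 0 0 0, tile 1 0 1 0, tile 0 1 0 1, tile 1 1 1 1, tile 1 1 0 0, tile 0 0 1 1,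
         tile 0 1 1 0}"

end

theory Submission
  imports Defs
begin

text \<open>
  Read the black edges of a tiling as paths.

  \<^bold>\<open>Ramification.\<close> In each of the tilesets \<open>T1\<close>, \<open>T2\<close>, \<open>T3\<close>, \<open>T5\<close>, \<open>T6\<close>, \<open>T8\<close> a tile has at least
  as many black edges on its right and upper sides as on its left and lower sides. So, when only
  finitely many paths are around, the number of paths that cross a column never drops from left to
  right (\<open>column_count_mono\<close>). Let \<open>2 * r + 1\<close> parallel paths run at slope \<open>1 / n\<close> through an otherwise
  white plane. To graft a tall white column onto them with radius r is impossible: all \<open>2 * r + 1\<close>
  paths would have to squeeze through the \<open>2 * r\<close> cells just above and below the column. White columns
  of any height occur far above the paths, which gives a ramification along \<open>(n, 1)\<close>
  (\<open>flux_imp_finitely_ramified\<close>). The tilesets \<open>T4\<close> and \<open>T7\<close> are reduced to this case by exchanging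
  the two colours of half of the edges, in a checkerboard fashion: \<open>T7\<close> becomes \<open>T5\<close>, and \<open>T4\<close> becomes
  \<open>T5\<close> with each of the two corner tiles confined to one parity class of cells.

  \<^bold>\<open>Mixing.\<close> It is enough to continue any pattern on a box to a tiling that is white on a given
  half-plane close to the box, because two distant boxes are separated by such half-planes and the
  two tilings can be glued along a white strip (\<open>confinable_imp_mixing\<close>). If the straight tiles in
  both directions and two corner tiles are available, all paths leave the box along straight
  lines, and those that would enter the half-plane are turned away along an antidiagonal
  (\<open>confinable_right\<close>). In \<open>T1\<close> and \<open>T3\<close> there is no vertical straight tile; there paths run along
  rows and along diagonal staircases instead (\<open>flatten\<close>, \<open>flat_bend_right\<close>), and the half-planes are
  bounded by lines in these two directions.

  \<^bold>\<open>Non-membership.\<close> Every element of \<open>L0\<close> is a factor of a product of finitely many periodic shifts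
  (full shifts being periodic under the trivial group) and one countable subshift
  (\<open>L0_imp_tame\<close>); call the components of the product tracks. Let X be such a factor and mixing.
  Since the countable track takes countably many values, the Baire category theorem gives a value
  for which the remaining tracks reach a whole cylinder of X. Mixing lets this cylinder be pushed to
  infinity without restricting X, so in the limit there is a value for which they reach all
  of X (\<open>surjective_layer\<close>), and by minimality this value may be taken periodic in a prescribed
  direction u (\<open>periodic_surjective_layer\<close>). Let now v be independent of the periods of all periodic
  tracks. In each of these tracks a multiple of u acts as a multiple of v, so van der Waerden's
  theorem finds a place on the line of v and a translate of it by a multiple of u around which all
  periodic tracks show the same finite pattern. The full shift track can be overwritten freely, so
  the pattern of the translate can be grafted at that place, which rules out a ramification with support
  v (\<open>mixing_finitely_ramified_not_tame\<close>).
\<close>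

section \<open>Van der Waerden's theorem\<close>

text \<open>
  The bound N confines progression and difference to a finite window. The induction needs this:
  it applies the statement to colourings by the content of whole windows, of which there are
  finitely many only if the size of the window is fixed in advance.
\<close>

definition vdw_holds :: "nat \<Rightarrow> bool" where
  "vdw_holds k \<longleftrightarrow> (\<forall>r. \<exists>N. \<forall>c :: int \<Rightarrow> nat. (\<forall>x. c x < r) \<longrightarrow>
     (\<exists>a d. 0 < d \<and> d \<le> N \<and> (\<forall>j<k. \<bar>a + int j * d\<bar> \<le> N \<and> c (a + int j * d) = c a)))"

lemma van_der_waerden_finite_colours:
  assumes "vdw_holds k" "finite S"
  obtains N where "\<And>c :: int \<Rightarrow> 'c. (\<And>x. c x \<in> S) \<Longrightarrow>
     \<exists>a d. 0 < d \<and> d \<le> N \<and> (\<forall>j<k. \<bar>a + int j * d\<bar> \<le> N \<and> c (a + int j * d) = c a)"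
proof -
  obtain e :: "'c \<Rightarrow> nat" where e: "bij_betw e S {..<card S}"
    using ex_bij_betw_finite_nat[OF assms(2)] by (auto simp: lessThan_atLeast0)
  obtain N where N: "\<And>c :: int \<Rightarrow> nat. (\<forall>x. c x < card S) \<Longrightarrow>
     \<exists>a d. 0 < d \<and> d \<le> N \<and> (\<forall>j<k. \<bar>a + int j * d\<bar> \<le> N \<and> c (a + int j * d) = c a)"
    using assms(1) unfolding vdw_holds_def by metis
  show thesis
  proof (rule that)
    fix c :: "int \<Rightarrow> 'c" assume c: "\<And>x. c x \<in> S"
    have "\<forall>x. (e \<circ> c) x < card S"
      using c e by (auto simp: bij_betw_def)
    from N[OF this] show "\<exists>a d. 0 < d \<and> d \<le> N \<and> (\<forall>j<k. \<bar>a + int j * d\<bar> \<le> N \<and> c (a + int j * d) = c a)"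
      using c bij_betw_imp_inj_on[OF e] by (auto simp: inj_on_eq_iff)
  qed
qed

text \<open>
  Colour focusing. In the second alternative the progressions with differences in D, which all
  start at f, are monochromatic apart from f itself and have pairwise different colours. Once s is
  the number of colours, f must share its colour with one of them, which makes that
  progression longer by one. To pass from s to \<open>s + 1\<close>, take k equally coloured windows in
  arithmetic progression with difference \<open>\<delta>\<close>, find s focused progressions in the first, and move the
  focus back by \<open>\<delta>\<close>: the old progressions continue from window to window with differences \<open>\<delta> + d\<close>,
  and the old foci form the new progression.
\<close>

lemma van_der_waerden_focus:
  assumes k: "vdw_holds k" "k > 0"
  shows "\<exists>N. \<forall>c :: int \<Rightarrow> nat. (\<forall>x. c x < r) \<longrightarrow>
     (\<exists>a d. 0 < d \<and> d \<le> N \<and> (\<forall>j<Suc k. \<bar>a + int j * d\<bar> \<le> N \<and> c (a + int j * d) = c a)) \<or>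
     (\<exists>f D. \<bar>f\<bar> \<le> N \<and> finite D \<and> card D = s \<and> inj_on (\<lambda>d. c (f + d)) D \<and>
        (\<forall>d\<in>D. 0 < d \<and> d \<le> N \<and> (\<forall>j\<in>{1..k}. \<bar>f + int j * d\<bar> \<le> N \<and> c (f + int j * d) = c (f + d))))"
    (is "\<exists>N. \<forall>c. _ \<longrightarrow> ?mono N c \<or> ?focus N c s")
proof (induction s)
  case 0
  show ?case by (rule exI[of _ 0], intro allI impI disjI2 exI[of _ 0] exI[of _ "{}"]) auto
next
  case (Suc s)
  then obtain N where N: "\<And>c. (\<forall>x. c x < r) \<Longrightarrow> ?mono N c \<or> ?focus N c s" by blast
  let ?W = "{-N..N}"
  \<comment> \<open>Colour a position by the colours that c shows in the whole window around it.\<close>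
  obtain M where M: "\<And>c :: int \<Rightarrow> int \<Rightarrow> nat. (\<And>x. c x \<in> ?W \<rightarrow>\<^sub>E {..<r}) \<Longrightarrow>
     \<exists>a d. 0 < d \<and> d \<le> M \<and> (\<forall>j<k. \<bar>a + int j * d\<bar> \<le> M \<and> c (a + int j * d) = c a)"
    by (rule van_der_waerden_finite_colours[OF k(1), of "?W \<rightarrow>\<^sub>E {..<r}"]) (auto simp: finite_PiE)
  show ?case
  proof (intro exI[of _ "3 * \<bar>M\<bar> + \<bar>N\<bar>"] allI impI)
    fix c :: "int \<Rightarrow> nat" assume c: "\<forall>x. c x < r"
    let ?N = "3 * \<bar>M\<bar> + \<bar>N\<bar>"
    have "(\<lambda>x\<in>?W. c (b + x)) \<in> ?W \<rightarrow>\<^sub>E {..<r}" for b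
      using c by auto
    from M[of "\<lambda>b. \<lambda>x\<in>?W. c (b + x)", OF this] obtain e D
      where D: "D > 0" "D \<le> M" and e: "\<And>j. j < k \<Longrightarrow> \<bar>e + int j * D\<bar> \<le> M"
        and eq: "\<And>j. j < k \<Longrightarrow> (\<lambda>x\<in>?W. c (e + int j * D + x)) = (\<lambda>x\<in>?W. c (e + x))"
      by blast
    have rep: "c (e + int j * D + x) = c (e + x)" if "j < k" "\<bar>x\<bar> \<le> N" for j x
    proof -
      have "x \<in> ?W" using that(2) by auto
      with fun_cong[OF eq[OF that(1)], of x] show ?thesis by simp
    qed
    have e0: "\<bar>e\<bar> \<le> M" using e[of 0] k(2) by simp
    show "?mono ?N c \<or> ?focus ?N c (Suc s)"
    proof (cases "?mono N (\<lambda>x. c (e + x))")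
      case True
      then obtain a d where "d > 0" "d \<le> N" "\<And>j. j < Suc k \<Longrightarrow> \<bar>a + int j * d\<bar> \<le> N"
        "\<And>j. j < Suc k \<Longrightarrow> c (e + (a + int j * d)) = c (e + a)" by blast
      then have "0 < d \<and> d \<le> ?N \<and> (\<forall>j<Suc k. \<bar>(e + a) + int j * d\<bar> \<le> ?N \<and> c (e + a + int j * d) = c (e + a))"
        using e0 by (auto simp: add.assoc) (smt (verit))
      then show ?thesis by blast
    next
      case False
      with N[of "\<lambda>x. c (e + x)"] c obtain f E where f: "\<bar>f\<bar> \<le> N" "finite E" "card E = s"
        and inj: "inj_on (\<lambda>d. c (e + (f + d))) E"
        and E: "\<And>d. d \<in> E \<Longrightarrow> 0 < d \<and> d \<le> N" "\<And>d j. d \<in> E \<Longrightarrow> j \<in> {1..k} \<Longrightarrow> \<bar>f + int j * d\<bar> \<le> N"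
          "\<And>d j. d \<in> E \<Longrightarrow> j \<in> {1..k} \<Longrightarrow> c (e + (f + int j * d)) = c (e + (f + d))"
        by (auto; blast)
      \<comment> \<open>A focus that shares the colour of one of its progressions already gives a long one.\<close>
      have ne: "c (e + (f + d)) \<noteq> c (e + f)" if d: "d \<in> E" for d
      proof
        assume "c (e + (f + d)) = c (e + f)"
        then have "\<bar>f + int j * d\<bar> \<le> N \<and> c (e + (f + int j * d)) = c (e + f)" if "j < Suc k" for j
          using that f E(2,3)[OF d, of j] by (cases "j = 0") auto
        with E(1)[OF d] False show False by blast
      qed
      let ?f = "e + f - D" and ?E = "insert D ((+) D ` E)"
      have pt: "c (?f + int j * (D + d)) = c (e + (f + int j * d))"
        if "j \<in> {1..k}" "\<bar>f + int j * d\<bar> \<le> N" for j d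
      proof -
        have "?f + int j * (D + d) = e + int (j - 1) * D + (f + int j * d)"
          using that(1) by (simp add: algebra_simps of_nat_diff)
        moreover have "j - 1 < k" using that(1) by auto
        ultimately show ?thesis using rep[of "j - 1" "f + int j * d"] that(2) by metis
      qed
      have bd: "\<bar>?f + int j * (D + d)\<bar> \<le> ?N" if "j \<in> {1..k}" "\<bar>f + int j * d\<bar> \<le> N" for j d
      proof -
        have "?f + int j * (D + d) = (e + int (j - 1) * D) + (f + int j * d)"
          using that(1) by (simp add: algebra_simps of_nat_diff)
        moreover have "\<bar>e + int (j - 1) * D\<bar> \<le> M" using that(1) by (intro e) auto
        ultimately show ?thesis using that(2) by linarith
      qed
      have col: "c (?f + (D + d)) = c (e + (f + d))" if "\<bar>f + d\<bar> \<le> N" for d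
        using pt[of 1 d] that k(2) by simp
      have E1: "\<bar>f + d\<bar> \<le> N" if "d \<in> E" for d using E(2)[OF that, of 1] k(2) by simp
      have "D \<notin> (+) D ` E" using E(1) by fastforce
      then have card: "card ?E = Suc s" using f by (simp add: card_image)
      have "inj_on (\<lambda>d. c (?f + d)) ?E"
      proof -
        have old: "c (?f + d') = c (e + (f + d))" "c (e + (f + d)) \<noteq> c (e + f)"
          if "d \<in> E" "d' = D + d" for d d'
          using col[OF E1[OF that(1)]] ne[OF that(1)] that(2) by simp_all
        have new: "c (?f + D) = c (e + f)" using col[of 0] f(1) by simp
        show ?thesis
        proof (rule inj_onI)
          fix d1 d2 assume d: "d1 \<in> ?E" "d2 \<in> ?E" "c (?f + d1) = c (?f + d2)"
          consider "d1 = D" "d2 = D" | b where "d1 = D" "b \<in> E" "d2 = D + b"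
            | a where "a \<in> E" "d1 = D + a" "d2 = D"
            | a b where "a \<in> E" "d1 = D + a" "b \<in> E" "d2 = D + b"
            using d by blast
          then show "d1 = d2"
          proof cases
            case 2 then show ?thesis using old[OF 2(2,3)] new d(3) by simp
          next
            case 3 then show ?thesis using old[OF 3(1,2)] new d(3) by simp
          next
            case 4
            then have "c (e + (f + a)) = c (e + (f + b))"
              using old(1)[OF 4(1,2)] old(1)[OF 4(3,4)] d(3) by simp
            then show ?thesis using inj_onD[OF inj _ 4(1,3)] 4 by simp
          qed simp
        qed
      qed
      moreover have "\<forall>d\<in>?E. 0 < d \<and> d \<le> ?N \<and> (\<forall>j\<in>{1..k}. \<bar>?f + int j * d\<bar> \<le> ?N \<and> c (?f + int j * d) = c (?f + d))"
      proof (intro ballI)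
        fix d' assume "d' \<in> ?E"
        then obtain d where d: "d' = D + d" "d = 0 \<or> d \<in> E" by auto
        have *: "\<bar>f + int j * d\<bar> \<le> N" "c (e + (f + int j * d)) = c (e + (f + d))" if "j \<in> {1..k}" for j
          using d(2) E(2,3) that f(1) by auto
        have "c (?f + int j * d') = c (?f + d')" if "j \<in> {1..k}" for j
          using pt[OF that *(1)[OF that]] *(2)[OF that] col[of d] *(1)[of 1] k(2) d(1) by simp
        moreover have bound: "0 < d' \<and> d' \<le> ?N"
          using d D E(1) e0 by fastforce
        ultimately show "0 < d' \<and> d' \<le> ?N \<and> (\<forall>j\<in>{1..k}. \<bar>?f + int j * d'\<bar> \<le> ?N \<and> c (?f + int j * d') = c (?f + d'))"
          using bd[OF _ *(1)] d(1) bound by simp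
      qed
      moreover have "\<bar>?f\<bar> \<le> ?N"
        using e0 f(1) D by linarith
      moreover have "finite ?E" using f by simp
      ultimately show ?thesis using card by blast
    qed
  qed
qed

lemma van_der_waerden: "k > 0 \<Longrightarrow> vdw_holds k"
proof (induction k rule: nat_induct_non_zero)
  case 1
  show ?case unfolding vdw_holds_def
    by (intro allI exI[of _ 1] impI exI[of _ 0]) auto
next
  case (Suc k)
  show ?case unfolding vdw_holds_def
  proof
    fix r
    obtain N where N: "\<forall>c :: int \<Rightarrow> nat. (\<forall>x. c x < r) \<longrightarrow>
     (\<exists>a d. 0 < d \<and> d \<le> N \<and> (\<forall>j<Suc k. \<bar>a + int j * d\<bar> \<le> N \<and> c (a + int j * d) = c a)) \<or>
     (\<exists>f D. \<bar>f\<bar> \<le> N \<and> finite D \<and> card D = r \<and> inj_on (\<lambda>d. c (f + d)) D \<and>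
        (\<forall>d\<in>D. 0 < d \<and> d \<le> N \<and> (\<forall>j\<in>{1..k}. \<bar>f + int j * d\<bar> \<le> N \<and> c (f + int j * d) = c (f + d))))"
      using van_der_waerden_focus[OF Suc.IH Suc.hyps, of r r] by (elim exE)
    show "\<exists>N. \<forall>c :: int \<Rightarrow> nat. (\<forall>x. c x < r) \<longrightarrow>
      (\<exists>a d. 0 < d \<and> d \<le> N \<and> (\<forall>j<Suc k. \<bar>a + int j * d\<bar> \<le> N \<and> c (a + int j * d) = c a))"
    proof (rule exI[of _ N], intro allI impI)
      fix c :: "int \<Rightarrow> nat" assume c: "\<forall>x. c x < r"
      show "\<exists>a d. 0 < d \<and> d \<le> N \<and> (\<forall>j<Suc k. \<bar>a + int j * d\<bar> \<le> N \<and> c (a + int j * d) = c a)"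
      proof (rule disjE[OF N[rule_format, OF c[rule_format]]])
        assume "\<exists>f D. \<bar>f\<bar> \<le> N \<and> finite D \<and> card D = r \<and> inj_on (\<lambda>d. c (f + d)) D \<and>
          (\<forall>d\<in>D. 0 < d \<and> d \<le> N \<and> (\<forall>j\<in>{1..k}. \<bar>f + int j * d\<bar> \<le> N \<and> c (f + int j * d) = c (f + d)))"
        then obtain f D where f: "\<bar>f\<bar> \<le> N" "finite D" "card D = r" "inj_on (\<lambda>d. c (f + d)) D"
          and D: "\<And>d. d \<in> D \<Longrightarrow> 0 < d \<and> d \<le> N"
            "\<And>d j. d \<in> D \<Longrightarrow> j \<in> {1..k} \<Longrightarrow> \<bar>f + int j * d\<bar> \<le> N \<and> c (f + int j * d) = c (f + d)"
          by blast
        have "(\<lambda>d. c (f + d)) ` D = {..<r}"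
          using c f by (intro card_subset_eq) (auto simp: card_image)
        then obtain d where d: "d \<in> D" "c (f + d) = c f"
          using c by (metis (no_types, lifting) imageE lessThan_iff)
        have "\<bar>f + int j * d\<bar> \<le> N \<and> c (f + int j * d) = c f" if "j < Suc k" for j
          using D(2)[OF d(1), of j] d(2) f(1) that by (cases "j = 0") auto
        with D(1)[OF d(1)] show ?thesis by blast
      qed blast
    qed
  qed
qed

text \<open>
  The one-dimensional Gallai theorem: a long progression contains a copy of the finite set L,
  scaled by its difference and centred at its middle term.
\<close>

lemma homothetic_copy_same_colour:
  fixes c :: "int \<Rightarrow> 'c" and L :: "int set"
  assumes "finite (range c)" "finite L"
  obtains l m where "m > 0" "\<And>a. a \<in> L \<Longrightarrow> c (l + m * a) = c l"
proof -
  obtain K where K: "\<And>a. a \<in> L \<Longrightarrow> \<bar>a\<bar> \<le> int K"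
  proof (rule that[of "nat (\<Sum>a\<in>L. \<bar>a\<bar>)"])
    fix a assume "a \<in> L"
    then have "\<bar>a\<bar> \<le> (\<Sum>a\<in>L. \<bar>a\<bar>)" using assms(2) by (intro member_le_sum) auto
    then show "\<bar>a\<bar> \<le> int (nat (\<Sum>a\<in>L. \<bar>a\<bar>))" by linarith
  qed
  obtain a d where d: "d > 0" and ad: "\<And>j. j < 2 * K + 1 \<Longrightarrow> c (a + int j * d) = c a"
    using van_der_waerden_finite_colours[OF van_der_waerden assms(1), of "2 * K + 1"] by (metis add_is_0 gr0I one_neq_zero rangeI)
  show thesis
  proof (rule that[OF d])
    fix b assume "b \<in> L"
    then have "\<bar>b\<bar> \<le> int K" by (rule K)
    define j where "j = nat (int K + b)"
    have j: "int j = int K + b" "j < 2 * K + 1"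
      using \<open>\<bar>b\<bar> \<le> int K\<close> unfolding j_def by linarith+
    have "a + int K * d + d * b = a + int j * d" using j(1) by (simp add: algebra_simps)
    then show "c (a + int K * d + d * b) = c (a + int K * d)"
      using ad[OF j(2)] ad[of K] by (simp add: add.assoc)
  qed
qed

section \<open>Closed sets of configurations\<close>

definition zball :: "int ^ 'd \<Rightarrow> nat \<Rightarrow> (int ^ 'd) set" where
  "zball p n = {q. zdist q p \<le> n}"

lemma zdist_le_iff: "zdist p q \<le> n \<longleftrightarrow> (\<forall>i. \<bar>p $ i - q $ i\<bar> \<le> int n)"
  unfolding zdist_def by (subst Max_le_iff) (auto simp: nat_le_iff)

lemma mem_zball_iff: "q \<in> zball p n \<longleftrightarrow> (\<forall>i. \<bar>q $ i - p $ i\<bar> \<le> int n)"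
  by (simp add: zball_def zdist_le_iff)

lemma finite_zball: "finite (zball (p :: int ^ 'd) n)"
proof -
  have "zball p n \<subseteq> vec_lambda ` (\<Pi>\<^sub>E i\<in>UNIV. {p $ i - int n..p $ i + int n})"
  proof
    fix q assume "q \<in> zball p n"
    then have "vec_nth q \<in> (\<Pi>\<^sub>E i\<in>UNIV. {p $ i - int n..p $ i + int n})"
      unfolding mem_zball_iff by (auto simp: abs_le_iff) (smt (verit))+
    then show "q \<in> vec_lambda ` (\<Pi>\<^sub>E i\<in>UNIV. {p $ i - int n..p $ i + int n})"
      by (intro image_eqI[of _ _ "vec_nth q"]) simp_all
  qed
  then show ?thesis by (rule finite_subset) (intro finite_imageI finite_PiE, auto)
qed

lemma zball_mono: "m \<le> n \<Longrightarrow> zball p m \<subseteq> zball p n"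
  by (auto simp: zball_def)

lemma zball_trans:
  assumes "q \<in> zball p m" "s \<in> zball q n"
  shows "s \<in> zball p (m + n)"
  unfolding mem_zball_iff
proof
  fix i
  have "\<bar>q $ i - p $ i\<bar> \<le> int m" "\<bar>s $ i - q $ i\<bar> \<le> int n"
    using assms by (simp_all add: mem_zball_iff)
  then show "\<bar>s $ i - p $ i\<bar> \<le> int (m + n)" by linarith
qed

lemma zball_covers: "\<exists>n. p \<in> zball 0 n"
  using zball_def by auto

lemma finite_subset_zball:
  assumes "finite A"
  shows "\<exists>n. A \<subseteq> zball 0 n"
proof -
  have "A \<subseteq> zball 0 (Max (insert 0 ((\<lambda>p. zdist p 0) ` A)))"
    using assms by (auto simp: zball_def intro!: Max_ge)
  then show ?thesis ..
qed

lemma shift_shift: "shift p (shift q x) = shift (q + p) x"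
  by (simp add: shift_def add.assoc)

lemma shift_0: "shift 0 x = x"
  by (simp add: shift_def)

definition agree :: "(int ^ 'd) set \<Rightarrow> (int ^ 'd \<Rightarrow> 'a) \<Rightarrow> (int ^ 'd \<Rightarrow> 'a) \<Rightarrow> bool" where
  "agree A x y \<longleftrightarrow> (\<forall>p\<in>A. x p = y p)"

lemma agree_sym: "agree A x y \<Longrightarrow> agree A y x"
  by (simp add: agree_def)

lemma agree_trans: "agree A x y \<Longrightarrow> agree A y z \<Longrightarrow> agree A x z"
  by (simp add: agree_def)

lemma agree_mono: "agree A x y \<Longrightarrow> B \<subseteq> A \<Longrightarrow> agree B x y"
  by (auto simp: agree_def)

lemma agree_refl: "agree A x x"
  by (simp add: agree_def)

lemma topspace_config [simp]: "topspace config_topology = UNIV"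
  by (simp add: config_topology_def)

lemma openin_config_cylinder:
  "openin config_topology {y. agree (zball p n) x y}"
proof -
  have "openin config_topology (\<Pi>\<^sub>E q\<in>UNIV. if q \<in> zball p n then {x q} else UNIV)"
    unfolding config_topology_def
  proof (rule product_topology_basis)
    have "{q. (if q \<in> zball p n then {x q} else UNIV) \<noteq> UNIV} \<subseteq> zball p n" by auto
    then show "finite {q. (if q \<in> zball p n then {x q} else UNIV) \<noteq> topspace (discrete_topology UNIV)}"
      using finite_zball[of p n] by (auto intro: finite_subset)
  qed simp
  also have "(\<Pi>\<^sub>E q\<in>UNIV. if q \<in> zball p n then {x q} else UNIV) = {y. agree (zball p n) x y}"
    by (force simp: agree_def PiE_iff split: if_splits)
  finally show ?thesis .
qed

lemma openin_config_contains_cylinder: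
  assumes "openin config_topology U" "x \<in> U"
  shows "\<exists>n. \<forall>y. agree (zball 0 n) x y \<longrightarrow> y \<in> U"
proof -
  obtain B where B: "finite {q. B q \<noteq> UNIV}" "x \<in> Pi\<^sub>E UNIV B" "Pi\<^sub>E UNIV B \<subseteq> U"
    using assms unfolding config_topology_def openin_product_topology_alt by auto
  obtain n where n: "{q. B q \<noteq> UNIV} \<subseteq> zball 0 n"
    using finite_subset_zball[OF B(1)] by blast
  have "y \<in> U" if "agree (zball 0 n) x y" for y
  proof -
    have "y q \<in> B q" for q
      using that n B(2) unfolding agree_def by (cases "B q = UNIV") (auto, metis (mono_tags) PiE_E UNIV_I mem_Collect_eq subsetD)
    then show ?thesis using B(3) by auto
  qed
  then show ?thesis by blast
qed

definition limit_closed :: "(int ^ 'd \<Rightarrow> 'a) set \<Rightarrow> bool" where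
  "limit_closed X \<longleftrightarrow> (\<forall>x. (\<forall>n. \<exists>y\<in>X. agree (zball 0 n) x y) \<longrightarrow> x \<in> X)"

text \<open>
  Cylinders over balls are a base of the topology. From here on closedness is only used in the
  form of \<open>limit_closed\<close>, which involves finite windows instead of open sets.
\<close>

lemma closedin_config_iff: "closedin config_topology X \<longleftrightarrow> limit_closed X"
proof
  assume cl: "closedin config_topology X"
  show "limit_closed X" unfolding limit_closed_def
  proof (intro allI impI, rule ccontr)
    fix x assume x: "\<forall>n. \<exists>y\<in>X. agree (zball 0 n) x y" "x \<notin> X"
    have "openin config_topology (- X)"
      using cl by (simp add: closedin_def Compl_eq_Diff_UNIV)
    from openin_config_contains_cylinder[OF this, of x] x show False by blast
  qed
next
  assume lc: "limit_closed X"
  have "\<exists>U. openin config_topology U \<and> x \<in> U \<and> U \<subseteq> - X" if x: "x \<notin> X" for x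
  proof -
    obtain n where "\<forall>y\<in>X. \<not> agree (zball 0 n) x y"
      using lc x unfolding limit_closed_def by blast
    then show ?thesis
      by (intro exI[of _ "{y. agree (zball 0 n) x y}"]) (auto simp: openin_config_cylinder agree_refl)
  qed
  then have "openin config_topology (- X)"
    by (subst openin_subopen) auto
  then show "closedin config_topology X"
    by (simp add: closedin_def Compl_eq_Diff_UNIV)
qed

lemma limit_closed_singleton: "limit_closed {c :: int ^ 'd \<Rightarrow> 'a}"
  unfolding limit_closed_def
proof (intro allI impI)
  fix x assume x: "\<forall>n. \<exists>y\<in>{c}. agree (zball 0 n) x y"
  have "x p = c p" for p
    using x zball_covers[of p] by (auto simp: agree_def)
  then show "x \<in> {c}" by auto
qed

text \<open>
  Compactness of the full shift over a finite alphabet, as a statement on sequences.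
\<close>

lemma cluster_point:
  fixes x :: "nat \<Rightarrow> int ^ 'd \<Rightarrow> 'a"
  assumes fin: "finite \<Sigma>" and x: "\<And>n. x n \<in> fullshift \<Sigma>"
  obtains z where "\<And>n N. \<exists>k\<ge>N. agree (zball 0 n) z (x k)"
proof -
  let ?T = "product_topology (\<lambda>_ :: int ^ 'd. discrete_topology \<Sigma>) UNIV"
  have full: "topspace ?T = fullshift \<Sigma>"
    by (auto simp: fullshift_def)
  have comp: "compact_space ?T"
    unfolding compact_space_product_topology by (simp add: compact_space_discrete_topology fin)
  have sub: "?T = subtopology config_topology (fullshift \<Sigma>)"
  proof -
    have "fullshift \<Sigma> = (\<Pi>\<^sub>E i\<in>(UNIV :: (int ^ 'd) set). \<Sigma>)"
      by (auto simp: fullshift_def)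
    then show ?thesis
      unfolding config_topology_def by (simp add: subtopology_product_topology subtopology_discrete_topology)
  qed
  define C where "C N = ?T closure_of (x ` {N..})" for N
  have "(\<Inter>N. C N) \<noteq> {}"
  proof (rule compact_space_imp_nest[OF comp])
    show "closedin ?T (C N)" for N by (simp add: C_def)
    show "C N \<noteq> {}" for N
    proof -
      have "x N \<in> C N" unfolding C_def
        using closure_of_subset[of "x ` {N..}" ?T] x full by (auto simp: image_subset_iff)
      then show ?thesis by blast
    qed
    show "decseq C" unfolding C_def
      by (intro decseq_SucI closure_of_mono image_mono) auto
  qed
  then obtain z where z: "\<And>N. z \<in> C N" by auto
  show thesis
  proof (rule that[of z])
    fix n N
    let ?U = "fullshift \<Sigma> \<inter> {y. agree (zball 0 n) z y}"
    have "openin ?T ?U"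
      unfolding sub by (intro openin_subtopology_Int2 openin_config_cylinder)
    moreover have "z \<in> fullshift \<Sigma>"
      using z[of 0] full unfolding C_def by (metis in_closure_of)
    then have "z \<in> ?U" by (simp add: agree_refl)
    moreover have "\<And>T. z \<in> T \<Longrightarrow> openin ?T T \<Longrightarrow> \<exists>y\<in>x ` {N..}. y \<in> T"
      using z[of N] unfolding C_def in_closure_of by simp
    ultimately have "\<exists>y\<in>x ` {N..}. y \<in> ?U" by presburger
    then show "\<exists>k\<ge>N. agree (zball 0 n) z (x k)"
      by auto
  qed
qed

text \<open>
  The Baire category theorem for subshifts. If no \<open>Z n\<close> contained a cylinder of X, one could
  shrink a cylinder step by step, leaving \<open>Z n\<close> in step n, and the limit would lie in no \<open>Z n\<close>.
\<close>

lemma countable_cover_contains_cylinder: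
  fixes X :: "(int ^ 'd \<Rightarrow> 'a) set" and Z :: "nat \<Rightarrow> (int ^ 'd \<Rightarrow> 'a) set"
  assumes cl: "limit_closed X" and ne: "X \<noteq> {}"
    and Z: "\<And>n. limit_closed (Z n)" and cover: "X \<subseteq> (\<Union>n. Z n)"
  shows "\<exists>n. \<exists>x\<in>X. \<exists>r. \<forall>y\<in>X. agree (zball 0 r) x y \<longrightarrow> y \<in> Z n"
proof (rule ccontr)
  assume no: "\<not> ?thesis"
  obtain x0 where x0: "x0 \<in> X" using ne by blast
  \<comment> \<open>Shrinking cylinders (x, r), the n-th of which misses Z n.\<close>
  define P where "P n c \<longleftrightarrow> fst c \<in> X \<and> n \<le> snd c \<and> (\<forall>y\<in>Z n. \<not> agree (zball 0 (snd c)) (fst c) y)"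
    for n c
  define Q where "Q c c' \<longleftrightarrow> agree (zball 0 (snd c)) (fst c) (fst c') \<and> snd c \<le> snd c'"
    for c c' :: "(int ^ 'd \<Rightarrow> 'a) \<times> nat"
  have step: "\<exists>c'. P n c' \<and> Q (x, r) c'" if x: "x \<in> X" for n x r
  proof -
    obtain x' where x': "x' \<in> X" "agree (zball 0 r) x x'" "x' \<notin> Z n"
      using no x by blast
    then obtain k where k: "\<forall>y\<in>Z n. \<not> agree (zball 0 k) x' y"
      using Z[of n] unfolding limit_closed_def by blast
    have "\<forall>y\<in>Z n. \<not> agree (zball 0 (k + n + r)) x' y"
      using k agree_mono[OF _ zball_mono[of k "k + n + r" 0]] by (metis add.assoc le_add1)
    then show ?thesis using x' by (intro exI[of _ "(x', k + n + r)"]) (auto simp: P_def Q_def)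
  qed
  have "\<exists>f. \<forall>n. P n (f n) \<and> Q (f n) (f (Suc n))"
  proof (rule dependent_nat_choice)
    show "\<exists>c. P 0 c" using step[OF x0, of 0] by fast
    show "\<exists>c'. P (Suc n) c' \<and> Q c c'" if "P n c" for c n
      using step[of "fst c" "Suc n" "snd c"] that by (simp add: P_def)
  qed
  then obtain f where "\<And>n. P n (f n)" "\<And>n. Q (f n) (f (Suc n))" by metis
  note f = this[unfolded P_def Q_def]
  have chain: "agree (zball 0 (snd (f n))) (fst (f n)) (fst (f m))" if "n \<le> m" for n m
    using that
  proof (induction m rule: dec_induct)
    case base show ?case by (rule agree_refl)
  next
    case (step m)
    have "snd (f n) \<le> snd (f m)"
      using lift_Suc_mono_le[of "\<lambda>k. snd (f k)" n m] f(2) step(1) by auto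
    moreover have "agree (zball 0 (snd (f m))) (fst (f m)) (fst (f (Suc m)))"
      using f(2)[of m] by simp
    ultimately show ?case using step.IH agree_mono agree_trans zball_mono by metis
  qed
  define z where "z p = fst (f (zdist p 0)) p" for p
  have r: "n \<le> snd (f n)" for n using f(1)[of n] by simp
  have zf: "agree (zball 0 (snd (f n))) (fst (f n)) z" for n
    unfolding agree_def
  proof
    fix p :: "int ^ 'd" assume p: "p \<in> zball 0 (snd (f n))"
    let ?m = "zdist p 0"
    have pm: "p \<in> zball 0 (snd (f ?m))" using r[of ?m] by (simp add: zball_def)
    show "fst (f n) p = z p"
    proof (cases "n \<le> ?m")
      case True then show ?thesis using chain[OF True] p by (simp add: agree_def z_def)
    next
      case False then show ?thesis using chain[of ?m n] pm by (simp add: agree_def z_def)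
    qed
  qed
  have "z \<in> X"
  proof -
    have "\<exists>y\<in>X. agree (zball 0 n) z y" for n
      using agree_mono[OF agree_sym[OF zf[of n]] zball_mono[OF r[of n]]] f(1)[of n]
      by auto
    then show ?thesis using cl unfolding limit_closed_def by blast
  qed
  moreover have "z \<notin> Z n" for n using f(1)[of n] zf[of n] by auto
  ultimately show False using cover by blast
qed

section \<open>A normal form for the class L0\<close>

text \<open>
  A configuration carries one H-periodic track for every set H of lattice points and one track
  from C. The alphabet \<open>A H\<close> is a singleton for all but finitely many H, so only finitely many tracks
  matter; indexing by H itself makes the product of two sources a source again, with the two
  H-periodic tracks paired letter by letter. The track of the trivial group is the
  full shift component.
\<close>

definition source :: "((int ^ 'd) set \<Rightarrow> symbol set) \<Rightarrow> (int ^ 'd \<Rightarrow> symbol) set \<Rightarrow>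
    (int ^ 'd \<Rightarrow> ((int ^ 'd) set \<Rightarrow> symbol) \<times> symbol) set" where
  "source A C = {w. (\<forall>H. (\<lambda>p. fst (w p) H) \<in> periodic_shift H (A H)) \<and> (\<lambda>p. snd (w p)) \<in> C}"

definition source_data :: "((int ^ 'd) set \<Rightarrow> symbol set) \<Rightarrow> (int ^ 'd \<Rightarrow> symbol) set \<Rightarrow> bool" where
  "source_data A C \<longleftrightarrow> finite {H. \<not> is_singleton (A H)} \<and>
     (\<forall>H. finite (A H) \<and> (\<not> is_singleton (A H) \<longrightarrow> zsubgroup H)) \<and> subshift C \<and> countable C"

definition tame :: "(int ^ 'd \<Rightarrow> 'b) set \<Rightarrow> bool" where
  "tame Y \<longleftrightarrow> (\<exists>A C. source_data A C \<and> factor_of Y (source A C))"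

lemma continuous_map_into_config_iff:
  "continuous_map T config_topology f \<longleftrightarrow>
     (\<forall>p. continuous_map T (discrete_topology UNIV) (\<lambda>w. f w p))"
  unfolding config_topology_def by (simp add: continuous_map_componentwise_UNIV)

lemma continuous_map_config_eval:
  "continuous_map config_topology (discrete_topology UNIV) (\<lambda>w. w p)"
  unfolding config_topology_def by (rule continuous_map_product_projection) simp

lemma continuous_map_letterwise:
  "continuous_map config_topology config_topology (\<lambda>x p. h (x p))"
  unfolding continuous_map_into_config_iff
proof
  fix p
  have "continuous_map (discrete_topology UNIV) (discrete_topology UNIV) h" by simp
  from continuous_map_compose[OF continuous_map_config_eval[of p] this]
  show "continuous_map config_topology (discrete_topology UNIV) (\<lambda>x. h (x p))"
    by (simp add: o_def)
qed

lemma continuous_map_config_pair: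
  assumes "continuous_map T config_topology f" "continuous_map T config_topology g"
  shows "continuous_map T config_topology (\<lambda>w p. (f w p, g w p))"
  unfolding continuous_map_into_config_iff
proof
  fix p
  have "continuous_map T (prod_topology (discrete_topology UNIV) (discrete_topology UNIV))
      (\<lambda>w. (f w p, g w p))"
    using assms by (simp add: continuous_map_paired continuous_map_into_config_iff)
  then show "continuous_map T (discrete_topology UNIV) (\<lambda>w. (f w p, g w p))"
    by (simp flip: prod_topology_discrete_topology)
qed

lemma factor_ofI:
  assumes "continuous_map (subtopology config_topology X) config_topology f" "f ` X = Y"
    "\<And>x p. x \<in> X \<Longrightarrow> f (shift p x) = shift p (f x)"
  shows "factor_of Y X"
  unfolding factor_of_def
  using assms by (intro exI[of _ f]) (auto simp: continuous_map_in_subtopology)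

lemma factor_of_letterwise:
  assumes "(\<lambda>x p. h (x p)) ` X = Y"
  shows "factor_of Y X"
  by (rule factor_ofI[OF continuous_map_from_subtopology[OF continuous_map_letterwise] assms])
    (simp add: shift_def)

lemma factor_of_trans:
  assumes XY: "factor_of Y X" and ZY: "factor_of Z Y"
  shows "factor_of Z X"
proof -
  obtain f where f: "continuous_map (subtopology config_topology X) (subtopology config_topology Y) f"
      "f ` X = Y" "\<And>x p. x \<in> X \<Longrightarrow> f (shift p x) = shift p (f x)"
    using XY unfolding factor_of_def by blast
  obtain g where g: "continuous_map (subtopology config_topology Y) (subtopology config_topology Z) g"
      "g ` Y = Z" "\<And>y p. y \<in> Y \<Longrightarrow> g (shift p y) = shift p (g y)"
    using ZY unfolding factor_of_def by blast
  have "\<forall>x\<in>X. \<forall>p. (g \<circ> f) (shift p x) = shift p ((g \<circ> f) x)"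
    using f(2,3) g(3) by auto
  moreover have "(g \<circ> f) ` X = Z" using f(2) g(2) by (metis image_comp)
  ultimately show ?thesis
    unfolding factor_of_def using continuous_map_compose[OF f(1) g(1)] by blast
qed

lemma tame_factor: "tame X \<Longrightarrow> factor_of Y X \<Longrightarrow> tame Y"
  unfolding tame_def using factor_of_trans by blast

lemma subshift_const: "subshift {\<lambda>_ :: int ^ 'd. c}"
  unfolding subshift_def closedin_config_iff
  using limit_closed_singleton by (auto intro!: exI[of _ "{c}"] simp: fullshift_def shift_def)

lemma tame_periodic_shift:
  fixes H :: "(int ^ 'd) set" and \<Sigma> :: "symbol set"
  assumes "finite \<Sigma>" "zsubgroup H"
  shows "tame (periodic_shift H \<Sigma>)"
proof -
  let ?A = "\<lambda>K. if K = H then \<Sigma> else {Num 0}" and ?C = "{\<lambda>_ :: int ^ 'd. Num 0}"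
  have "{K. \<not> is_singleton (?A K)} \<subseteq> {H}" by auto
  then have "source_data ?A ?C"
    using assms finite_subset[of _ "{H}"] subshift_const by (auto simp: source_data_def)
  moreover have "factor_of (periodic_shift H \<Sigma>) (source ?A ?C)"
  proof (rule factor_of_letterwise[of "\<lambda>s. fst s H"], intro equalityI subsetI)
    fix x assume "x \<in> (\<lambda>w p. fst (w p) H) ` source ?A ?C"
    then obtain w where w: "w \<in> source ?A ?C" "x = (\<lambda>p. fst (w p) H)" by blast
    then have "(\<lambda>p. fst (w p) H) \<in> periodic_shift H (?A H)" unfolding source_def by blast
    then show "x \<in> periodic_shift H \<Sigma>" by (simp add: w)
  next
    fix x assume x: "x \<in> periodic_shift H \<Sigma>"
    let ?w = "\<lambda>p. (\<lambda>K. if K = H then x p else Num 0, Num 0)"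
    have "(\<lambda>p. fst (?w p) K) \<in> periodic_shift K (?A K)" for K
      using x by (cases "K = H") (auto simp: periodic_shift_def fullshift_def)
    then have "?w \<in> source ?A ?C" by (simp add: source_def)
    then show "x \<in> (\<lambda>w p. fst (w p) H) ` source ?A ?C"
      by (rule rev_image_eqI) simp
  qed
  ultimately show ?thesis unfolding tame_def by blast
qed

lemma fullshift_eq_periodic_shift: "fullshift \<Sigma> = periodic_shift {0} \<Sigma>"
  by (simp add: periodic_shift_def)

lemma tame_countable:
  fixes C :: "(int ^ 'd \<Rightarrow> symbol) set"
  assumes "subshift C" "countable C"
  shows "tame C"
proof -
  have "source_data (\<lambda>_. {Num 0}) C" using assms by (simp add: source_data_def)
  moreover have "factor_of C (source (\<lambda>_. {Num 0}) C)"
  proof (rule factor_of_letterwise[of snd], intro equalityI subsetI)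
    fix x assume x: "x \<in> C"
    have "(\<lambda>p. (\<lambda>_. Num 0, x p)) \<in> source (\<lambda>_. {Num 0}) C"
      using x by (simp add: source_def periodic_shift_def fullshift_def)
    then show "x \<in> (\<lambda>w p. snd (w p)) ` source (\<lambda>_. {Num 0}) C"
      by (rule rev_image_eqI) simp
  qed (auto simp: source_def)
  ultimately show ?thesis unfolding tame_def by blast
qed

lemma subshift_shift: "subshift X \<Longrightarrow> x \<in> X \<Longrightarrow> shift p x \<in> X"
  unfolding subshift_def by blast

lemma subshift_pair:
  fixes C D :: "(int ^ 'd \<Rightarrow> symbol) set"
  assumes "subshift C" "subshift D"
  shows "subshift ((\<lambda>(c, d) p. Word [c p, d p]) ` (C \<times> D))" (is "subshift ?E")
proof -
  obtain \<Sigma> \<Gamma> where fin: "finite \<Sigma>" "C \<subseteq> fullshift \<Sigma>" "finite \<Gamma>" "D \<subseteq> fullshift \<Gamma>"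
    using assms unfolding subshift_def by blast
  have cl: "limit_closed C" "limit_closed D"
    using assms unfolding subshift_def closedin_config_iff by auto
  have "limit_closed ?E"
    unfolding limit_closed_def
  proof (intro allI impI)
    fix x :: "int ^ 'd \<Rightarrow> symbol" assume x: "\<forall>n. \<exists>y\<in>?E. agree (zball 0 n) x y"
    let ?c = "\<lambda>i p. letters (x p) ! i"
    have near: "\<exists>c\<in>C. \<exists>d\<in>D. \<forall>p\<in>zball 0 n. x p = Word [c p, d p]" for n
      using x unfolding agree_def by force
    have "\<exists>y\<in>C. agree (zball 0 n) (?c 0) y" for n
      using near[of n] unfolding agree_def by fastforce
    then have c: "?c 0 \<in> C" using cl(1) unfolding limit_closed_def by blast
    have "\<exists>y\<in>D. agree (zball 0 n) (?c 1) y" for n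
      using near[of n] unfolding agree_def by fastforce
    then have d: "?c 1 \<in> D" using cl(2) unfolding limit_closed_def by blast
    have "x p = Word [?c 0 p, ?c 1 p]" for p
      using near zball_covers[of p] by force
    with c d show "x \<in> ?E" by (intro image_eqI[of _ _ "(?c 0, ?c 1)"]) auto
  qed
  moreover have "?E \<subseteq> fullshift ((\<lambda>(s, t). Word [s, t]) ` (\<Sigma> \<times> \<Gamma>))"
    using fin by (fastforce simp: fullshift_def)
  moreover have "shift p y \<in> ?E" if y: "y \<in> ?E" for p y
  proof -
    obtain c d where cd: "c \<in> C" "d \<in> D" "y = (\<lambda>p. Word [c p, d p])"
      using y by auto
    then have "shift p c \<in> C" "shift p d \<in> D" using assms by (auto intro: subshift_shift)
    then show ?thesis
      by (intro image_eqI[of _ _ "(shift p c, shift p d)"]) (simp_all add: cd shift_def)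
  qed
  moreover have "finite ((\<lambda>(s, t). Word [s, t]) ` (\<Sigma> \<times> \<Gamma>))" using fin by simp
  ultimately show ?thesis
    unfolding subshift_def closedin_config_iff image_subset_iff by blast
qed

text \<open>
  The crucial closure property. Both source configurations are stored in one by pairing letters,
  and a singleton alphabet stays a singleton when paired with a singleton.
\<close>

lemma tame_pair:
  fixes X :: "(int ^ 'd \<Rightarrow> 'a) set" and Y :: "(int ^ 'd \<Rightarrow> 'b) set"
  assumes "tame X" "tame Y"
  shows "tame ((\<lambda>(x, y) p. (x p, y p)) ` (X \<times> Y))"
proof -
  obtain A B C D where src: "source_data A C" "factor_of X (source A C)"
      "source_data B D" "factor_of Y (source B D)"
    using assms unfolding tame_def by blast
  obtain f where f: "continuous_map (subtopology config_topology (source A C)) (subtopology config_topology X) f"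
      "f ` source A C = X" "\<And>w p. w \<in> source A C \<Longrightarrow> f (shift p w) = shift p (f w)"
    using src(2) unfolding factor_of_def by blast
  obtain g where g: "continuous_map (subtopology config_topology (source B D)) (subtopology config_topology Y) g"
      "g ` source B D = Y" "\<And>w p. w \<in> source B D \<Longrightarrow> g (shift p w) = shift p (g w)"
    using src(4) unfolding factor_of_def by blast
  let ?A = "\<lambda>H. (\<lambda>(s, t). Word [s, t]) ` (A H \<times> B H)"
  let ?C = "(\<lambda>(c, d) p. Word [c p, d p]) ` (C \<times> D)"
  let ?S = "source ?A ?C"
  let ?pr = "\<lambda>i w p. (\<lambda>H. letters (fst (w p) H) ! i, letters (snd (w p)) ! i)"
  have data: "source_data ?A ?C"
  proof -
    have sing: "is_singleton (?A H)" if "is_singleton (A H)" "is_singleton (B H)" for H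
      using that by (auto simp: is_singleton_def)
    then have "{H. \<not> is_singleton (?A H)} \<subseteq> {H. \<not> is_singleton (A H)} \<union> {H. \<not> is_singleton (B H)}"
      by auto
    then have "finite {H. \<not> is_singleton (?A H)}"
      using src(1,3) unfolding source_data_def by (meson finite_UnI finite_subset)
    moreover have "zsubgroup H" if "\<not> is_singleton (?A H)" for H
      using that sing src(1,3) unfolding source_data_def by blast
    moreover have "finite (?A H)" for H
      using src(1,3) unfolding source_data_def by simp
    ultimately show ?thesis
      using src(1,3) subshift_pair[of C D] unfolding source_data_def by simp
  qed
  have pr: "?pr 0 w \<in> source A C" "?pr 1 w \<in> source B D" if w: "w \<in> ?S" for w
  proof -
    have "(\<lambda>p. fst (w p) H) \<in> periodic_shift H (?A H)" for H
      using w by (simp add: source_def)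
    then have mem: "fst (w p) H \<in> ?A H" and per: "h \<in> H \<Longrightarrow> fst (w (p + h)) H = fst (w p) H" for p h H
      unfolding periodic_shift_def fullshift_def by blast+
    have comp: "letters (fst (w p) H) ! 0 \<in> A H" "letters (fst (w p) H) ! 1 \<in> B H" for p H
      using mem[of p H] by auto
    have "(\<lambda>p. fst (?pr 0 w p) H) \<in> periodic_shift H (A H) \<and> (\<lambda>p. fst (?pr 1 w p) H) \<in> periodic_shift H (B H)"
      for H using comp per by (simp add: periodic_shift_def fullshift_def)
    moreover obtain c d where "c \<in> C" "d \<in> D" "(\<lambda>p. snd (w p)) = (\<lambda>p. Word [c p, d p])"
      using w by (auto simp: source_def)
    then have "(\<lambda>p. snd (?pr 0 w p)) = c \<and> (\<lambda>p. snd (?pr 1 w p)) = d" by (simp add: fun_eq_iff)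
    ultimately show "?pr 0 w \<in> source A C" "?pr 1 w \<in> source B D"
      using \<open>c \<in> C\<close> \<open>d \<in> D\<close> by (simp_all add: source_def)
  qed
  have cont: "continuous_map (subtopology config_topology ?S) (subtopology config_topology (source A C)) (?pr 0)"
    "continuous_map (subtopology config_topology ?S) (subtopology config_topology (source B D)) (?pr 1)"
    using pr by (auto simp: continuous_map_in_subtopology intro!: continuous_map_from_subtopology
        continuous_map_letterwise[of "\<lambda>s. (\<lambda>H. letters (fst s H) ! _, letters (snd s) ! _)"])
  have sh: "?pr i (shift p w) = shift p (?pr i w)" for i p and w :: "int ^ 'd \<Rightarrow> ((int ^ 'd) set \<Rightarrow> symbol) \<times> symbol"
    by (simp add: shift_def)
  have "factor_of ((\<lambda>(x, y) p. (x p, y p)) ` (X \<times> Y)) ?S"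
  proof (rule factor_ofI)
    have "continuous_map (subtopology config_topology ?S) config_topology (f \<circ> ?pr 0)"
      "continuous_map (subtopology config_topology ?S) config_topology (g \<circ> ?pr 1)"
      using continuous_map_compose[OF cont(1) f(1)] continuous_map_compose[OF cont(2) g(1)]
      by (simp_all add: continuous_map_in_subtopology)
    from continuous_map_config_pair[OF this]
    show "continuous_map (subtopology config_topology ?S) config_topology
        (\<lambda>w p. (f (?pr 0 w) p, g (?pr 1 w) p))" by simp
    show "(\<lambda>w p. (f (?pr 0 w) p, g (?pr 1 w) p)) ` ?S = (\<lambda>(x, y) p. (x p, y p)) ` (X \<times> Y)"
    proof (intro equalityI subsetI)
      fix z assume "z \<in> (\<lambda>w p. (f (?pr 0 w) p, g (?pr 1 w) p)) ` ?S"
      then obtain w where w: "w \<in> ?S" "z = (\<lambda>p. (f (?pr 0 w) p, g (?pr 1 w) p))" by blast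
      have "f (?pr 0 w) \<in> X" "g (?pr 1 w) \<in> Y" using pr[OF w(1)] f(2) g(2) by auto
      with w(2) show "z \<in> (\<lambda>(x, y) p. (x p, y p)) ` (X \<times> Y)"
        by (intro image_eqI[of _ _ "(f (?pr 0 w), g (?pr 1 w))"]) auto
    next
      fix z assume "z \<in> (\<lambda>(x, y) p. (x p, y p)) ` (X \<times> Y)"
      then obtain x y where xy: "x \<in> X" "y \<in> Y" "z = (\<lambda>p. (x p, y p))" by auto
      obtain v w where v: "v \<in> source A C" "f v = x" and w: "w \<in> source B D" "g w = y"
        using xy f(2) g(2) by blast
      let ?j = "\<lambda>p. (\<lambda>H. Word [fst (v p) H, fst (w p) H], Word [snd (v p), snd (w p)])"
      have "(\<lambda>p. fst (?j p) H) \<in> periodic_shift H (?A H)" for H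
        using v(1) w(1) by (simp add: source_def periodic_shift_def fullshift_def image_iff)
      moreover have "(\<lambda>p. snd (?j p)) \<in> ?C"
        using v(1) w(1) by (intro image_eqI[of _ _ "(\<lambda>p. snd (v p), \<lambda>p. snd (w p))"]) (auto simp: source_def)
      ultimately have j: "?j \<in> ?S" unfolding source_def by simp
      have "?pr 0 ?j = v" "?pr 1 ?j = w" by (simp_all add: fun_eq_iff)
      then have "z = (\<lambda>p. (f (?pr 0 ?j) p, g (?pr 1 ?j) p))"
        using xy(3) v(2) w(2) by simp
      then show "z \<in> (\<lambda>w p. (f (?pr 0 w) p, g (?pr 1 w) p)) ` ?S"
        by (rule image_eqI[OF _ j])
    qed
    show "(\<lambda>p. (f (?pr 0 (shift q w)) p, g (?pr 1 (shift q w)) p)) =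
        shift q (\<lambda>p. (f (?pr 0 w) p, g (?pr 1 w) p))" if "w \<in> ?S" for w q
      unfolding sh f(3)[OF pr(1)[OF that]] g(3)[OF pr(2)[OF that]] by (simp add: shift_def)
  qed
  with data show ?thesis unfolding tame_def by blast
qed

lemma tame_product_shift:
  fixes Xs :: "(int ^ 'd \<Rightarrow> symbol) set list"
  assumes "\<And>X. X \<in> set Xs \<Longrightarrow> tame X"
  shows "tame (product_shift Xs)"
  using assms
proof (induction Xs)
  case Nil
  have "product_shift [] = {\<lambda>_ :: int ^ 'd. Word []}"
    by (auto simp: product_shift_def)
  then show ?case using tame_countable[OF subshift_const] by simp
next
  case (Cons X Xs)
  let ?h = "\<lambda>(s, t). Word (s # letters t)"
  let ?P = "(\<lambda>(x, y) p. (x p, y p)) ` (X \<times> product_shift Xs)"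
  have "(\<lambda>z p. ?h (z p)) ` ?P = product_shift (X # Xs)"
  proof (intro equalityI subsetI)
    fix y assume "y \<in> (\<lambda>z p. ?h (z p)) ` ?P"
    then obtain x xs where "x \<in> X" "list_all2 (\<in>) xs Xs" "y = (\<lambda>p. Word (x p # map (\<lambda>x. x p) xs))"
      by (auto simp: product_shift_def)
    then show "y \<in> product_shift (X # Xs)"
      by (auto simp: product_shift_def intro!: exI[of _ "x # xs"])
  next
    fix y assume "y \<in> product_shift (X # Xs)"
    then obtain x xs where xs: "x \<in> X" "list_all2 (\<in>) xs Xs" "y = (\<lambda>p. Word (map (\<lambda>x. x p) (x # xs)))"
      by (auto simp: product_shift_def list_all2_Cons2)
    let ?y = "\<lambda>p. Word (map (\<lambda>x. x p) xs)"
    have "(x, ?y) \<in> X \<times> product_shift Xs" using xs by (auto simp: product_shift_def)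
    then have "(\<lambda>p. (x p, ?y p)) \<in> ?P" by (rule rev_image_eqI) simp
    then show "y \<in> (\<lambda>z p. ?h (z p)) ` ?P" by (rule rev_image_eqI) (simp add: xs)
  qed
  then have "factor_of (product_shift (X # Xs)) ?P" by (rule factor_of_letterwise)
  moreover have "tame ?P" using Cons by (intro tame_pair) auto
  ultimately show ?case by (rule tame_factor[rotated])
qed

theorem L0_imp_tame:
  assumes "X \<in> L0"
  shows "tame X"
  using assms
proof (induction rule: L0.induct)
  case (full \<Sigma>)
  then show ?case
    unfolding fullshift_eq_periodic_shift by (intro tame_periodic_shift) (auto simp: zsubgroup_def)
next
  case (periodic \<Sigma> H) then show ?case by (rule tame_periodic_shift)
next
  case (countable X) then show ?case by (rule tame_countable)
next
  case (product Xs) then show ?case by (intro tame_product_shift) auto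
next
  case (factor X Y) show ?case by (rule tame_factor[OF factor.IH factor.hyps(3)])
qed

lemma source_alphabet:
  assumes "source_data A C"
  shows "\<exists>\<Gamma>. finite \<Gamma> \<and> source A C \<subseteq> fullshift \<Gamma>"
proof -
  obtain \<Sigma> where \<Sigma>: "finite \<Sigma>" "C \<subseteq> fullshift \<Sigma>"
    using assms unfolding source_data_def subshift_def by blast
  let ?S = "{H. \<not> is_singleton (A H)}"
  let ?G = "{a. \<forall>H. a H \<in> A H}"
  have inj: "inj_on (\<lambda>a. restrict a ?S) ?G"
  proof (rule inj_onI)
    fix a b assume ab: "a \<in> ?G" "b \<in> ?G" "restrict a ?S = restrict b ?S"
    have "a H = b H" for H
    proof (cases "is_singleton (A H)")
      case True
      then show ?thesis using ab(1,2) by (auto simp: is_singleton_def) (metis singletonD)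
    next
      case False
      then show ?thesis using fun_cong[OF ab(3), of H] by simp
    qed
    then show "a = b" by auto
  qed
  have "(\<lambda>a. restrict a ?S) ` ?G \<subseteq> Pi\<^sub>E ?S A" by auto
  moreover have "finite (Pi\<^sub>E ?S A)"
    using assms unfolding source_data_def by (intro finite_PiE) auto
  ultimately have "finite ?G" using inj by (meson finite_imageD finite_subset)
  moreover have "source A C \<subseteq> fullshift (?G \<times> \<Sigma>)"
  proof
    fix w assume "w \<in> source A C"
    then have "(\<forall>p H. fst (w p) H \<in> A H) \<and> (\<forall>p. snd (w p) \<in> \<Sigma>)"
      using \<Sigma>(2) by (auto simp: source_def periodic_shift_def fullshift_def)
    then show "w \<in> fullshift (?G \<times> \<Sigma>)" by (auto simp: fullshift_def mem_Times_iff)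
  qed
  ultimately show ?thesis
    using \<Sigma>(1) by (intro exI[of _ "?G \<times> \<Sigma>"] conjI finite_cartesian_product)
qed

lemma limit_closed_source:
  fixes A :: "(int ^ 'd) set \<Rightarrow> symbol set"
  assumes "source_data A C"
  shows "limit_closed (source A C)"
  unfolding limit_closed_def
proof (intro allI impI)
  fix w :: "int ^ 'd \<Rightarrow> ((int ^ 'd) set \<Rightarrow> symbol) \<times> symbol"
  assume w: "\<forall>n. \<exists>y\<in>source A C. agree (zball 0 n) w y"
  have two: "\<exists>y\<in>source A C. w p = y p \<and> w q = y q" for p q
  proof -
    obtain n where "{p, q} \<subseteq> zball 0 n" using finite_subset_zball[of "{p, q}"] by blast
    then show ?thesis using w unfolding agree_def by (metis insert_subset)
  qed
  have "(\<lambda>p. fst (w p) H) \<in> periodic_shift H (A H)" for H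
    unfolding periodic_shift_def fullshift_def
  proof (intro CollectI conjI allI ballI)
    show "fst (w p) H \<in> A H" for p
      using two[of p p] by (auto simp: source_def periodic_shift_def fullshift_def)
    show "fst (w (p + h)) H = fst (w p) H" if "h \<in> H" for p h
      using two[of "p + h" p] that by (auto simp: source_def periodic_shift_def)
  qed
  moreover have "(\<lambda>p. snd (w p)) \<in> C"
  proof -
    have "limit_closed C"
      using assms unfolding source_data_def subshift_def closedin_config_iff by blast
    moreover have "\<exists>c\<in>C. agree (zball 0 n) (\<lambda>p. snd (w p)) c" for n
    proof -
      obtain y where "y \<in> source A C" "agree (zball 0 n) w y" using w by blast
      then show ?thesis by (intro bexI[of _ "\<lambda>p. snd (y p)"]) (auto simp: agree_def source_def)
    qed
    ultimately show ?thesis unfolding limit_closed_def by blast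
  qed
  ultimately show "w \<in> source A C" by (simp add: source_def)
qed

lemma source_shift:
  assumes "source_data A C" "w \<in> source A C"
  shows "shift p w \<in> source A C"
proof -
  have "shift p (\<lambda>q. snd (w q)) \<in> C"
    using assms unfolding source_data_def subshift_def source_def by blast
  moreover have "(\<lambda>q. fst (shift p w q) H) \<in> periodic_shift H (A H)" for H
    using assms(2) by (simp add: source_def periodic_shift_def fullshift_def shift_def add.assoc[symmetric])
  ultimately show ?thesis by (simp add: source_def shift_def)
qed

text \<open>
  The theorem of Curtis, Hedlund and Lyndon. Without a uniform radius there would be pairs of
  configurations that agree on larger and larger balls but have different images at 0; both
  cluster at the same point, where continuity fails.
\<close>

lemma sliding_block_code:
  fixes f :: "(int ^ 'd \<Rightarrow> 'a) \<Rightarrow> int ^ 'd \<Rightarrow> 'b"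
  assumes fin: "finite \<Gamma>" "W \<subseteq> fullshift \<Gamma>" and cl: "limit_closed W"
    and inv: "\<And>w p. w \<in> W \<Longrightarrow> shift p w \<in> W"
    and cont: "continuous_map (subtopology config_topology W) (subtopology config_topology Y) f"
    and eq: "\<And>w p. w \<in> W \<Longrightarrow> f (shift p w) = shift p (f w)"
  obtains R where "\<And>w w' q. w \<in> W \<Longrightarrow> w' \<in> W \<Longrightarrow> agree (zball q R) w w' \<Longrightarrow> f w q = f w' q"
proof -
  have pointwise: "\<exists>n. \<forall>w'\<in>W. agree (zball 0 n) w w' \<longrightarrow> f w' 0 = f w 0" if w: "w \<in> W" for w
  proof -
    have "continuous_map (subtopology config_topology W) (discrete_topology UNIV) (\<lambda>w. f w 0)"
      using cont unfolding continuous_map_in_subtopology continuous_map_into_config_iff by blast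
    then have "openin (subtopology config_topology W) {w' \<in> W. f w' 0 = f w 0}"
      using openin_continuous_map_preimage[of "subtopology config_topology W" "discrete_topology UNIV" "\<lambda>w. f w 0" "{f w 0}"]
      by simp
    then obtain U where U: "openin config_topology U" "{w' \<in> W. f w' 0 = f w 0} = U \<inter> W"
      unfolding openin_subtopology by blast
    have "w \<in> U" using U(2) w by blast
    from openin_config_contains_cylinder[OF U(1) this] obtain n
      where "\<forall>y. agree (zball 0 n) w y \<longrightarrow> y \<in> U" by blast
    then show ?thesis using U(2) by blast
  qed
  have "\<exists>R. \<forall>w\<in>W. \<forall>w'\<in>W. agree (zball 0 R) w w' \<longrightarrow> f w 0 = f w' 0"
  proof (rule ccontr)
    assume "\<not> ?thesis"
    then have "\<forall>R. \<exists>w w'. w \<in> W \<and> w' \<in> W \<and> agree (zball 0 R) w w' \<and> f w 0 \<noteq> f w' 0" by blast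
    then obtain u v where uv: "\<And>R. u R \<in> W" "\<And>R. v R \<in> W" "\<And>R. agree (zball 0 R) (u R) (v R)"
      "\<And>R. f (u R) 0 \<noteq> f (v R) 0" by metis
    obtain z where z: "\<And>n N. \<exists>k\<ge>N. agree (zball 0 n) z (u k)"
      using cluster_point[OF fin(1), of u] uv(1) fin(2) by blast
    then have "z \<in> W" using cl uv(1) unfolding limit_closed_def by blast
    from pointwise[OF this] obtain n where n: "\<And>w'. w' \<in> W \<Longrightarrow> agree (zball 0 n) z w' \<Longrightarrow> f w' 0 = f z 0"
      by blast
    obtain k where k: "k \<ge> n" "agree (zball 0 n) z (u k)" using z by blast
    then have "agree (zball 0 n) z (v k)"
      using agree_mono[OF uv(3) zball_mono[OF k(1)]] agree_trans by blast
    then show False using n[OF uv(1) k(2)] n[OF uv(2)[of k]] uv(4)[of k] by simp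
  qed
  then obtain R where R: "\<And>w w'. w \<in> W \<Longrightarrow> w' \<in> W \<Longrightarrow> agree (zball 0 R) w w' \<Longrightarrow> f w 0 = f w' 0"
    by blast
  show thesis
  proof (rule that)
    fix w w' q assume w: "w \<in> W" "w' \<in> W" "agree (zball q R) w w'"
    have "agree (zball 0 R) (shift q w) (shift q w')"
      using w(3) by (simp add: agree_def shift_def mem_zball_iff)
    from R[OF inv[OF w(1)] inv[OF w(2)] this] show "f w q = f w' q"
      using eq[OF w(1), of q] eq[OF w(2), of q] by (simp add: shift_def)
  qed
qed

section \<open>Mixing windows, periodic points and independent vectors\<close>

text \<open>
  The displacement p depends only on the sizes of the windows. This uniformity is what allows
  a single limit to serve all points of X later on.
\<close>

lemma mixing_two_windows:
  fixes X :: "(int ^ 'd \<Rightarrow> 'a) set"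
  assumes X: "mixing X" and inv: "\<And>x p. x \<in> X \<Longrightarrow> shift p x \<in> X"
  shows "\<exists>p. \<forall>x\<in>X. \<forall>z\<in>X. \<exists>y\<in>X. agree (zball 0 n) x y \<and> agree (zball 0 k) z (shift p y)"
proof -
  obtain N :: nat where N: "\<And>F G. diam F \<le> enat (2 * n + 2 * k) \<Longrightarrow> diam G \<le> enat (2 * n + 2 * k) \<Longrightarrow>
      region_dist F G \<ge> enat N \<Longrightarrow> independent_regions X F G"
    using X unfolding mixing_def by metis
  define p :: "int ^ 'd" where "p = (\<chi> i. int (N + n + k))"
  let ?F = "zball 0 n :: (int ^ 'd) set" and ?G = "zball p k"
  have diam: "diam (zball q j) \<le> enat (2 * n + 2 * k)" if "j \<le> n + k" for q :: "int ^ 'd" and j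
  proof -
    have "zdist a b \<le> 2 * n + 2 * k" if "a \<in> zball q j" "b \<in> zball q j" for a b
      unfolding zdist_le_iff
    proof
      fix i
      have "\<bar>a $ i - q $ i\<bar> \<le> int j" "\<bar>b $ i - q $ i\<bar> \<le> int j" using that by (auto simp: mem_zball_iff)
      then show "\<bar>a $ i - b $ i\<bar> \<le> int (2 * n + 2 * k)" using \<open>j \<le> n + k\<close> by linarith
    qed
    then show ?thesis unfolding diam_def by (intro SUP_least) simp
  qed
  have "N \<le> zdist a b" if "a \<in> ?F" "b \<in> ?G" for a b
  proof -
    fix i :: 'd
    have "\<bar>a $ i - b $ i\<bar> \<le> int (zdist a b)" using zdist_le_iff[of a b "zdist a b"] by simp
    moreover have "\<bar>a $ i\<bar> \<le> int n" "\<bar>b $ i - int (N + n + k)\<bar> \<le> int k"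
      using that by (auto simp: mem_zball_iff p_def)
    ultimately show ?thesis by linarith
  qed
  then have "region_dist ?F ?G \<ge> enat N" unfolding region_dist_def by (intro INF_greatest) simp
  with N diam have ind: "independent_regions X ?F ?G" by simp
  have "\<exists>y\<in>X. agree ?F x y \<and> agree (zball 0 k) z (shift p y)" if x: "x \<in> X" and z: "z \<in> X" for x z
  proof -
    let ?\<pi> = "\<lambda>q. if q \<in> ?F then Some (x q) else None"
    let ?\<rho> = "\<lambda>q. if q \<in> ?G then Some (z (- p + q)) else None"
    have dom: "dom ?\<pi> = ?F" "dom ?\<rho> = ?G" by (auto split: if_splits)
    have "valid X ?\<pi>"
      unfolding valid_def appears_def dom using x by (intro bexI[of _ x] exI[of _ 0]) auto
    moreover have "valid X ?\<rho>"
      unfolding valid_def appears_def dom using z by (intro bexI[of _ z] exI[of _ "- p"]) auto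
    ultimately have "valid X (?\<pi> ++ ?\<rho>)" using ind dom unfolding independent_regions_def by blast
    then obtain y q where y: "y \<in> X" "appears (?\<pi> ++ ?\<rho>) q y" unfolding valid_def by blast
    have disj: "?F \<inter> ?G = {}" using ind unfolding independent_regions_def by blast
    have val: "(?\<pi> ++ ?\<rho>) s = Some (y (q + s))" if "s \<in> ?F \<union> ?G" for s
      using y(2) that unfolding appears_def dom_map_add dom by blast
    have "agree ?F x (shift q y)"
      unfolding agree_def shift_def
    proof
      fix s assume s: "s \<in> ?F"
      then have "s \<notin> ?G" using disj by blast
      then show "x s = y (q + s)" using val[of s] s by (simp add: map_add_def)
    qed
    moreover have "agree (zball 0 k) z (shift p (shift q y))"
      unfolding agree_def shift_def
    proof
      fix s :: "int ^ 'd" assume s: "s \<in> zball 0 k"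
      then have "p + s \<in> ?G" by (simp add: mem_zball_iff)
      then show "z s = y (q + (p + s))" using val[of "p + s"] by (simp add: map_add_def)
    qed
    ultimately show ?thesis using inv[OF y(1)] by blast
  qed
  then show ?thesis by blast
qed

text \<open>
  Countability replaces Zorn's lemma: it suffices to decide, one point of D after the other,
  whether a subsystem can avoid it. A proper subsystem of the intersection would avoid some point k,
  which step k would then have dropped.
\<close>

lemma countable_minimal_system:
  fixes D :: "(int ^ 'd \<Rightarrow> 'a) set"
  assumes fin: "finite \<Sigma>" "D \<subseteq> fullshift \<Sigma>" and D: "limit_closed D" "countable D" "D \<noteq> {}"
    and inv: "\<And>c. c \<in> D \<Longrightarrow> shift u c \<in> D"
  obtains M where "M \<subseteq> D" "limit_closed M" "M \<noteq> {}" "\<And>c. c \<in> M \<Longrightarrow> shift u c \<in> M"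
    "\<And>N. N \<subseteq> M \<Longrightarrow> limit_closed N \<Longrightarrow> N \<noteq> {} \<Longrightarrow> (\<And>c. c \<in> N \<Longrightarrow> shift u c \<in> N) \<Longrightarrow> N = M"
proof -
  define sys where "sys M \<longleftrightarrow> limit_closed M \<and> M \<noteq> {} \<and> (\<forall>c\<in>M. shift u c \<in> M)"
    for M :: "(int ^ 'd \<Rightarrow> 'a) set"
  let ?e = "from_nat_into D"
  let ?av = "\<lambda>k M M'. M' \<subseteq> M \<and> sys M' \<and> ?e k \<notin> M'"
  \<comment> \<open>Step k drops the k-th point of D whenever some subsystem avoids it.\<close>
  define S where "S = rec_nat D (\<lambda>k M. if \<exists>M'. ?av k M M' then SOME M'. ?av k M M' else M)"
  have S0: "S 0 = D" by (simp add: S_def)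
  have SSuc: "S (Suc k) = (if \<exists>M'. ?av k (S k) M' then SOME M'. ?av k (S k) M' else S k)" for k
    unfolding S_def by simp
  have av: "?av k (S k) (S (Suc k))" if "\<exists>M'. ?av k (S k) M'" for k
    unfolding SSuc if_P[OF that] by (rule someI_ex[OF that])
  have same: "S (Suc k) = S k" if "\<not> (\<exists>M'. ?av k (S k) M')" for k
    unfolding SSuc by (rule if_not_P[OF that])
  have sysD: "sys D" using D inv by (simp add: sys_def)
  have S: "sys (S k)" for k
  proof (induction k)
    case 0 show ?case by (simp add: S0 sysD)
  next
    case (Suc k) then show ?case using av[of k] same[of k] by metis
  qed
  have "S (Suc k) \<subseteq> S k" for k using av[of k] same[of k] by (metis order_refl)
  then have dec: "S m \<subseteq> S k" if "k \<le> m" for k m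
    using that by (rule lift_Suc_antimono_le)
  define M where "M = (\<Inter>k. S k)"
  have MD: "M \<subseteq> D" using S0 by (auto simp: M_def)
  have lM: "limit_closed M"
    using S unfolding M_def sys_def limit_closed_def by (metis INT_iff)
  have "M \<noteq> {}"
  proof -
    have "\<forall>k. \<exists>x. x \<in> S k" using S unfolding sys_def by blast
    then obtain x where x: "\<And>k. x k \<in> S k" by metis
    have "x k \<in> fullshift \<Sigma>" for k using x[of k] dec[of 0 k] S0 fin(2) by auto
    then obtain z where z: "\<And>n N. \<exists>k\<ge>N. agree (zball 0 n) z (x k)"
      using cluster_point[OF fin(1)] by blast
    have "z \<in> S k" for k
    proof -
      have "\<exists>y\<in>S k. agree (zball 0 n) z y" for n
        using z[of k n] x dec by blast
      then show ?thesis using S[of k] unfolding sys_def limit_closed_def by blast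
    qed
    then show ?thesis by (auto simp: M_def)
  qed
  moreover have "shift u c \<in> M" if "c \<in> M" for c
    using that S unfolding M_def sys_def by blast
  moreover have "N = M" if N: "N \<subseteq> M" "limit_closed N" "N \<noteq> {}" "\<And>c. c \<in> N \<Longrightarrow> shift u c \<in> N" for N
  proof (rule ccontr)
    assume "N \<noteq> M"
    then obtain c where c: "c \<in> M" "c \<notin> N" using N(1) by blast
    then obtain k where k: "c = ?e k"
      using MD D(2) by (metis from_nat_into_surj subsetD)
    have "?av k (S k) N" using N c k unfolding sys_def M_def by blast
    then have "c \<notin> S (Suc k)" using av[of k] k by blast
    then show False using c(1) unfolding M_def by blast
  qed
  ultimately show thesis using that MD lM by blast
qed

text \<open>
  By Baire a countable minimal system has an isolated point c. The limit points of the forward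
  orbit of c form a subsystem, hence everything, so c is one of them, and the orbit must return to
  c itself.
\<close>

lemma countable_system_has_periodic_point:
  fixes D :: "(int ^ 'd \<Rightarrow> 'a) set"
  assumes fin: "finite \<Sigma>" "D \<subseteq> fullshift \<Sigma>" and D: "limit_closed D" "countable D" "D \<noteq> {}"
    and inv: "\<And>c. c \<in> D \<Longrightarrow> shift u c \<in> D"
  obtains c n where "c \<in> D" "n > 0" "shift (int n *s u) c = c"
proof -
  obtain M where M: "M \<subseteq> D" "limit_closed M" "M \<noteq> {}" "\<And>c. c \<in> M \<Longrightarrow> shift u c \<in> M"
    and min: "\<And>N. N \<subseteq> M \<Longrightarrow> limit_closed N \<Longrightarrow> N \<noteq> {} \<Longrightarrow> (\<And>c. c \<in> N \<Longrightarrow> shift u c \<in> N) \<Longrightarrow> N = M"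
    using countable_minimal_system[OF assms] by metis
  have "M \<subseteq> (\<Union>k. {from_nat_into D k})"
    using M(1) D(2) by (auto simp: image_iff) (metis from_nat_into_surj subsetD)
  from countable_cover_contains_cylinder[OF M(2,3) limit_closed_singleton this]
  obtain c r where c: "c \<in> M" and iso: "\<And>y. y \<in> M \<Longrightarrow> agree (zball 0 r) c y \<Longrightarrow> y = c"
    by (metis agree_refl singletonD)
  \<comment> \<open>Positive times only, so that membership of c itself means a return.\<close>
  define N where "N = {y. \<forall>n. \<exists>j. j > 0 \<and> agree (zball 0 n) y (shift (int j *s u) c)}"
  have orbit: "shift (int j *s u) c \<in> M" for j
  proof (induction j)
    case 0 show ?case using c by (simp add: shift_0)
  next
    case (Suc j)
    have "shift (int (Suc j) *s u) c = shift u (shift (int j *s u) c)"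
      by (simp add: shift_shift vector_sadd_rdistrib add.commute)
    then show ?case using M(4)[OF Suc] by simp
  qed
  have "N = M"
  proof (rule min)
    show "N \<subseteq> M"
    proof
      fix y assume "y \<in> N"
      then have "\<exists>x\<in>M. agree (zball 0 n) y x" for n using orbit unfolding N_def by blast
      then show "y \<in> M" using M(2) unfolding limit_closed_def by blast
    qed
    show "limit_closed N"
      unfolding limit_closed_def
    proof (intro allI impI)
      fix x :: "int ^ 'd \<Rightarrow> 'a" assume "\<forall>n. \<exists>y\<in>N. agree (zball 0 n) x y"
      then show "x \<in> N" unfolding N_def using agree_trans by blast
    qed
    have "shift (int 1 *s u) c \<in> N" unfolding N_def using agree_refl zero_less_one by blast
    then show "N \<noteq> {}" by blast
    show "shift u y \<in> N" if y: "y \<in> N" for y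
      unfolding N_def
    proof (intro CollectI allI)
      fix n
      obtain k where k: "u \<in> zball 0 k" using zball_covers by blast
      obtain j where j: "j > 0" "agree (zball 0 (k + n)) y (shift (int j *s u) c)"
        using y unfolding N_def by blast
      have "agree (zball 0 n) (shift u y) (shift (int (Suc j) *s u) c)"
        unfolding agree_def
      proof
        fix q :: "int ^ 'd" assume "q \<in> zball 0 n"
        then have "u + q \<in> zball u n" by (simp add: mem_zball_iff)
        then have "u + q \<in> zball 0 (k + n)" using zball_trans[OF k] by blast
        then have "y (u + q) = c (int j *s u + (u + q))"
          using j(2) by (simp add: agree_def shift_def)
        then show "shift u y q = shift (int (Suc j) *s u) c q"
          by (simp add: shift_def vector_sadd_rdistrib ac_simps)
      qed
      then show "\<exists>j. j > 0 \<and> agree (zball 0 n) (shift u y) (shift (int j *s u) c)" by blast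
    qed
  qed
  then obtain j where "j > 0" "agree (zball 0 r) c (shift (int j *s u) c)" using c unfolding N_def by blast
  then show thesis using that[of c j] iso[OF orbit] c M(1) by blast
qed

lemma zsubgroup_scale:
  assumes "zsubgroup H" "g \<in> H"
  shows "(k :: int) *s g \<in> H"
proof -
  have nat: "int n *s g \<in> H" for n
  proof (induction n)
    case 0 show ?case using assms by (simp add: zsubgroup_def)
  next
    case (Suc n)
    have "int (Suc n) *s g = g + int n *s g" by (simp add: vector_sadd_rdistrib)
    then show ?case using Suc assms by (simp add: zsubgroup_def)
  qed
  show ?thesis
  proof (cases "k \<ge> 0")
    case True then show ?thesis using nat[of "nat k"] by simp
  next
    case False
    have "k *s g = - (int (nat (- k)) *s g)" using False by (simp add: vec_eq_iff)
    then show ?thesis using nat[of "nat (- k)"] assms(1) by (simp add: zsubgroup_def)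
  qed
qed

lemma zsubgroup_periods: "zsubgroup {h. shift h c = c}"
proof -
  have "shift (- h) c = c" if "shift h c = c" for h
    using arg_cong[OF that, of "shift (- h)"] by (simp add: shift_shift shift_0)
  moreover have "shift (g + h) c = c" if "shift g c = c" "shift h c = c" for g h
    using that by (metis shift_shift)
  ultimately show ?thesis by (auto simp: zsubgroup_def shift_0)
qed

text \<open>
  Ramification by finite patterns. Van der Waerden's theorem only makes finite windows recur,
  hence the finiteness of F in what follows.
\<close>

definition finitely_ramified :: "(int ^ 2 \<Rightarrow> 'a) set \<Rightarrow> bool" where
  "finitely_ramified X \<longleftrightarrow>
     (\<forall>r. \<exists>V. infinite V \<and> pairwise independent_vectors V \<and>
        (\<forall>v\<in>V. \<exists>x u F. finite F \<and> ramification X r v x u F))"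

lemma finitely_ramified_imp_ramified: "finitely_ramified X \<Longrightarrow> ramified X"
  unfolding finitely_ramified_def ramified_def by meson

definition det2 :: "int ^ 2 \<Rightarrow> int ^ 2 \<Rightarrow> int" where
  "det2 v w = v $ 1 * w $ 2 - v $ 2 * w $ 1"

lemma det2_nonzero:
  assumes "independent_vectors v w"
  shows "det2 v w \<noteq> 0"
proof
  assume 0: "det2 v w = 0"
  have ind: "l = 0 \<and> m = 0" if "l *s v + m *s w = 0" for l m
    using assms that unfolding independent_vectors_def by blast
  have "w $ 2 *s v + (- (v $ 2)) *s w = 0" "w $ 1 *s v + (- (v $ 1)) *s w = 0"
    using 0 by (simp_all add: det2_def vec_eq_iff forall_2 algebra_simps)
  then have "w $ 2 = 0 \<and> v $ 2 = 0" "w $ 1 = 0 \<and> v $ 1 = 0" using ind by force+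
  then have "1 *s v + 1 *s w = 0" by (simp add: vec_eq_iff forall_2)
  then show False using ind[of 1 1] by simp
qed

lemma cramer2: "det2 v g *s u = det2 u g *s v + det2 v u *s g"
  by (simp add: vec_eq_iff forall_2 det2_def algebra_simps)

text \<open>
  Dependence on a common nonzero vector g makes two vectors of the plane dependent on each
  other, so every g excludes at most one element of V.
\<close>

lemma independent_of_finitely_many:
  assumes V: "infinite V" "pairwise independent_vectors V" and G: "finite G" "0 \<notin> G"
  shows "\<exists>v\<in>V. \<forall>g\<in>G. independent_vectors v g"
proof (rule ccontr)
  assume "\<not> ?thesis"
  then have "\<forall>v\<in>V. \<exists>g\<in>G. \<not> independent_vectors v g" by blast
  then obtain h where h: "\<And>v. v \<in> V \<Longrightarrow> h v \<in> G" "\<And>v. v \<in> V \<Longrightarrow> \<not> independent_vectors v (h v)"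
    by metis
  have "\<not> inj_on h V" using V(1) G(1) h(1) by (meson finite_imageD finite_subset image_subsetI)
  then obtain v w where vw: "v \<in> V" "w \<in> V" "v \<noteq> w" "h v = h w" by (auto simp: inj_on_def)
  have dep: "\<exists>a b. a \<noteq> 0 \<and> a *s x + b *s h v = 0" if x: "x \<in> V" "h x = h v" for x
  proof -
    obtain a b where ab: "a *s x + b *s h v = 0" "\<not> (a = 0 \<and> b = 0)"
      using h(2)[OF x(1)] x(2) unfolding independent_vectors_def by auto
    have "a \<noteq> 0"
    proof
      assume "a = 0"
      then have "b *s h v = 0" "b \<noteq> 0" using ab by auto
      then have "h v = 0" by (simp add: vec_eq_iff)
      then show False using G(2) h(1)[OF vw(1)] by simp
    qed
    then show ?thesis using ab by blast
  qed
  obtain a b where ab: "a \<noteq> 0" "a *s v + b *s h v = 0" using dep[OF vw(1)] by auto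
  obtain c d where cd: "c \<noteq> 0" "c *s w + d *s h v = 0" using dep[OF vw(2)] vw(4) by auto
  have ind: "l = 0 \<and> m = 0" if "l *s v + m *s w = 0" for l m
    using V(2) vw that unfolding pairwise_def independent_vectors_def by blast
  have "(d * a) *s v + (- b * c) *s w = d *s (a *s v + b *s h v) - b *s (c *s w + d *s h v)"
    by (simp add: vec_eq_iff algebra_simps)
  then have "d * a = 0 \<and> - b * c = 0" using ind ab(2) cd(2) by (metis diff_zero vector_smult_rzero)
  then have "a *s v + 0 *s w = 0" using ab cd by simp
  then show False using ind ab(1) by blast
qed

section \<open>Mixing finitely ramified subshifts are not tame\<close>

definition local_map :: "nat \<Rightarrow> (int ^ 'd \<Rightarrow> 'a) set \<Rightarrow> ((int ^ 'd \<Rightarrow> 'a) \<Rightarrow> int ^ 'd \<Rightarrow> 'b) \<Rightarrow> bool" where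
  "local_map R W f \<longleftrightarrow> (\<forall>w\<in>W. \<forall>w'\<in>W. \<forall>q. agree (zball q R) w w' \<longrightarrow> f w q = f w' q)"

text \<open>
  The part of the image that is reached while the second track is held at c.
\<close>

definition layer :: "((int ^ 'd \<Rightarrow> 'a \<times> 'c) \<Rightarrow> int ^ 'd \<Rightarrow> 'b) \<Rightarrow> (int ^ 'd \<Rightarrow> 'a \<times> 'c) set \<Rightarrow>
    (int ^ 'd \<Rightarrow> 'c) \<Rightarrow> (int ^ 'd \<Rightarrow> 'b) set" where
  "layer f W c = f ` {w \<in> W. (\<lambda>p. snd (w p)) = c}"

lemma layerI: "w \<in> W \<Longrightarrow> (\<lambda>p. snd (w p)) = c \<Longrightarrow> f w = y \<Longrightarrow> y \<in> layer f W c"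
  unfolding layer_def by (rule image_eqI[of _ _ w]) simp_all

lemma layerE:
  assumes "y \<in> layer f W c"
  obtains w where "w \<in> W" "(\<lambda>p. snd (w p)) = c" "f w = y"
  using assms unfolding layer_def by blast

text \<open>
  Layers depend upper semicontinuously on c, by compactness. This serves both to see that each
  layer is closed and to pass to a limit of layers.
\<close>

lemma layer_limit:
  fixes f :: "(int ^ 'd \<Rightarrow> 'a \<times> 'c) \<Rightarrow> int ^ 'd \<Rightarrow> 'b"
  assumes fin: "finite \<Gamma>" "W \<subseteq> fullshift \<Gamma>" and cl: "limit_closed W" and f: "local_map R W f"
    and near: "\<And>n. \<exists>d. \<exists>y\<in>layer f W d. agree (zball 0 n) c d \<and> agree (zball 0 n) x y"
  shows "x \<in> layer f W c"
proof -
  have "\<exists>w\<in>W. agree (zball 0 n) c (\<lambda>p. snd (w p)) \<and> agree (zball 0 n) x (f w)" for n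
    using near[of n] unfolding layer_def by blast
  then obtain w where w: "\<And>n. w n \<in> W" "\<And>n. agree (zball 0 n) c (\<lambda>p. snd (w n p))"
    "\<And>n. agree (zball 0 n) x (f (w n))" by metis
  obtain z where z: "\<And>n N. \<exists>k\<ge>N. agree (zball 0 n) z (w k)"
    using cluster_point[OF fin(1), of w] w(1) fin(2) by blast
  then have zW: "z \<in> W" using cl w(1) unfolding limit_closed_def by blast
  have "snd (z q) = c q \<and> f z q = x q" for q
  proof -
    obtain n where q: "q \<in> zball 0 n" using zball_covers by blast
    obtain k where k: "k \<ge> n + R" "agree (zball 0 (n + R)) z (w k)" using z by blast
    have "zball q R \<subseteq> zball 0 (n + R)" using zball_trans[OF q] by blast
    then have "agree (zball q R) z (w k)" using k(2) agree_mono by blast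
    then have "f z q = f (w k) q" using f zW w(1) unfolding local_map_def by blast
    moreover have "z q = w k q" using k(2) q zball_mono[of n "n + R" 0] unfolding agree_def by auto
    moreover have "q \<in> zball 0 k" using q k(1) zball_mono[of n k 0] by auto
    ultimately show ?thesis using w(2,3)[of k] unfolding agree_def by simp
  qed
  then have "(\<lambda>p. snd (z p)) = c" "f z = x" by auto
  then show ?thesis using zW by (intro layerI)
qed

text \<open>
  Some layer contains a cylinder, by Baire. Translated by \<open>- p n\<close>, it becomes the layer of a
  translated c, and as the cylinder now constrains only a distant window, this layer comes within any
  prescribed accuracy of every point of X. A cluster point d of the translates of c works.
\<close>

lemma surjective_layer:
  fixes f :: "(int ^ 'd \<Rightarrow> 'a \<times> 'c) \<Rightarrow> int ^ 'd \<Rightarrow> 'b"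
  assumes fin: "finite \<Gamma>" "W \<subseteq> fullshift \<Gamma>" and cl: "limit_closed W" and f: "local_map R W f"
    and invW: "\<And>w p. w \<in> W \<Longrightarrow> shift p w \<in> W"
    and eq: "\<And>w p. w \<in> W \<Longrightarrow> f (shift p w) = shift p (f w)"
    and C: "subshift C" "countable C" "\<And>w. w \<in> W \<Longrightarrow> (\<lambda>p. snd (w p)) \<in> C"
    and X: "f ` W = X" "limit_closed X" "X \<noteq> {}" "mixing X"
  shows "\<exists>c\<in>C. X \<subseteq> layer f W c"
proof -
  have sub: "layer f W c \<subseteq> X" for c using X(1) by (auto simp: layer_def)
  have invX: "shift p x \<in> X" if "x \<in> X" for x p using that X(1) eq invW by (metis imageE imageI)
  have shl: "shift p y \<in> layer f W (shift p c)" if y: "y \<in> layer f W c" for y c p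
  proof -
    obtain w where w: "w \<in> W" "(\<lambda>p. snd (w p)) = c" "f w = y" using y by (rule layerE)
    then have "shift p w \<in> W" "f (shift p w) = shift p y" "(\<lambda>q. snd (shift p w q)) = shift p c"
      using invW eq by (auto simp: shift_def)
    then show ?thesis by (intro layerI)
  qed
  have ne: "C \<noteq> {}" using C(3) X(1,3) by blast
  have "limit_closed (layer f W c)" for c
    unfolding limit_closed_def
  proof (intro allI impI layer_limit[OF fin cl f])
    fix x n assume "\<forall>n. \<exists>y\<in>layer f W c. agree (zball 0 n) x y"
    then show "\<exists>d. \<exists>y\<in>layer f W d. agree (zball 0 n) c d \<and> agree (zball 0 n) x y"
      using agree_refl by blast
  qed
  moreover have "X \<subseteq> (\<Union>k. layer f W (from_nat_into C k))"
  proof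
    fix x assume "x \<in> X"
    then obtain w where w: "w \<in> W" "f w = x" using X(1) by blast
    obtain k where "from_nat_into C k = (\<lambda>p. snd (w p))"
      using C(2,3) w(1) from_nat_into_surj by metis
    then have "x \<in> layer f W (from_nat_into C k)" using w by (intro layerI[of w]) simp_all
    then show "x \<in> (\<Union>k. layer f W (from_nat_into C k))" by blast
  qed
  ultimately obtain k z r where zr: "z \<in> X" "\<And>y. y \<in> X \<Longrightarrow> agree (zball 0 r) z y \<Longrightarrow> y \<in> layer f W (from_nat_into C k)"
    using countable_cover_contains_cylinder[OF X(2,3), of "\<lambda>k. layer f W (from_nat_into C k)"] by blast
  let ?c = "from_nat_into C k"
  have cC: "?c \<in> C" using ne by (rule from_nat_into)
  obtain p where p: "\<And>n x. x \<in> X \<Longrightarrow> \<exists>y\<in>X. agree (zball 0 n) x y \<and> agree (zball 0 r) z (shift (p n) y)"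
    using mixing_two_windows[OF X(4) invX, of _ r] zr(1) by metis
  have far: "\<exists>y\<in>layer f W (shift (- p n) ?c). agree (zball 0 n) x y" if x: "x \<in> X" for n x
  proof -
    obtain y where y: "y \<in> X" "agree (zball 0 n) x y" "agree (zball 0 r) z (shift (p n) y)"
      using p[OF x] by blast
    have "shift (- p n) (shift (p n) y) \<in> layer f W (shift (- p n) ?c)"
      using zr(2)[OF invX[OF y(1)] y(3)] by (rule shl)
    then show ?thesis using y(2) by (auto simp: shift_shift shift_0)
  qed
  obtain \<Sigma> where \<Sigma>: "finite \<Sigma>" "C \<subseteq> fullshift \<Sigma>" using C(1) unfolding subshift_def by blast
  have dC: "shift (- p n) ?c \<in> C" for n using C(1) cC by (rule subshift_shift)
  obtain d where d: "\<And>n N. \<exists>k\<ge>N. agree (zball 0 n) d (shift (- p k) ?c)"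
    using cluster_point[OF \<Sigma>(1), of "\<lambda>n. shift (- p n) ?c"] dC \<Sigma>(2) by blast
  have "d \<in> C"
    using d dC C(1) unfolding subshift_def closedin_config_iff limit_closed_def by blast
  moreover have "x \<in> layer f W d" if x: "x \<in> X" for x
  proof (rule layer_limit[OF fin cl f])
    fix n
    obtain k where k: "k \<ge> n" "agree (zball 0 n) d (shift (- p k) ?c)" using d by blast
    obtain y where "y \<in> layer f W (shift (- p k) ?c)" "agree (zball 0 k) x y" using far[OF x] by blast
    then show "\<exists>d'. \<exists>y\<in>layer f W d'. agree (zball 0 n) d d' \<and> agree (zball 0 n) x y"
      using k agree_mono[OF _ zball_mono[OF k(1)]] by blast
  qed
  ultimately show ?thesis by blast
qed

text \<open>
  The values of the second track whose layer is all of X form a nonempty countable subshift,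
  so one of them is periodic in the direction u.
\<close>

lemma periodic_surjective_layer:
  fixes f :: "(int ^ 'd \<Rightarrow> 'a \<times> 'c) \<Rightarrow> int ^ 'd \<Rightarrow> 'b"
  assumes fin: "finite \<Gamma>" "W \<subseteq> fullshift \<Gamma>" and cl: "limit_closed W" and f: "local_map R W f"
    and invW: "\<And>w p. w \<in> W \<Longrightarrow> shift p w \<in> W"
    and eq: "\<And>w p. w \<in> W \<Longrightarrow> f (shift p w) = shift p (f w)"
    and C: "subshift C" "countable C" "\<And>w. w \<in> W \<Longrightarrow> (\<lambda>p. snd (w p)) \<in> C"
    and X: "f ` W = X" "limit_closed X" "X \<noteq> {}" "mixing X"
  shows "\<exists>c n. X \<subseteq> layer f W c \<and> n > 0 \<and> shift (int n *s u) c = c"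
proof -
  let ?D = "{c \<in> C. X \<subseteq> layer f W c}"
  obtain \<Sigma> where \<Sigma>: "finite \<Sigma>" "C \<subseteq> fullshift \<Sigma>" using C(1) unfolding subshift_def by blast
  have "limit_closed ?D"
    unfolding limit_closed_def
  proof (intro allI impI CollectI conjI subsetI)
    fix c assume c: "\<forall>n. \<exists>y\<in>?D. agree (zball 0 n) c y"
    then show "c \<in> C"
      using C(1) unfolding subshift_def closedin_config_iff limit_closed_def by blast
    show "x \<in> layer f W c" if "x \<in> X" for x
    proof (rule layer_limit[OF fin cl f])
      show "\<exists>d. \<exists>y\<in>layer f W d. agree (zball 0 n) c d \<and> agree (zball 0 n) x y" for n
        using c that agree_refl by blast
    qed
  qed
  moreover have "countable ?D" using C(2) by (rule countable_subset[rotated]) auto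
  moreover have "?D \<noteq> {}" using surjective_layer[OF assms] by blast
  moreover have "shift u c \<in> ?D" if c: "c \<in> ?D" for c
  proof -
    have "x \<in> layer f W (shift u c)" if x: "x \<in> X" for x
    proof -
      have "shift (- u) x \<in> X" using x X(1) eq invW by (metis imageE imageI)
      then have "shift (- u) x \<in> layer f W c" using c by blast
      then obtain w where w: "w \<in> W" "(\<lambda>p. snd (w p)) = c" "f w = shift (- u) x"
        by (rule layerE)
      have "f (shift u w) = x" using w eq by (simp add: shift_shift shift_0)
      moreover have "(\<lambda>q. snd (shift u w q)) = shift u c" using w(2) by (auto simp: shift_def)
      ultimately show ?thesis
        using invW[OF w(1)] by (intro layerI)
    qed
    then show ?thesis using c C(1) by (auto intro: subshift_shift)
  qed
  moreover have "?D \<subseteq> fullshift \<Sigma>" using \<Sigma>(2) by blast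
  ultimately obtain c n where "c \<in> ?D" "n > 0" "shift (int n *s u) c = c"
    using countable_system_has_periodic_point[OF \<Sigma>(1), of ?D u] by blast
  then show ?thesis by blast
qed

lemma finite_homothety:
  fixes w :: "int ^ 'd \<Rightarrow> 'a"
  assumes "finite \<Gamma>" "w \<in> fullshift \<Gamma>" "finite P" "finite L"
  obtains l m where "m > 0" "\<And>a q. a \<in> L \<Longrightarrow> q \<in> P \<Longrightarrow> w ((l + m * a) *s v + q) = w (l *s v + q)"
proof -
  let ?c = "\<lambda>l. \<lambda>q\<in>P. w (l *s v + q)"
  have "range ?c \<subseteq> P \<rightarrow>\<^sub>E \<Gamma>" using assms(2) by (auto simp: fullshift_def)
  then have "finite (range ?c)" using assms(1,3) by (meson finite_PiE finite_subset)
  then obtain l m where m: "m > 0" "\<And>a. a \<in> L \<Longrightarrow> ?c (l + m * a) = ?c l"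
    using homothetic_copy_same_colour[OF _ assms(4), of ?c] by blast
  show thesis
  proof (rule that[OF m(1)])
    show "w ((l + m * a) *s v + q) = w (l *s v + q)" if "a \<in> L" "q \<in> P" for a q
      using fun_cong[OF m(2)[OF that(1)], of q] that(2) by simp
  qed
qed

text \<open>
  By Cramer's rule a multiple of u lies in every lattice spanned by v and some \<open>g i\<close>.
\<close>

lemma common_multiple_in_lattices:
  fixes g :: "'i \<Rightarrow> int ^ 2"
  assumes "finite I" "\<And>i. i \<in> I \<Longrightarrow> independent_vectors v (g i)"
  shows "\<exists>k>0. \<forall>i\<in>I. \<exists>a b. k *s u = a *s v + b *s g i"
proof -
  let ?k = "\<Prod>i\<in>I. \<bar>det2 v (g i)\<bar>"
  have "?k > 0" using assms det2_nonzero by (intro prod_pos) auto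
  moreover have "\<exists>a b. ?k *s u = a *s v + b *s g i" if i: "i \<in> I" for i
  proof -
    have "det2 v (g i) dvd ?k" using assms(1) i by (metis abs_dvd_iff dvd_prodI)
    then obtain e where e: "?k = e * det2 v (g i)" by (metis dvdE mult.commute)
    have "?k *s u = e *s (det2 v (g i) *s u)" unfolding e by (simp add: vec_eq_iff)
    also have "\<dots> = (e * det2 u (g i)) *s v + (e * det2 v u) *s g i"
      unfolding cramer2[of v "g i" u] by (simp add: vec_eq_iff algebra_simps)
    finally show ?thesis by blast
  qed
  ultimately show ?thesis by blast
qed

text \<open>
  Let f have radius R and consider a ramification of radius \<open>2 * R\<close>. Overwriting the full shift
  track within distance R of the place of the graft changes the image only within distance
  \<open>2 * R\<close>, and shows the desired pattern there if all other tracks look the same around the place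
  and around its translate by t.
\<close>

theorem mixing_finitely_ramified_not_tame:
  fixes X :: "(int ^ 2 \<Rightarrow> 'a) set"
  assumes X: "subshift X" "mixing X" "finitely_ramified X"
  shows "\<not> tame X"
proof
  assume "tame X"
  then obtain A C where src: "source_data A C" and fac: "factor_of X (source A C)"
    unfolding tame_def by blast
  let ?W = "source A C"
  obtain f where f: "continuous_map (subtopology config_topology ?W) (subtopology config_topology X) f"
      "f ` ?W = X" "\<And>w p. w \<in> ?W \<Longrightarrow> f (shift p w) = shift p (f w)"
    using fac unfolding factor_of_def by blast
  obtain \<Gamma> where \<Gamma>: "finite \<Gamma>" "?W \<subseteq> fullshift \<Gamma>" using source_alphabet[OF src] by blast
  have clW: "limit_closed ?W" using src by (rule limit_closed_source)
  obtain R where R: "\<And>w w' q. w \<in> ?W \<Longrightarrow> w' \<in> ?W \<Longrightarrow> agree (zball q R) w w' \<Longrightarrow> f w q = f w' q"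
    using sliding_block_code[OF \<Gamma> clW source_shift[OF src] f(1) f(3)] by metis
  then have loc: "local_map R ?W f" unfolding local_map_def by blast
  obtain V where V: "infinite V" "pairwise independent_vectors V"
    and ram: "\<And>v. v \<in> V \<Longrightarrow> \<exists>x u F. finite F \<and> ramification X (2 * R) v x u F"
    using X(3) unfolding finitely_ramified_def by metis
  \<comment> \<open>A nonzero period for every periodic track.\<close>
  define I where "I = {H. \<not> is_singleton (A H) \<and> H \<noteq> {0}}"
  have "I \<subseteq> {H. \<not> is_singleton (A H)}" by (auto simp: I_def)
  then have finI: "finite I" using src unfolding source_data_def by (blast intro: finite_subset)
  have subI: "zsubgroup H" if "H \<in> I" for H using src that unfolding source_data_def I_def by blast
  have "\<forall>H\<in>I. \<exists>g. g \<in> H \<and> g \<noteq> 0"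
    using subI unfolding zsubgroup_def I_def by blast
  from bchoice[OF this] obtain g where g: "\<And>H. H \<in> I \<Longrightarrow> g H \<in> H" "\<And>H. H \<in> I \<Longrightarrow> g H \<noteq> 0"
    by blast
  have "finite (g ` I)" "0 \<notin> g ` I" using finI g(2) by auto
  from independent_of_finitely_many[OF V this] obtain v
    where v: "v \<in> V" "\<And>H. H \<in> I \<Longrightarrow> independent_vectors v (g H)" by blast
  obtain x u F where F: "finite F" and xram: "ramification X (2 * R) v x u F" using ram[OF v(1)] by blast
  have xX: "x \<in> X" using xram by (simp add: ramification_def)
  then have ne: "X \<noteq> {}" by blast
  have "limit_closed X" using X(1) unfolding subshift_def closedin_config_iff by blast
  moreover have "subshift C" "countable C" using src unfolding source_data_def by auto
  moreover have "(\<lambda>p. snd (w p)) \<in> C" if "w \<in> ?W" for w using that by (simp add: source_def)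
  ultimately obtain c n where c: "X \<subseteq> layer f ?W c" "n > 0" "shift (int n *s u) c = c"
    using periodic_surjective_layer[OF \<Gamma> clW loc source_shift[OF src] f(3) _ _ _ f(2) _ ne X(2), of C u] by blast
  have "x \<in> layer f ?W c" using c(1) xX by blast
  then obtain w where w: "w \<in> ?W" "(\<lambda>p. snd (w p)) = c" "f w = x" by (rule layerE)
  obtain k where k: "k > 0" "\<And>H. H \<in> I \<Longrightarrow> \<exists>a b. k *s (int n *s u) = a *s v + b *s g H"
    using common_multiple_in_lattices[where u = "int n *s u" and g = g, OF finI v(2)] by blast
  have "\<forall>H\<in>I. \<exists>ab. k *s (int n *s u) = fst ab *s v + snd ab *s g H" using k(2) by force
  from bchoice[OF this] obtain ab where
    ab: "\<And>H. H \<in> I \<Longrightarrow> k *s (int n *s u) = fst (ab H) *s v + snd (ab H) *s g H" by blast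
  let ?a = "\<lambda>H. fst (ab H)" and ?b = "\<lambda>H. snd (ab H)"
  let ?P = "\<Union>s\<in>F. zball s R"
  have "finite ?P" using F finite_zball by blast
  have w\<Gamma>: "w \<in> fullshift \<Gamma>" using w(1) \<Gamma>(2) by blast
  obtain l m where m: "m > 0"
    and rep0: "\<And>a q. a \<in> ?a ` I \<Longrightarrow> q \<in> ?P \<Longrightarrow> w ((l + m * a) *s v + q) = w (l *s v + q)"
  proof (rule finite_homothety[where v = v, OF \<Gamma>(1) w\<Gamma> \<open>finite ?P\<close> finite_imageI[OF finI, of ?a]])
    fix l m
    assume "m > 0" "\<And>a q. a \<in> ?a ` I \<Longrightarrow> q \<in> ?P \<Longrightarrow> w ((l + m * a) *s v + q) = w (l *s v + q)"
    then show thesis by (rule that)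
  qed
  have rep: "w ((l + m * ?a H) *s v + q) = w (l *s v + q)" if "H \<in> I" "q \<in> ?P" for H q
    using that by (intro rep0 imageI)
  let ?t = "(m * k * int n) *s u"
  have tpos: "m * k * int n > 0" using m k(1) c(2) by simp
  have wper: "(\<lambda>p. fst (w p) H) \<in> periodic_shift H (A H)" for H using w(1) by (simp add: source_def)
  have wA: "fst (w p) H \<in> A H" for p H using wper[of H] by (simp add: periodic_shift_def fullshift_def)
  have track: "fst (w (?t + (l *s v + q))) H = fst (w (l *s v + q)) H" if q: "q \<in> ?P" and H: "H \<noteq> {0}" for q H
  proof (cases "H \<in> I")
    case True
    have "?t = m *s (k *s (int n *s u))" by (simp add: vec_eq_iff)
    also have "\<dots> = (m * ?a H) *s v + (m * ?b H) *s g H"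
      unfolding ab[OF True] by (simp add: vec_eq_iff algebra_simps)
    finally have "?t + (l *s v + q) = ((l + m * ?a H) *s v + q) + (m * ?b H) *s g H"
      by (simp add: vec_eq_iff algebra_simps)
    moreover have "fst (w (p + (m * ?b H) *s g H)) H = fst (w p) H" for p
      using wper[of H] zsubgroup_scale[OF subI[OF True] g(1)[OF True]]
      unfolding periodic_shift_def by blast
    ultimately have "fst (w (?t + (l *s v + q))) H = fst (w ((l + m * ?a H) *s v + q)) H"
      by metis
    then show ?thesis using rep[OF True q] by simp
  next
    case False
    then have "is_singleton (A H)" using H unfolding I_def by blast
    then obtain s where "A H = {s}" by (rule is_singletonE)
    then show ?thesis using wA[of _ H] by simp
  qed
  have "(m * k) *s (int n *s u) \<in> {h. shift h c = c}"
    using zsubgroup_scale[OF zsubgroup_periods] c(3) by blast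
  then have "shift ?t c = c" by (simp add: vector_smult_assoc)
  then have ctrack: "c (?t + p) = c p" for p unfolding shift_def by metis
  \<comment> \<open>Only the unconstrained track is changed, and only near the place of the graft.\<close>
  let ?Z = "\<Union>s\<in>F. zball (l *s v + s) R"
  define w' where "w' p = (\<lambda>H. fst (w (if H = {0} \<and> p \<in> ?Z then ?t + p else p)) H, snd (w p))" for p
  have w'W: "w' \<in> ?W"
  proof -
    have "(\<lambda>p. fst (w' p) H) \<in> periodic_shift H (A H)" for H
    proof (cases "H = {0}")
      case True then show ?thesis using wA by (simp add: periodic_shift_def fullshift_def w'_def)
    next
      case False then show ?thesis using wper[of H] by (simp add: w'_def)
    qed
    then show ?thesis using w(1) by (simp add: source_def w'_def)
  qed
  have out: "f w' q = x q" if q: "q \<notin> nbhd ((+) (l *s v) ` F) (2 * R)" for q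
  proof -
    have "w p = w' p" if p: "p \<in> zball q R" for p
    proof -
      have "p \<notin> ?Z"
      proof
        assume "p \<in> ?Z"
        then obtain s where s: "s \<in> F" "p \<in> zball (l *s v + s) R" by blast
        have "q \<in> zball p R" using p by (simp add: mem_zball_iff abs_minus_commute)
        then have "q \<in> zball (l *s v + s) (2 * R)" using zball_trans[OF s(2)] by (simp add: mult_2)
        then show False using q s(1) unfolding nbhd_def zball_def by blast
      qed
      then show ?thesis by (simp add: w'_def)
    qed
    then have "agree (zball q R) w w'" by (simp add: agree_def)
    then show ?thesis using R[OF w(1) w'W] w(3) by metis
  qed
  have ins: "f w' (l *s v + s) = x (?t + (l *s v + s))" if s: "s \<in> F" for s
  proof -
    have "w' p = shift ?t w p" if p: "p \<in> zball (l *s v + s) R" for p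
    proof -
      define q where "q = p - l *s v"
      have q: "p = l *s v + q" by (simp add: q_def)
      have "q \<in> zball s R" using p by (simp add: q mem_zball_iff algebra_simps)
      then have qP: "q \<in> ?P" using s by blast
      have pZ: "p \<in> ?Z" using p s by blast
      have "fst (w' p) H = fst (w (?t + p)) H" for H
        using pZ track[OF qP, of H] by (auto simp: w'_def q)
      moreover have "snd (w' p) = snd (w (?t + p))"
        using ctrack[of p] w(2) by (auto simp: w'_def)
      ultimately show ?thesis by (simp add: shift_def prod_eq_iff fun_eq_iff)
    qed
    then have "agree (zball (l *s v + s) R) w' (shift ?t w)" by (simp add: agree_def)
    then have "f w' (l *s v + s) = f (shift ?t w) (l *s v + s)"
      using R[OF w'W source_shift[OF src w(1)]] by blast
    then show ?thesis using f(3)[OF w(1)] w(3) by (simp add: shift_def)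
  qed
  let ?\<pi> = "pattern_at x F (?t + l *s v)"
  have dom: "dom ?\<pi> = F" by (auto simp: pattern_at_def split: if_splits)
  have "graftable X (2 * R) ?\<pi> x (l *s v)"
    unfolding graftable_def dom
  proof (intro bexI[of _ "f w'"] conjI allI impI)
    show "f w' \<in> X" using w'W f(2) by blast
    show "f w' q = x q" if "q \<notin> nbhd ((+) (l *s v) ` F) (2 * R)" for q using that by (rule out)
    show "appears ?\<pi> (l *s v) (f w')"
      unfolding appears_def dom using ins by (simp add: pattern_at_def add.assoc)
  qed
  then show False using xram tpos unfolding ramification_def by blast
qed

section \<open>Bicolor Wang tilings as edge colourings\<close>

text \<open>
  The colours of the edges determine a tiling, and edge colourings have no matching condition:
  \<open>H i j\<close> is the left edge of the cell \<open>(i, j)\<close> and \<open>V i j\<close> its lower edge, True being black. A rule may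
  depend on the cell, in order to cover recoloured tilesets.
\<close>

type_synonym edges = "int \<Rightarrow> int \<Rightarrow> bool"
type_synonym local_rule = "int \<Rightarrow> int \<Rightarrow> bool \<Rightarrow> bool \<Rightarrow> bool \<Rightarrow> bool \<Rightarrow> bool"

definition wiring :: "local_rule \<Rightarrow> edges \<Rightarrow> edges \<Rightarrow> bool" where
  "wiring Q H V \<longleftrightarrow> (\<forall>i j. Q i j (H i j) (V i (j + 1)) (H (i + 1) j) (V i j))"

definition bit_tile :: "bool \<Rightarrow> bool \<Rightarrow> bool \<Rightarrow> bool \<Rightarrow> symbol" where
  "bit_tile l u r d = tile (of_bool l) (of_bool u) (of_bool r) (of_bool d)"

definition bit_tiles :: "symbol set" where
  "bit_tiles = {bit_tile l u r d | l u r d. True}"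

text \<open>
  The flag s exchanges the two colours of the left edge of a cell if the cell is odd and of its
  lower edge if it is even. Each edge gets the same treatment from both of its cells: an even
  cell has its right and lower edges recoloured, an odd cell its left and upper ones. This turns
  the balance \<open>left + right = upper + lower\<close> of \<open>T4\<close> and \<open>T7\<close> into the conservation of flux
  \<open>left + lower = right + upper\<close>.
\<close>

definition plane :: "bool \<Rightarrow> edges \<Rightarrow> edges \<Rightarrow> int ^ 2 \<Rightarrow> symbol" where
  "plane s H V p = (let i = p $ 1; j = p $ 2 in
     bit_tile (H i j \<noteq> (s \<and> odd (i + j))) (V i (j + 1) \<noteq> (s \<and> odd (i + j)))
       (H (i + 1) j \<noteq> (s \<and> even (i + j))) (V i j \<noteq> (s \<and> even (i + j))))"

definition tile_rule :: "symbol set \<Rightarrow> bool \<Rightarrow> local_rule" where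
  "tile_rule T s i j l u r d \<longleftrightarrow>
     bit_tile (l \<noteq> (s \<and> odd (i + j))) (u \<noteq> (s \<and> odd (i + j)))
       (r \<noteq> (s \<and> even (i + j))) (d \<noteq> (s \<and> even (i + j))) \<in> T"

lemma bit_tile_edges:
  "left_edge (bit_tile l u r d) = Num (of_bool l)" "upper_edge (bit_tile l u r d) = Num (of_bool u)"
  "right_edge (bit_tile l u r d) = Num (of_bool r)" "lower_edge (bit_tile l u r d) = Num (of_bool d)"
  by (simp_all add: bit_tile_def tile_def left_edge_def upper_edge_def right_edge_def lower_edge_def
      numeral_2_eq_2 numeral_3_eq_3)

lemma bit_tile_eq_iff [simp]:
  "bit_tile l u r d = bit_tile l' u' r' d' \<longleftrightarrow> l = l' \<and> u = u' \<and> r = r' \<and> d = d'"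
  by (auto simp: bit_tile_def tile_def of_bool_eq_iff)

lemma vector_2_eta: "vector [p $ 1, p $ 2] = (p :: int ^ 2)"
  by (simp add: vec_eq_iff forall_2)

lemma tile_rule_plane:
  "tile_rule T s i j (H i j) (V i (j + 1)) (H (i + 1) j) (V i j) \<longleftrightarrow> plane s H V (vector [i, j]) \<in> T"
  by (simp add: tile_rule_def plane_def)

lemma wang_shift_eq_planes:
  assumes T: "T \<subseteq> bit_tiles"
  shows "wang_shift T = {plane s H V | H V. wiring (tile_rule T s) H V}"
proof (intro equalityI subsetI)
  fix x assume x: "x \<in> wang_shift T"
  define L where "L i j \<longleftrightarrow> left_edge (x (vector [i, j])) = Num 1" for i j
  define D where "D i j \<longleftrightarrow> lower_edge (x (vector [i, j])) = Num 1" for i j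
  have xt: "x p = bit_tile (L (p $ 1) (p $ 2)) (D (p $ 1) (p $ 2 + 1)) (L (p $ 1 + 1) (p $ 2)) (D (p $ 1) (p $ 2))"
    and xT: "x p \<in> T" for p
  proof -
    show "x p \<in> T" using x by (simp add: wang_shift_def fullshift_def)
    then obtain l u r d where t: "x p = bit_tile l u r d" using T unfolding bit_tiles_def by blast
    have "right_edge (x p) = left_edge (x (vector [p $ 1 + 1, p $ 2]))"
      "upper_edge (x p) = lower_edge (x (vector [p $ 1, p $ 2 + 1]))"
      using x unfolding wang_shift_def by (metis (mono_tags, lifting) mem_Collect_eq vector_2_eta)+
    then have "left_edge (x (vector [p $ 1 + 1, p $ 2])) = Num (of_bool r)"
      "lower_edge (x (vector [p $ 1, p $ 2 + 1])) = Num (of_bool u)"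
      by (simp_all add: t bit_tile_edges)
    then show "x p = bit_tile (L (p $ 1) (p $ 2)) (D (p $ 1) (p $ 2 + 1)) (L (p $ 1 + 1) (p $ 2)) (D (p $ 1) (p $ 2))"
      unfolding L_def D_def vector_2_eta t bit_tile_edges by (simp del: One_nat_def)
  qed
  let ?H = "\<lambda>i j. L i j \<noteq> (s \<and> odd (i + j))" and ?V = "\<lambda>i j. D i j \<noteq> (s \<and> even (i + j))"
  have par: "plane s ?H ?V p = x p" for p
    unfolding xt plane_def Let_def by auto
  have "wiring (tile_rule T s) ?H ?V"
    unfolding wiring_def tile_rule_plane[of T s _ _ ?H ?V] par by (simp add: xT)
  moreover have "x = plane s ?H ?V" using par by auto
  ultimately show "x \<in> {plane s H V | H V. wiring (tile_rule T s) H V}" by blast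
next
  fix x assume "x \<in> {plane s H V | H V. wiring (tile_rule T s) H V}"
  then obtain H V where x: "x = plane s H V" and w: "wiring (tile_rule T s) H V" by blast
  have "x p \<in> T" for p
    using w vector_2_eta[of p] unfolding wiring_def tile_rule_plane[of T s _ _ H V] x by metis
  then show "x \<in> wang_shift T"
    unfolding wang_shift_def fullshift_def x by (auto simp: plane_def Let_def bit_tile_edges)
qed

lemma plane_eqD:
  assumes "plane s H V p = plane s H' V' q" "even (p $ 1 + p $ 2) = even (q $ 1 + q $ 2)"
  shows "H (p $ 1) (p $ 2) = H' (q $ 1) (q $ 2)" "V (p $ 1) (p $ 2) = V' (q $ 1) (q $ 2)"
  using assms by (auto simp: plane_def Let_def)

section \<open>Ramification\<close>

text \<open>
  Paths are directed to the right and upwards. A tile with black right and upper edges only,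
  as in \<open>T3\<close>, \<open>T6\<close> and \<open>T8\<close>, is a source of two paths; there are no sinks.
\<close>

definition flux_grows :: "local_rule \<Rightarrow> bool" where
  "flux_grows Q \<longleftrightarrow>
     (\<forall>i j l u r d. Q i j l u r d \<longrightarrow> of_bool l + of_bool d \<le> (of_bool r + of_bool u :: int))"

lemma sum_telescope_int:
  fixes f :: "int \<Rightarrow> int"
  assumes "a \<le> b"
  shows "(\<Sum>j\<in>{a..b}. f (j + 1) - f j) = f (b + 1) - f a"
  using assms
proof (induction rule: int_ge_induct)
  case base show ?case by simp
next
  case (step b)
  have "{a..b + 1} = insert (b + 1) {a..b}" using step(1) by auto
  then show ?case using step by simp
qed

text \<open>
  Within a column the contributions of the horizontal edges telescope.
\<close>

lemma column_count_mono:
  fixes H V :: edges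
  assumes flux: "\<And>i j. of_bool (H i j) + of_bool (V i j) \<le> (of_bool (H (i + 1) j) + of_bool (V i (j + 1)) :: int)"
    and ab: "a \<le> b" and cd: "c \<le> d"
    and V: "\<And>i. a \<le> i \<Longrightarrow> i < b \<Longrightarrow> \<not> V i c \<and> \<not> V i (d + 1)"
  shows "(\<Sum>j\<in>{c..d}. of_bool (H a j)) \<le> (\<Sum>j\<in>{c..d}. of_bool (H b j) :: int)"
  using ab V
proof (induction rule: int_ge_induct)
  case (step b)
  have "(\<Sum>j\<in>{c..d}. of_bool (H b j)) \<le>
      (\<Sum>j\<in>{c..d}. of_bool (H (b + 1) j) + (of_bool (V b (j + 1)) - of_bool (V b j)) :: int)"
    by (intro sum_mono) (use flux[of b] in \<open>smt (verit)\<close>)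
  also have "\<dots> = (\<Sum>j\<in>{c..d}. of_bool (H (b + 1) j))"
    using step.prems[of b] step.hyps sum_telescope_int[OF cd, of "\<lambda>j. of_bool (V b j)"]
    by (simp add: sum.distrib)
  finally show ?case using step by fastforce
qed simp

text \<open>
  Path l follows the graph of \<open>h i + 2 * l\<close>, with a step up exactly where \<open>h i = i div n + 1\<close> grows.
  For odd n, and thanks to the summand 1, the tile that leaves the row at a step lies on an odd
  cell and the tile that enters the next row on an even one, where these corners are available. The
  vertical distance 2 keeps the paths disjoint and preserves the parity. The translation u has even
  length, so that it does not interfere with the recolouring.
\<close>

theorem flux_imp_finitely_ramified:
  assumes X: "X = {plane s H V | H V. wiring Q H V}"
    and straight: "\<And>i j. Q i j False False False False" "\<And>i j. Q i j True False True False"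
    and corner: "\<And>i j. odd (i + j) \<Longrightarrow> Q i j True True False False"
      "\<And>i j. even (i + j) \<Longrightarrow> Q i j False False True True"
    and flux: "flux_grows Q"
  shows "finitely_ramified X"
  unfolding finitely_ramified_def
proof
  fix r :: nat
  define vec where "vec n = (vector [n, 1] :: int ^ 2)" for n :: int
  \<comment> \<open>M paths; K exceeds the extent of all paths in the columns near the graft.\<close>
  define M where "M = 2 * int r + 1"
  define K where "K = 2 * M + int r + 5"
  let ?V = "vec ` {n. 0 < n \<and> odd n}"
  let ?F = "(\<lambda>t. vector [0, t] :: int ^ 2) ` {-K..K}"
  let ?u = "vector [0, 2 * (K + 2 * M + 2)] :: int ^ 2"
  have inj: "inj_on vec A" for A
    by (auto simp: inj_on_def vec_def vec_eq_iff forall_2)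
  have "infinite {n :: int. 0 < n \<and> odd n}"
  proof
    assume "finite {n :: int. 0 < n \<and> odd n}"
    moreover have "(\<lambda>k. 2 * int k + 1) ` UNIV \<subseteq> {n :: int. 0 < n \<and> odd n}" by auto
    ultimately have "finite (range (\<lambda>k. 2 * int k + 1))" using finite_subset by blast
    moreover have "inj (\<lambda>k. 2 * int k + 1)" by (auto simp: inj_def)
    ultimately show False using finite_imageD by blast
  qed
  then have "infinite ?V" using finite_imageD inj by blast
  moreover have "pairwise independent_vectors ?V"
  proof (rule pairwiseI)
    fix v w assume "v \<in> ?V" "w \<in> ?V" "v \<noteq> w"
    then obtain a b where ab: "v = vec a" "w = vec b" "a \<noteq> b" by auto
    show "independent_vectors v w"
      unfolding independent_vectors_def
    proof (intro allI impI)
      fix l m assume "l *s v + m *s w = 0"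
      then have "l * a + m * b = 0" "l + m = 0"
        unfolding ab(1,2) vec_def by (auto simp: vec_eq_iff forall_2)
      then have m: "m = - l" by linarith
      then have "l * (a - b) = 0" using \<open>l * a + m * b = 0\<close> by (simp add: algebra_simps)
      then show "l = 0 \<and> m = 0" using ab(3) m by simp
    qed
  qed
  moreover have "\<exists>x u F. finite F \<and> ramification X r v x u F" if "v \<in> ?V" for v
  proof -
    obtain n where n: "v = vec n" "0 < n" "odd n" using \<open>v \<in> ?V\<close> by blast
    define h where "h i = i div n + 1" for i
    define on where "on t \<longleftrightarrow> 0 \<le> t \<and> t < 2 * M \<and> even t" for t :: int
    define H where "H i j \<longleftrightarrow> on (j - h i)" for i j
    define V where "V i j \<longleftrightarrow> h (i + 1) = h i + 1 \<and> on (j - 1 - h i)" for i j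
    have step: "h (i + 1) = h i \<or> h (i + 1) = h i + 1 \<and> odd (i + h i)" for i
    proof -
      have "i mod n < n" "0 \<le> i mod n" using n(2) by auto
      then consider "i mod n + 1 < n" | "i mod n = n - 1" by linarith
      then show ?thesis
      proof cases
        case 1
        have "i + 1 = n * (i div n) + (i mod n + 1)" by simp
        then have "(i + 1) div n = i div n"
          using 1 \<open>0 \<le> i mod n\<close> by (intro int_div_pos_eq) auto
        then show ?thesis by (simp add: h_def)
      next
        case 2
        moreover have "n * (i div n + 1) = n * (i div n) + n" by (simp add: distrib_left)
        ultimately have i: "i = n * (i div n + 1) - 1"
          using mult_div_mod_eq[of n i] by linarith
        then have "i + 1 = n * (i div n + 1) + 0" by simp
        then have "(i + 1) div n = i div n + 1" using n(2) by (intro int_div_pos_eq) auto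
        moreover have "odd (i + h i)"
        proof -
          have "i + h i + 1 = (n + 1) * h i" using i by (simp add: h_def algebra_simps)
          then have "even (i + h i + 1)" using n(3) by simp
          then show ?thesis by simp
        qed
        ultimately show ?thesis by (simp add: h_def)
      qed
    qed
    have wHV: "wiring Q H V"
      unfolding wiring_def
    proof (intro allI)
      fix i j
      consider "h (i + 1) = h i" | "h (i + 1) = h i + 1" "odd (i + h i)" using step[of i] by blast
      then show "Q i j (H i j) (V i (j + 1)) (H (i + 1) j) (V i j)"
      proof cases
        case 1 then show ?thesis using straight by (cases "on (j - h i)") (simp_all add: H_def V_def)
      next
        case 2
        have par: "odd (i + j)" if "on (j - h i)" using that 2(2) by (auto simp: on_def)
        have par': "even (i + j)" if "on (j - 1 - h i)" using that 2(2) by (auto simp: on_def)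
        have excl: "\<not> (on (j - h i) \<and> on (j - 1 - h i))" by (auto simp: on_def)
        have e: "j - h (i + 1) = j - 1 - h i" using 2(1) by simp
        show ?thesis
          using 2(1) straight(1) corner par par' excl unfolding H_def V_def e
          by (cases "on (j - h i)"; cases "on (j - 1 - h i)") simp_all
      qed
    qed
    define x where "x = plane s H V"
    have xX: "x \<in> X" using wHV X x_def by blast
    have near: "l - int r - 1 \<le> h i \<and> h i \<le> l + 1" if "l * n - int r - 1 \<le> i" "i \<le> l * n" for i l
    proof -
      have "i div n \<le> (l * n) div n" using that(2) n(2) by (intro zdiv_mono1) auto
      moreover have "(l - int r - 1) * n \<le> i"
      proof -
        have "int r * 1 \<le> int r * n" using n(2) by (intro mult_left_mono) auto
        then show ?thesis using that(1) n(2) by (simp add: left_diff_distrib)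
      qed
      then have "((l - int r - 1) * n) div n \<le> i div n" using n(2) by (rule zdiv_mono1)
      ultimately show ?thesis using n(2) by (simp add: h_def)
    qed
    have "\<not> graftable X r (pattern_at x ?F (m *s ?u + l *s v)) x (l *s v)" if m: "m > 0" for l m
    proof
      let ?\<pi> = "pattern_at x ?F (m *s ?u + l *s v)"
      assume "graftable X r ?\<pi> x (l *s v)"
      moreover have dom: "dom ?\<pi> = ?F" by (auto simp: pattern_at_def split: if_splits)
      ultimately obtain y where y: "y \<in> X" "\<And>q. q \<notin> nbhd ((+) (l *s v) ` ?F) r \<Longrightarrow> y q = x q"
        "appears ?\<pi> (l *s v) y" unfolding graftable_def by auto
      obtain H' V' where y': "y = plane s H' V'" and w': "wiring Q H' V'" using y(1) X by blast
      have outside: "H' i j = H i j \<and> V' i j = V i j"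
        if "\<bar>i - l * n\<bar> > int r \<or> \<bar>j - l\<bar> > K + int r" for i j
      proof -
        have "vector [i, j] \<notin> nbhd ((+) (l *s v) ` ?F) r"
          using that by (auto simp: nbhd_def zdist_le_iff forall_2 n(1) vec_def)
        from y(2)[OF this] show ?thesis
          using plane_eqD[of s H' V' "vector [i, j]" H V "vector [i, j]"] by (simp add: y' x_def)
      qed
      have blank: "\<not> H' (l * n) j" if j: "\<bar>j - l\<bar> \<le> K" for j
      proof -
        define t where "t = m * (2 * (K + 2 * M + 2))"
        have "vector [0, j - l] \<in> ?F" using j by (intro imageI) auto
        then have "y (l *s v + vector [0, j - l]) = x (m *s ?u + l *s v + vector [0, j - l])"
          using y(3) unfolding appears_def dom by (auto simp: pattern_at_def)
        then have "H' (l * n) j = H (l * n) (t + j)"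
          unfolding y' x_def n(1) vec_def t_def by (drule_tac plane_eqD(1)) (auto simp: algebra_simps)
        moreover have "h (l * n) = l + 1" using n(2) by (simp add: h_def)
        moreover have "1 * (2 * (K + 2 * M + 2)) \<le> t"
          unfolding t_def using m by (intro mult_right_mono) (auto simp: K_def M_def)
        then have "\<not> t + j - (l + 1) < 2 * M" using j unfolding K_def M_def by simp
        then have "\<not> on (t + j - (l + 1))" by (simp add: on_def)
        ultimately show ?thesis unfolding H_def by simp
      qed
      \<comment> \<open>The flux is compared between a column left of the graft, where nothing has changed, and its
        middle column.\<close>
      let ?L = "K + int r + 1"
      let ?J = "{l - ?L..l + ?L}" and ?a = "l * n - int r - 1"
      have Vend: "\<not> V' i (l - ?L) \<and> \<not> V' i (l + ?L + 1)" if "?a \<le> i" "i < l * n" for i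
      proof -
        have "V' i (l - ?L) = V i (l - ?L)" "V' i (l + ?L + 1) = V i (l + ?L + 1)"
          using outside[of i "l - ?L"] outside[of i "l + ?L + 1"] by (auto simp: K_def M_def)
        then show ?thesis using near[of l i] that unfolding V_def on_def K_def M_def by auto
      qed
      have "(\<Sum>j\<in>?J. of_bool (H' ?a j)) \<le> (\<Sum>j\<in>?J. of_bool (H' (l * n) j) :: int)"
      proof (rule column_count_mono[OF _ _ _ Vend])
        show "of_bool (H' i j) + of_bool (V' i j) \<le> (of_bool (H' (i + 1) j) + of_bool (V' i (j + 1)) :: int)" for i j
          using w' flux unfolding wiring_def flux_grows_def by blast
      qed (auto simp: K_def M_def)
      moreover have "M \<le> (\<Sum>j\<in>?J. of_bool (H' ?a j) :: int)"
      proof -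
        let ?A = "(\<lambda>k. h ?a + 2 * int k) ` {..<nat M}"
        have "?A \<subseteq> ?J" using near[of l ?a] by (auto simp: K_def M_def)
        moreover have "H' ?a j" if "j \<in> ?A" for j
          using that outside[of ?a j] by (auto simp: H_def on_def)
        ultimately have sub: "?A \<subseteq> {j \<in> ?J. H' ?a j}" by blast
        have fin: "finite {j \<in> ?J. H' ?a j}" by (rule finite_subset[of _ ?J]) auto
        have "M = int (card ?A)" by (subst card_image) (auto simp: inj_on_def M_def)
        also have "\<dots> \<le> int (card {j \<in> ?J. H' ?a j})"  using sub fin by (intro of_nat_mono card_mono)
        also have "\<dots> = (\<Sum>j\<in>?J. of_bool (H' ?a j))" by (simp add: sum_of_bool_eq Int_def)
        finally show ?thesis .
      qed
      moreover have "(\<Sum>j\<in>?J. of_bool (H' (l * n) j) :: int) \<le> 2 * int r"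
      proof -
        have "(\<Sum>j\<in>?J. of_bool (H' (l * n) j) :: int) = int (card {j \<in> ?J. H' (l * n) j})"
          by (simp add: sum_of_bool_eq Int_def)
        also have "\<dots> \<le> int (card ({l - K - int r..l - K - 1} \<union> {l + K + 1..l + K + int r}))"
        proof (intro of_nat_mono card_mono subsetI)
          fix j assume "j \<in> {j \<in> ?J. H' (l * n) j}"
          then have j: "H' (l * n) j" by simp
          then have K: "\<bar>j - l\<bar> > K" using blank by force
          moreover have "\<bar>j - l\<bar> \<le> K + int r"
          proof (rule ccontr)
            assume far: "\<not> \<bar>j - l\<bar> \<le> K + int r"
            then have "H (l * n) j" using outside[of "l * n" j] j by auto
            moreover have "h (l * n) = l + 1" using n(2) by (simp add: h_def)
            ultimately show False using far unfolding H_def on_def K_def M_def by auto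
          qed
          ultimately show "j \<in> {l - K - int r..l - K - 1} \<union> {l + K + 1..l + K + int r}" by auto
        qed simp
        also have "\<dots> \<le> int (card {l - K - int r..l - K - 1} + card {l + K + 1..l + K + int r})"
          by (intro of_nat_mono card_Un_le)
        also have "\<dots> = 2 * int r" by simp
        finally show ?thesis .
      qed
      ultimately show False by (simp add: M_def)
    qed
    then have "ramification X r v x ?u ?F" using xX by (simp add: ramification_def)
    then show ?thesis by blast
  qed
  ultimately show "\<exists>V. infinite V \<and> pairwise independent_vectors V \<and>
      (\<forall>v\<in>V. \<exists>x u F. finite F \<and> ramification X r v x u F)" by blast
qed

section \<open>Mixing\<close>

definition near :: "int \<Rightarrow> int \<Rightarrow> int \<Rightarrow> edges \<Rightarrow> edges \<Rightarrow> edges \<Rightarrow> edges \<Rightarrow> bool" where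
  "near m a b H V H' V' \<longleftrightarrow>
     (\<forall>i j. \<bar>i - a\<bar> \<le> m \<and> \<bar>j - b\<bar> \<le> m \<longrightarrow> H' i j = H i j \<and> V' i j = V i j)"

text \<open>
  The window of radius m around \<open>(a, b)\<close> can be kept while the half-plane in direction
  \<open>(\<alpha>, \<beta>)\<close> is cleared, with a distance k that depends on m only.
\<close>

definition confinable :: "local_rule \<Rightarrow> int \<Rightarrow> int \<Rightarrow> bool" where
  "confinable Q \<alpha> \<beta> \<longleftrightarrow> (\<forall>m. \<exists>k. \<forall>H V a b. wiring Q H V \<longrightarrow>
     (\<exists>H' V'. wiring Q H' V' \<and> near m a b H V H' V' \<and>
        (\<forall>i j. \<alpha> * (i - a) + \<beta> * (j - b) \<ge> k \<longrightarrow> \<not> H' i j \<and> \<not> V' i j)))"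

text \<open>
  Cut where both tilings are white: there the first may be replaced by the second without any
  cell noticing.
\<close>

lemma glue_confined:
  assumes conf: "confinable Q \<alpha> \<beta>" "confinable Q (- \<alpha>) (- \<beta>)" and unit: "\<bar>\<alpha>\<bar> \<le> 1" "\<bar>\<beta>\<bar> \<le> 1"
  shows "\<exists>K. \<forall>H1 V1 H2 V2 a b c d. wiring Q H1 V1 \<and> wiring Q H2 V2 \<and> \<alpha> * (c - a) + \<beta> * (d - b) \<ge> K \<longrightarrow>
    (\<exists>H V. wiring Q H V \<and> near m a b H1 V1 H V \<and> near m c d H2 V2 H V)"
proof -
  obtain k1 where k1: "\<And>H V a b. wiring Q H V \<Longrightarrow> \<exists>H' V'. wiring Q H' V' \<and> near m a b H V H' V' \<and>
      (\<forall>i j. \<alpha> * (i - a) + \<beta> * (j - b) \<ge> k1 \<longrightarrow> \<not> H' i j \<and> \<not> V' i j)"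
    using conf(1) unfolding confinable_def by metis
  obtain k2 where k2: "\<And>H V a b. wiring Q H V \<Longrightarrow> \<exists>H' V'. wiring Q H' V' \<and> near m a b H V H' V' \<and>
      (\<forall>i j. - \<alpha> * (i - a) + - \<beta> * (j - b) \<ge> k2 \<longrightarrow> \<not> H' i j \<and> \<not> V' i j)"
    using conf(2) unfolding confinable_def by metis
  show ?thesis
  proof (intro exI[of _ "\<bar>k1\<bar> + \<bar>k2\<bar> + 4 * \<bar>m\<bar> + 10"] allI impI, elim conjE)
    fix H1 V1 H2 V2 a b c d
    assume w: "wiring Q H1 V1" "wiring Q H2 V2"
      and K: "\<bar>k1\<bar> + \<bar>k2\<bar> + 4 * \<bar>m\<bar> + 10 \<le> \<alpha> * (c - a) + \<beta> * (d - b)"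
    obtain A B where A: "wiring Q A B" "near m a b H1 V1 A B"
      "\<And>i j. \<alpha> * (i - a) + \<beta> * (j - b) \<ge> k1 \<Longrightarrow> \<not> A i j \<and> \<not> B i j"
      using k1[OF w(1), of a b] by blast
    obtain C D where C: "wiring Q C D" "near m c d H2 V2 C D"
      "\<And>i j. - \<alpha> * (i - c) + - \<beta> * (j - d) \<ge> k2 \<Longrightarrow> \<not> C i j \<and> \<not> D i j"
      using k2[OF w(2), of c d] by blast
    define \<phi> where "\<phi> i j = \<alpha> * (i - a) + \<beta> * (j - b)" for i j
    \<comment> \<open>The level e lies beyond the first window and in the white parts of both tilings.\<close>
    define e where "e = \<bar>k1\<bar> + 2 * \<bar>m\<bar> + 2"
    have \<phi>c: "\<phi> c d \<ge> \<bar>k1\<bar> + \<bar>k2\<bar> + 4 * \<bar>m\<bar> + 10" using K by (simp add: \<phi>_def)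
    have A0: "\<not> A i j" "\<not> B i j" if "\<phi> i j \<ge> e" for i j
      using A(3)[of i j] that by (auto simp: \<phi>_def e_def)
    have C0: "\<not> C i j" "\<not> D i j" if "\<phi> i j \<le> e + 1" for i j
    proof -
      have "- \<alpha> * (i - c) + - \<beta> * (j - d) = \<phi> c d - \<phi> i j" by (simp add: \<phi>_def algebra_simps)
      then have "- \<alpha> * (i - c) + - \<beta> * (j - d) \<ge> k2" using that \<phi>c by (simp add: e_def)
      from C(3)[OF this] show "\<not> C i j" "\<not> D i j" by auto
    qed
    let ?H = "\<lambda>i j. if \<phi> i j \<le> e then A i j else C i j" and ?V = "\<lambda>i j. if \<phi> i j \<le> e then B i j else D i j"
    have nb: "\<bar>\<phi> (i + 1) j - \<phi> i j\<bar> \<le> 1" "\<bar>\<phi> i (j + 1) - \<phi> i j\<bar> \<le> 1" for i j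
      using unit by (simp_all add: \<phi>_def algebra_simps)
    have "Q i j (?H i j) (?V i (j + 1)) (?H (i + 1) j) (?V i j)" for i j
    proof (cases "\<phi> i j \<le> e")
      case True
      have "?H (i + 1) j = A (i + 1) j"
        using A0(1)[of "i + 1" j] C0(1)[of "i + 1" j] nb(1)[of i j] True by auto
      moreover have "?V i (j + 1) = B i (j + 1)"
        using A0(2)[of i "j + 1"] C0(2)[of i "j + 1"] nb(2)[of i j] True by auto
      moreover have "Q i j (A i j) (B i (j + 1)) (A (i + 1) j) (B i j)"
        using A(1) unfolding wiring_def by blast
      ultimately show ?thesis using True by presburger
    next
      case False
      have "?H (i + 1) j = C (i + 1) j"
        using A0(1)[of "i + 1" j] C0(1)[of "i + 1" j] nb(1)[of i j] False by auto
      moreover have "?V i (j + 1) = D i (j + 1)"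
        using A0(2)[of i "j + 1"] C0(2)[of i "j + 1"] nb(2)[of i j] False by auto
      moreover have "Q i j (C i j) (D i (j + 1)) (C (i + 1) j) (D i j)"
        using C(1) unfolding wiring_def by blast
      ultimately show ?thesis using False by presburger
    qed
    then have "wiring Q ?H ?V" unfolding wiring_def by blast
    moreover have bound: "\<bar>\<alpha> * x + \<beta> * y\<bar> \<le> 2 * \<bar>m\<bar>" if "\<bar>x\<bar> \<le> m" "\<bar>y\<bar> \<le> m" for x y
    proof -
      have "\<bar>\<alpha> * x\<bar> \<le> 1 * \<bar>m\<bar>" "\<bar>\<beta> * y\<bar> \<le> 1 * \<bar>m\<bar>"
        unfolding abs_mult using unit that by (intro mult_mono; simp)+
      then show ?thesis by linarith
    qed
    have "near m a b H1 V1 ?H ?V"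
      unfolding near_def
    proof (intro allI impI)
      fix i j assume ij: "\<bar>i - a\<bar> \<le> m \<and> \<bar>j - b\<bar> \<le> m"
      then have "\<phi> i j \<le> e" using bound[of "i - a" "j - b"] by (simp add: \<phi>_def e_def)
      then show "?H i j = H1 i j \<and> ?V i j = V1 i j" using A(2) ij unfolding near_def by simp
    qed
    moreover have "near m c d H2 V2 ?H ?V"
      unfolding near_def
    proof (intro allI impI)
      fix i j assume ij: "\<bar>i - c\<bar> \<le> m \<and> \<bar>j - d\<bar> \<le> m"
      have "\<phi> i j = \<phi> c d + (\<alpha> * (i - c) + \<beta> * (j - d))" by (simp add: \<phi>_def algebra_simps)
      then have "\<not> \<phi> i j \<le> e" using bound[of "i - c" "j - d"] ij \<phi>c by (simp add: e_def)
      then show "?H i j = H2 i j \<and> ?V i j = V2 i j" using C(2) ij unfolding near_def by simp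
    qed
    ultimately show "\<exists>H V. wiring Q H V \<and> near m a b H1 V1 H V \<and> near m c d H2 V2 H V" by blast
  qed
qed

lemma plane_cong:
  assumes "near (m + 1) a b H V H' V'" "\<bar>p $ 1 - a\<bar> \<le> m" "\<bar>p $ 2 - b\<bar> \<le> m"
  shows "plane s H' V' p = plane s H V p"
proof -
  have "H' i j = H i j \<and> V' i j = V i j" if "\<bar>i - p $ 1\<bar> \<le> 1" "\<bar>j - p $ 2\<bar> \<le> 1" "\<bar>i - a\<bar> \<le> m + 1" "\<bar>j - b\<bar> \<le> m + 1" for i j
    using assms(1) that unfolding near_def by blast
  then show ?thesis using assms(2,3) by (simp add: plane_def Let_def)
qed

text \<open>
  Two windows at a large distance are far apart with respect to one of the two linear forms j
  and \<open>i - t * j\<close>.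
\<close>

theorem confinable_imp_mixing:
  assumes X: "X = {plane s H V | H V. wiring Q H V}" and inv: "\<And>x p. x \<in> X \<Longrightarrow> shift p x \<in> X"
    and t: "t = 0 \<or> t = 1"
    and vert: "confinable Q 0 1" "confinable Q 0 (- 1)"
    and across: "confinable Q 1 (- t)" "confinable Q (- 1) t"
  shows "mixing X"
  unfolding mixing_def
proof
  fix m :: nat
  let ?m = "int m + 1"
  have "\<exists>K. \<forall>H1 V1 H2 V2 a b c d. wiring Q H1 V1 \<and> wiring Q H2 V2 \<and> d - b \<ge> K \<longrightarrow>
      (\<exists>H V. wiring Q H V \<and> near ?m a b H1 V1 H V \<and> near ?m c d H2 V2 H V)"
    using glue_confined[of Q 0 1 ?m] vert by simp
  then obtain K1 where K1: "\<And>H1 V1 H2 V2 a b c d. wiring Q H1 V1 \<Longrightarrow> wiring Q H2 V2 \<Longrightarrow> d - b \<ge> K1 \<Longrightarrow>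
      \<exists>H V. wiring Q H V \<and> near ?m a b H1 V1 H V \<and> near ?m c d H2 V2 H V" by metis
  have "\<exists>K. \<forall>H1 V1 H2 V2 a b c d. wiring Q H1 V1 \<and> wiring Q H2 V2 \<and> (c - a) - t * (d - b) \<ge> K \<longrightarrow>
      (\<exists>H V. wiring Q H V \<and> near ?m a b H1 V1 H V \<and> near ?m c d H2 V2 H V)"
    using glue_confined[of Q 1 "- t" ?m] across t by auto
  then obtain K2 where K2: "\<And>H1 V1 H2 V2 a b c d. wiring Q H1 V1 \<Longrightarrow> wiring Q H2 V2 \<Longrightarrow>
      (c - a) - t * (d - b) \<ge> K2 \<Longrightarrow>
      \<exists>H V. wiring Q H V \<and> near ?m a b H1 V1 H V \<and> near ?m c d H2 V2 H V" by metis
  define K where "K = \<bar>K1\<bar> + \<bar>K2\<bar> + 1"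
  have glue: "\<exists>H V. wiring Q H V \<and> near ?m a b H1 V1 H V \<and> near ?m c d H2 V2 H V"
    if w: "wiring Q H1 V1" "wiring Q H2 V2" and far: "\<bar>c - a\<bar> \<ge> 2 * K \<or> \<bar>d - b\<bar> \<ge> 2 * K" for H1 V1 H2 V2 a b c d
  proof -
    have "d - b \<ge> K1 \<or> b - d \<ge> K1 \<or> (c - a) - t * (d - b) \<ge> K2 \<or> (a - c) - t * (b - d) \<ge> K2"
      using t
    proof
      assume "t = 0" then show ?thesis using far unfolding K_def by simp arith
    next
      assume "t = 1" then show ?thesis using far unfolding K_def by simp arith
    qed
    then consider "d - b \<ge> K1" | "b - d \<ge> K1" | "(c - a) - t * (d - b) \<ge> K2" | "(a - c) - t * (b - d) \<ge> K2"
      by blast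
    then show ?thesis
    proof cases
      case 1 then show ?thesis using K1[OF w] by blast
    next
      case 2 then show ?thesis using K1[OF w(2,1)] by blast
    next
      case 3 then show ?thesis using K2[OF w] by blast
    next
      case 4 then show ?thesis using K2[OF w(2,1)] by blast
    qed
  qed
  have "independent_regions X F G"
    if diam: "diam F \<le> enat m" "diam G \<le> enat m" and dist: "enat (nat (2 * K)) \<le> region_dist F G" for F G
  proof -
    have far: "nat (2 * K) \<le> zdist p q" if "p \<in> F" "q \<in> G" for p q
    proof -
      have "region_dist F G \<le> enat (zdist p q)"
        unfolding region_dist_def using that by (intro INF_lower2[of p] INF_lower2[of q]) auto
      then show ?thesis using dist order_trans by fastforce
    qed
    have close: "\<bar>q $ i - p $ i\<bar> \<le> int m" if "diam E \<le> enat m" "p \<in> E" "q \<in> E" for p q E and i :: 2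
    proof -
      have "enat (zdist q p) \<le> diam E"
        unfolding diam_def using that(2,3) by (intro SUP_upper2[of q] SUP_upper2[of p]) auto
      then have "zdist q p \<le> m" using that(1) by (meson enat_ord_simps(1) order_trans)
      then show ?thesis unfolding zdist_le_iff by blast
    qed
    have "F \<inter> G = {}"
    proof (rule ccontr)
      assume "F \<inter> G \<noteq> {}"
      then obtain p where p: "p \<in> F" "p \<in> G" by blast
      have "zdist p p \<le> 0" unfolding zdist_le_iff by simp
      then show False using far[OF p] by (simp add: K_def)
    qed
    moreover have "valid X (\<pi> ++ \<rho>)"
      if dom: "dom \<pi> = F" "dom \<rho> = G" and val: "valid X \<pi>" "valid X \<rho>" for \<pi> \<rho>
    proof -
      have origin: "\<exists>x\<in>X. \<forall>q\<in>dom \<sigma>. \<sigma> q = Some (x q)" if valid: "valid X \<sigma>" for \<sigma>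
      proof -
        obtain x p where "x \<in> X" "appears \<sigma> p x" using valid unfolding valid_def by blast
        then show ?thesis
          using inv by (intro bexI[of _ "shift p x"]) (auto simp: appears_def shift_def)
      qed
      obtain x1 where x1: "x1 \<in> X" "\<And>q. q \<in> F \<Longrightarrow> \<pi> q = Some (x1 q)" using origin[OF val(1)] dom(1) by blast
      obtain x2 where x2: "x2 \<in> X" "\<And>q. q \<in> G \<Longrightarrow> \<rho> q = Some (x2 q)" using origin[OF val(2)] dom(2) by blast
      have "\<exists>z\<in>X. (\<forall>q\<in>F. z q = x1 q) \<and> (\<forall>q\<in>G. z q = x2 q)"
      proof (cases "F = {} \<or> G = {}")
        case True then show ?thesis using x1(1) x2(1) by blast
      next
        case False
        then obtain f g where fg: "f \<in> F" "g \<in> G" by blast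
        obtain H1 V1 where w1: "x1 = plane s H1 V1" "wiring Q H1 V1" using x1(1) X by blast
        obtain H2 V2 where w2: "x2 = plane s H2 V2" "wiring Q H2 V2" using x2(1) X by blast
        have "\<not> zdist f g \<le> nat (2 * K) - 1" using far[OF fg] by (simp add: K_def)
        then have "\<bar>g $ 1 - f $ 1\<bar> \<ge> 2 * K \<or> \<bar>g $ 2 - f $ 2\<bar> \<ge> 2 * K"
          unfolding zdist_le_iff forall_2 by (auto simp: K_def of_nat_diff)
        from glue[OF w1(2) w2(2) this] obtain H V where HV: "wiring Q H V"
          "near ?m (f $ 1) (f $ 2) H1 V1 H V" "near ?m (g $ 1) (g $ 2) H2 V2 H V" by blast
        have "plane s H V \<in> X" using HV(1) X by blast
        moreover have "plane s H V q = x1 q" if "q \<in> F" for q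
          unfolding w1(1) by (rule plane_cong[OF HV(2)]) (use close[OF diam(1) fg(1) that] in auto)
        moreover have "plane s H V q = x2 q" if "q \<in> G" for q
          unfolding w2(1) by (rule plane_cong[OF HV(3)]) (use close[OF diam(2) fg(2) that] in auto)
        ultimately show ?thesis by blast
      qed
      then obtain z where z: "z \<in> X" "\<And>q. q \<in> F \<Longrightarrow> z q = x1 q" "\<And>q. q \<in> G \<Longrightarrow> z q = x2 q" by blast
      have "appears (\<pi> ++ \<rho>) 0 z"
        unfolding appears_def dom_map_add dom
      proof
        fix q assume "q \<in> G \<union> F"
        moreover have "\<rho> q = None" if "q \<notin> G" using that dom(2) by blast
        ultimately show "(\<pi> ++ \<rho>) q = Some (z (0 + q))"
          using x1(2) x2(2) z(2,3) by (cases "q \<in> G") (auto simp: map_add_def)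
      qed
      then show ?thesis using z(1) unfolding valid_def by blast
    qed
    ultimately show ?thesis unfolding independent_regions_def by blast
  qed
  then show "\<exists>n. \<forall>F G. diam F \<le> enat m \<and> diam G \<le> enat m \<and> enat n \<le> region_dist F G \<longrightarrow>
      independent_regions X F G" by blast
qed

section \<open>Symmetries\<close>

text \<open>
  Reflection in the main diagonal and rotation by a half turn, which reduce the four
  half-planes to one.
\<close>

definition transposed :: "local_rule \<Rightarrow> local_rule" where
  "transposed Q i j l u r d = Q j i d r u l"

definition rotated :: "local_rule \<Rightarrow> local_rule" where
  "rotated Q i j l u r d = Q (- i) (- j) r d l u"

lemma wiring_transposed: "wiring (transposed Q) (\<lambda>i j. V j i) (\<lambda>i j. H j i) \<longleftrightarrow> wiring Q H V"
  unfolding wiring_def transposed_def by blast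

lemma wiring_rotated:
  "wiring (rotated Q) (\<lambda>i j. H (1 - i) (- j)) (\<lambda>i j. V (- i) (1 - j)) \<longleftrightarrow> wiring Q H V"
proof
  assume "wiring (rotated Q) (\<lambda>i j. H (1 - i) (- j)) (\<lambda>i j. V (- i) (1 - j))"
  then have *: "rotated Q (- i) (- j) (H (1 - (- i)) (- (- j))) (V (- (- i)) (1 - (- j + 1))) (H (1 - (- i + 1)) (- (- j))) (V (- (- i)) (1 - (- j)))" for i j
    unfolding wiring_def by blast
  show "wiring Q H V"
    unfolding wiring_def using * by (simp add: rotated_def add.commute)
next
  assume "wiring Q H V"
  then have *: "Q (- i) (- j) (H (- i) (- j)) (V (- i) (- j + 1)) (H (- i + 1) (- j)) (V (- i) (- j))" for i j
    unfolding wiring_def by blast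
  show "wiring (rotated Q) (\<lambda>i j. H (1 - i) (- j)) (\<lambda>i j. V (- i) (1 - j))"
    unfolding wiring_def rotated_def using * by (simp add: add.commute)
qed

lemma rotated_rotated: "rotated (rotated Q) = Q"
  by (simp add: rotated_def fun_eq_iff)

lemma confinable_transposed:
  assumes "confinable (transposed Q) \<alpha> \<beta>"
  shows "confinable Q \<beta> \<alpha>"
  unfolding confinable_def
proof
  fix m
  obtain k where k: "\<And>H V a b. wiring (transposed Q) H V \<Longrightarrow> \<exists>H' V'. wiring (transposed Q) H' V' \<and>
      near m a b H V H' V' \<and> (\<forall>i j. \<alpha> * (i - a) + \<beta> * (j - b) \<ge> k \<longrightarrow> \<not> H' i j \<and> \<not> V' i j)"
    using assms unfolding confinable_def by metis
  show "\<exists>k. \<forall>H V a b. wiring Q H V \<longrightarrow> (\<exists>H' V'. wiring Q H' V' \<and> near m a b H V H' V' \<and>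
      (\<forall>i j. \<beta> * (i - a) + \<alpha> * (j - b) \<ge> k \<longrightarrow> \<not> H' i j \<and> \<not> V' i j))"
  proof (intro exI[of _ k] allI impI)
    fix H V a b assume "wiring Q H V"
    then have "wiring (transposed Q) (\<lambda>i j. V j i) (\<lambda>i j. H j i)" by (simp add: wiring_transposed)
    from k[OF this, of b a] obtain H' V' where
      "wiring (transposed Q) H' V'" "near m b a (\<lambda>i j. V j i) (\<lambda>i j. H j i) H' V'"
      "\<And>i j. \<alpha> * (i - b) + \<beta> * (j - a) \<ge> k \<Longrightarrow> \<not> H' i j \<and> \<not> V' i j" by blast
    then show "\<exists>H' V'. wiring Q H' V' \<and> near m a b H V H' V' \<and>
        (\<forall>i j. \<beta> * (i - a) + \<alpha> * (j - b) \<ge> k \<longrightarrow> \<not> H' i j \<and> \<not> V' i j)"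
      using wiring_transposed[of Q "\<lambda>i j. H' j i" "\<lambda>i j. V' j i"]
      by (intro exI[of _ "\<lambda>i j. V' j i"] exI[of _ "\<lambda>i j. H' j i"]) (auto simp: near_def wiring_transposed add.commute)
  qed
qed

lemma confinable_rotated:
  assumes "confinable (rotated Q) \<alpha> \<beta>"
  shows "confinable Q (- \<alpha>) (- \<beta>)"
  unfolding confinable_def
proof
  fix m
  obtain k where k: "\<And>H V a b. wiring (rotated Q) H V \<Longrightarrow> \<exists>H' V'. wiring (rotated Q) H' V' \<and>
      near (m + 1) a b H V H' V' \<and> (\<forall>i j. \<alpha> * (i - a) + \<beta> * (j - b) \<ge> k \<longrightarrow> \<not> H' i j \<and> \<not> V' i j)"
    using assms unfolding confinable_def by metis
  show "\<exists>k. \<forall>H V a b. wiring Q H V \<longrightarrow> (\<exists>H' V'. wiring Q H' V' \<and> near m a b H V H' V' \<and>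
      (\<forall>i j. - \<alpha> * (i - a) + - \<beta> * (j - b) \<ge> k \<longrightarrow> \<not> H' i j \<and> \<not> V' i j))"
  proof (intro exI[of _ "k + \<bar>\<alpha>\<bar> + \<bar>\<beta>\<bar>"] allI impI)
    fix H V a b assume "wiring Q H V"
    then have "wiring (rotated Q) (\<lambda>i j. H (1 - i) (- j)) (\<lambda>i j. V (- i) (1 - j))" by (simp add: wiring_rotated)
    from k[OF this, of "- a" "- b"] obtain H' V' where
      w: "wiring (rotated Q) H' V'"
      and n: "near (m + 1) (- a) (- b) (\<lambda>i j. H (1 - i) (- j)) (\<lambda>i j. V (- i) (1 - j)) H' V'"
      and z: "\<And>i j. \<alpha> * (i + a) + \<beta> * (j + b) \<ge> k \<Longrightarrow> \<not> H' i j \<and> \<not> V' i j" by auto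
    let ?H = "\<lambda>i j. H' (1 - i) (- j)" and ?V = "\<lambda>i j. V' (- i) (1 - j)"
    have "wiring Q ?H ?V"
      using w wiring_rotated[of "rotated Q" H' V'] by (simp add: rotated_rotated)
    moreover have "near m a b H V ?H ?V"
      unfolding near_def
    proof (intro allI impI)
      fix i j assume ij: "\<bar>i - a\<bar> \<le> m \<and> \<bar>j - b\<bar> \<le> m"
      have box: "\<bar>1 - i - (- a)\<bar> \<le> m + 1" "\<bar>- j - (- b)\<bar> \<le> m + 1"
        "\<bar>- i - (- a)\<bar> \<le> m + 1" "\<bar>1 - j - (- b)\<bar> \<le> m + 1" using ij by arith+
      have "H' (1 - i) (- j) = H (1 - (1 - i)) (- (- j))"
        using n[unfolded near_def, rule_format, of "1 - i" "- j"] box(1,2) by simp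
      moreover have "V' (- i) (1 - j) = V (- (- i)) (1 - (1 - j))"
        using n[unfolded near_def, rule_format, of "- i" "1 - j"] box(3,4) by simp
      ultimately show "?H i j = H i j \<and> ?V i j = V i j" by simp
    qed
    moreover have "\<not> ?H i j \<and> \<not> ?V i j"
      if "- \<alpha> * (i - a) + - \<beta> * (j - b) \<ge> k + \<bar>\<alpha>\<bar> + \<bar>\<beta>\<bar>" for i j
    proof -
      have "\<alpha> * ((1 - i) + a) + \<beta> * (- j + b) = (- \<alpha> * (i - a) + - \<beta> * (j - b)) + \<alpha>"
        "\<alpha> * (- i + a) + \<beta> * ((1 - j) + b) = (- \<alpha> * (i - a) + - \<beta> * (j - b)) + \<beta>"
        by (simp_all add: algebra_simps)
      then show ?thesis using that z[of "1 - i" "- j"] z[of "- i" "1 - j"] by linarith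
    qed
    ultimately show "\<exists>H' V'. wiring Q H' V' \<and> near m a b H V H' V' \<and>
        (\<forall>i j. - \<alpha> * (i - a) + - \<beta> * (j - b) \<ge> k + \<bar>\<alpha>\<bar> + \<bar>\<beta>\<bar> \<longrightarrow> \<not> H' i j \<and> \<not> V' i j)" by blast
  qed
qed

section \<open>Routing paths out of a box\<close>

text \<open>
  Straight tiles everywhere, and on each cell one of the two corners, chosen by the parity of the
  cell. Recoloured \<open>T4\<close> has no other corners; since symmetries exchange the two corners,
  \<open>\<epsilon>\<close> is needed to keep track of the parity.
\<close>

definition routable :: "int \<Rightarrow> local_rule \<Rightarrow> bool" where
  "routable \<epsilon> Q \<longleftrightarrow> (\<forall>i j. Q i j False False False False \<and> Q i j True False True False \<and>
     Q i j False True False True \<and>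
     (odd (i + j + \<epsilon>) \<longrightarrow> Q i j True True False False) \<and>
     (even (i + j + \<epsilon>) \<longrightarrow> Q i j False False True True))"

lemma routable_transposed: "routable \<epsilon> Q \<Longrightarrow> routable (\<epsilon> + 1) (transposed Q)"
  unfolding routable_def transposed_def by (auto simp: add.commute)

lemma routable_rotated: "routable \<epsilon> Q \<Longrightarrow> routable (\<epsilon> + 1) (rotated Q)"
  unfolding routable_def rotated_def by auto

text \<open>
  Outside the box \<open>{a..b} \<times> {c..d}\<close> every path continues straight, except that the path leaving
  to the right in row j turns up at the cell \<open>(i, j)\<close> with \<open>i + j = b + 1 + d\<close>. Higher rows turn earlier, so
  no path crosses another, and all corners have the same parity, which is made the right one by
  enlarging the box by one column if necessary.
\<close>

lemma confinable_right:
  assumes "routable \<epsilon> Q"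
  shows "confinable Q 1 0"
  unfolding confinable_def
proof
  fix m :: int
  have straight: "Q i j False False False False" "Q i j True False True False" "Q i j False True False True"
    and corner: "odd (i + j + \<epsilon>) \<Longrightarrow> Q i j True True False False" for i j
    using assms unfolding routable_def by blast+
  show "\<exists>k. \<forall>H V a b. wiring Q H V \<longrightarrow> (\<exists>H' V'. wiring Q H' V' \<and> near m a b H V H' V' \<and>
      (\<forall>i j. 1 * (i - a) + 0 * (j - b) \<ge> k \<longrightarrow> \<not> H' i j \<and> \<not> V' i j))"
  proof (intro exI[of _ "3 * \<bar>m\<bar> + 3"] allI impI)
    fix H V a0 b0 assume w: "wiring Q H V"
    define a c d where "a = a0 - \<bar>m\<bar>" and "c = b0 - \<bar>m\<bar>" and "d = b0 + \<bar>m\<bar>"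
    define b where "b = (if odd (a0 + \<bar>m\<bar> + 1 + d + \<epsilon>) then a0 + \<bar>m\<bar> else a0 + \<bar>m\<bar> + 1)"
    have b: "odd (b + 1 + d + \<epsilon>)" "a0 + \<bar>m\<bar> \<le> b" "b \<le> a0 + \<bar>m\<bar> + 1" "a \<le> b" by (auto simp: b_def a_def)
    define H' where "H' i j \<longleftrightarrow> c \<le> j \<and> j \<le> d \<and> i + j \<le> b + 1 + d \<and> H (max a (min i (b + 1))) j" for i j
    define V' where "V' i j \<longleftrightarrow> (if i \<le> b then a \<le> i \<and> V i (max c (min j (d + 1)))
       else i + j > b + 1 + d \<and> c \<le> b + 1 + d - i \<and> H (b + 1) (b + 1 + d - i))" for i j
    have "Q i j (H' i j) (V' i (j + 1)) (H' (i + 1) j) (V' i j)" for i j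
    proof (cases "i \<le> b")
      case ib: True
      consider "i < a" | "a \<le> i" "j < c" | "a \<le> i" "d < j" | "a \<le> i" "c \<le> j" "j \<le> d" by linarith
      then show ?thesis
      proof cases
        case 1
        then have "max a (min i (b + 1)) = a" "max a (min (i + 1) (b + 1)) = a" using b(4) by auto
        then have "H' i j = (c \<le> j \<and> j \<le> d \<and> H a j)" "H' (i + 1) j = (c \<le> j \<and> j \<le> d \<and> H a j)"
          "V' i (j + 1) = False" "V' i j = False" using 1 ib by (auto simp: H'_def V'_def)
        then show ?thesis using straight by (cases "c \<le> j \<and> j \<le> d \<and> H a j") simp_all
      next
        case 2
        then have "max c (min j (d + 1)) = c" "max c (min (j + 1) (d + 1)) = c" by (auto simp: c_def d_def)
        then have "H' i j = False" "H' (i + 1) j = False" "V' i (j + 1) = V i c" "V' i j = V i c"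
          using 2 ib by (auto simp: H'_def V'_def)
        then show ?thesis using straight by (cases "V i c") simp_all
      next
        case 3
        then have "max c (min j (d + 1)) = d + 1" "max c (min (j + 1) (d + 1)) = d + 1" by (auto simp: c_def d_def)
        then have "H' i j = False" "H' (i + 1) j = False" "V' i (j + 1) = V i (d + 1)" "V' i j = V i (d + 1)"
          using 3 ib by (auto simp: H'_def V'_def)
        then show ?thesis using straight by (cases "V i (d + 1)") simp_all
      next
        case 4
        then have "max a (min i (b + 1)) = i" "max a (min (i + 1) (b + 1)) = i + 1"
          "max c (min j (d + 1)) = j" "max c (min (j + 1) (d + 1)) = j + 1" using ib by auto
        then have "H' i j = H i j" "H' (i + 1) j = H (i + 1) j" "V' i (j + 1) = V i (j + 1)" "V' i j = V i j"
          using 4 ib by (auto simp: H'_def V'_def)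
        moreover have "Q i j (H i j) (V i (j + 1)) (H (i + 1) j) (V i j)" using w unfolding wiring_def by blast
        ultimately show ?thesis by simp
      qed
    next
      case ib: False
      then have cl: "max a (min i (b + 1)) = b + 1" "max a (min (i + 1) (b + 1)) = b + 1" using b(4) by auto
      consider "i + j < b + 1 + d" | "i + j = b + 1 + d" | "i + j > b + 1 + d" by linarith
      then show ?thesis
      proof cases
        case 1
        then have "H' i j = (c \<le> j \<and> j \<le> d \<and> H (b + 1) j)" "H' (i + 1) j = (c \<le> j \<and> j \<le> d \<and> H (b + 1) j)"
          "V' i (j + 1) = False" "V' i j = False" using ib cl 1 by (auto simp: H'_def V'_def)
        then show ?thesis using straight by (cases "c \<le> j \<and> j \<le> d \<and> H (b + 1) j") simp_all
      next
        case 2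
        then have j: "j = b + 1 + d - i" and "j \<le> d" using ib by auto
        then have "H' i j = (c \<le> j \<and> H (b + 1) j)" "H' (i + 1) j = False"
          "V' i (j + 1) = (c \<le> j \<and> H (b + 1) j)" "V' i j = False" using ib cl 2 j by (auto simp: H'_def V'_def)
        moreover have "odd (i + j + \<epsilon>)" using b(1) 2 by simp
        ultimately show ?thesis using straight corner by (cases "c \<le> j \<and> H (b + 1) j") simp_all
      next
        case 3
        let ?v = "c \<le> b + 1 + d - i \<and> H (b + 1) (b + 1 + d - i)"
        have "H' i j = False" "H' (i + 1) j = False" "V' i (j + 1) = ?v" "V' i j = ?v" using ib 3 by (auto simp: H'_def V'_def)
        then show ?thesis using straight by (cases ?v) simp_all
      qed
    qed
    then have "wiring Q H' V'" unfolding wiring_def by blast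
    moreover have "near m a0 b0 H V H' V'"
      unfolding near_def
    proof (intro allI impI)
      fix i j assume "\<bar>i - a0\<bar> \<le> m \<and> \<bar>j - b0\<bar> \<le> m"
      then have ij: "a \<le> i" "i \<le> b" "c \<le> j" "j \<le> d" using b(2) by (auto simp: a_def c_def d_def)
      then have "max a (min i (b + 1)) = i" "max c (min j (d + 1)) = j" by auto
      then show "H' i j = H i j \<and> V' i j = V i j" using ij b(4) by (auto simp: H'_def V'_def)
    qed
    moreover have "\<not> H' i j \<and> \<not> V' i j" if "1 * (i - a0) + 0 * (j - b0) \<ge> 3 * \<bar>m\<bar> + 3" for i j
    proof -
      have "i > b + 1 + d - c" using that b(3) by (simp add: c_def d_def)
      then show ?thesis using b(4) by (auto simp: H'_def V'_def c_def d_def)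
    qed
    ultimately show "\<exists>H' V'. wiring Q H' V' \<and> near m a0 b0 H V H' V' \<and>
        (\<forall>i j. 1 * (i - a0) + 0 * (j - b0) \<ge> 3 * \<bar>m\<bar> + 3 \<longrightarrow> \<not> H' i j \<and> \<not> V' i j)" by blast
  qed
qed

lemma routable_confinable:
  assumes "routable \<epsilon> Q"
  shows "confinable Q 1 0" "confinable Q (- 1) 0" "confinable Q 0 1" "confinable Q 0 (- 1)"
proof -
  show "confinable Q 1 0" using assms by (rule confinable_right)
  show "confinable Q (- 1) 0"
    using confinable_rotated[OF confinable_right[OF routable_rotated[OF assms]]] by simp
  show "confinable Q 0 1"
    using confinable_transposed[OF confinable_right[OF routable_transposed[OF assms]]] .
  have "confinable (transposed Q) (- 1) 0"
    using confinable_rotated[OF confinable_right[OF routable_rotated[OF routable_transposed[OF assms]]]] by simp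
  then show "confinable Q 0 (- 1)" by (rule confinable_transposed)
qed

text \<open>
  The tiles of \<open>T1\<close>. A path may alternate between the two corners and climb a diagonal staircase.
\<close>

definition has_staircases :: "local_rule \<Rightarrow> bool" where
  "has_staircases Q \<longleftrightarrow> (\<forall>i j. Q i j False False False False \<and> Q i j True False True False \<and>
     Q i j True True False False \<and> Q i j False False True True)"

text \<open>
  In \<open>T1\<close> and \<open>T3\<close> a path that enters a cell from below must leave to the right. So no two
  horizontally adjacent lower edges are black, and paths that cross a horizontal line can be
  continued as disjoint parallel staircases.
\<close>

definition lower_turns_right :: "local_rule \<Rightarrow> bool" where
  "lower_turns_right Q \<longleftrightarrow> (\<forall>i j l u r. Q i j l u r True \<longrightarrow> r \<and> \<not> l)"

text \<open>
  All paths outside the box are infinite horizontal rays from its left and right sides.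
\<close>

definition flat :: "int \<Rightarrow> int \<Rightarrow> int \<Rightarrow> int \<Rightarrow> edges \<Rightarrow> edges \<Rightarrow> bool" where
  "flat a b c d H V \<longleftrightarrow> (\<forall>i j. V i j \<longrightarrow> a \<le> i \<and> i \<le> b) \<and> (\<forall>i j. H i j \<or> V i j \<longrightarrow> c \<le> j \<and> j \<le> d) \<and>
     (\<forall>i j. i \<le> a \<longrightarrow> H i j = H a j) \<and> (\<forall>i j. b < i \<longrightarrow> H i j = H (b + 1) j)"

lemma flat_rows: "flat a b c d H V \<Longrightarrow> H i j \<or> V i j \<Longrightarrow> c \<le> j \<and> j \<le> d"
  unfolding flat_def by blast

text \<open>
  Within the columns \<open>{a..b}\<close> the paths that cross the upper or lower side of the box are continued
  as staircases; outside these columns everything is continued horizontally. As a staircase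
  climbs one row per column, nothing gets further from the box than its width.
\<close>

lemma flatten:
  assumes Q: "has_staircases Q" and low: "lower_turns_right Q"
    and w: "wiring Q H V" and ab: "a \<le> b" and cd: "c \<le> d"
  shows "\<exists>H' V'. wiring Q H' V' \<and> flat a b (c - (b - a) - 2) (d + (b - a) + 2) H' V' \<and>
    (\<forall>i j. a \<le> i \<and> i \<le> b \<and> c \<le> j \<and> j \<le> d \<longrightarrow> H' i j = H i j \<and> V' i j = V i j)"
proof -
  have tiles: "Q i j False False False False" "Q i j True False True False"
     "Q i j True True False False" "Q i j False False True True" for i j
    using Q unfolding has_staircases_def by blast+
  have cell: "Q i j (H i j) (V i (j + 1)) (H (i + 1) j) (V i j)" for i j
    using w unfolding wiring_def by blast
  have sep: "\<not> (V i j \<and> V (i + 1) j)" for i j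
    using low cell[of i j] cell[of "i + 1" j] unfolding lower_turns_right_def by metis
  define up where "up i \<longleftrightarrow> a \<le> i \<and> i \<le> b \<and> V i (d + 1)" for i
  define dn where "dn i \<longleftrightarrow> a \<le> i \<and> i \<le> b \<and> V i c" for i
  have sep': "\<not> (up i \<and> up (i + 1))" "\<not> (dn i \<and> dn (i + 1))" for i
    using sep by (auto simp: up_def dn_def)
  define K where "K i j \<longleftrightarrow> (if d < j then up (i + d - j) else if j < c then dn (i + c - j - 1) else H i j)" for i j
  let ?cl = "\<lambda>i. max a (min i (b + 1))"
  define H' where "H' i j \<longleftrightarrow> K (?cl i) j" for i j
  define V' where "V' i j \<longleftrightarrow> a \<le> i \<and> i \<le> b \<and>
      (if d < j then up (i + d + 1 - j) else if j < c then dn (i + c - j) else V i j)" for i j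
  \<comment> \<open>In the rows of staircases left and upper edges carry one path, lower and right edges the next.\<close>
  have stair: "Q i j x x y y" if "\<not> (x \<and> y)" for i j x y
    using tiles that by (cases x; cases y) simp_all
  have "Q i j (H' i j) (V' i (j + 1)) (H' (i + 1) j) (V' i j)" for i j
  proof (cases "a \<le> i \<and> i \<le> b")
    case False
    then have "?cl (i + 1) = ?cl i" using ab by auto
    then have "H' (i + 1) j = H' i j" "\<not> V' i (j + 1)" "\<not> V' i j" using False by (auto simp: H'_def V'_def)
    then show ?thesis using tiles by (cases "H' i j") simp_all
  next
    case True
    then have cl: "?cl i = i" "?cl (i + 1) = i + 1" by auto
    consider "d < j" | "j < c" | "c \<le> j" "j \<le> d" using cd by linarith
    then show ?thesis
    proof cases
      case 1
      define e where "e = i + d - j"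
      have "H' i j = up e" "V' i (j + 1) = up e" "H' (i + 1) j = up (e + 1)" "V' i j = up (e + 1)"
        using 1 True by (simp_all add: H'_def V'_def cl K_def e_def algebra_simps)
      then show ?thesis using stair[OF sep'(1)[of e]] by simp
    next
      case 2
      define e where "e = i + c - j - 1"
      have "V' i (j + 1) = dn e"
      proof (cases "j + 1 = c")
        case j: True
        then have "e = i" by (simp add: e_def)
        then show ?thesis using 2 cd True j by (simp add: V'_def dn_def)
      next
        case False then show ?thesis using 2 cd True by (simp add: V'_def e_def algebra_simps)
      qed
      moreover have "H' i j = dn e" "H' (i + 1) j = dn (e + 1)" "V' i j = dn (e + 1)"
        using 2 cd True by (simp_all add: H'_def V'_def cl K_def e_def algebra_simps)
      ultimately show ?thesis using stair[OF sep'(2)[of e]] by simp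
    next
      case 3
      have "V' i (j + 1) = V i (j + 1)"
      proof (cases "j = d")
        case j: True then show ?thesis using True cd by (simp add: V'_def up_def)
      next
        case False then show ?thesis using 3 True by (simp add: V'_def)
      qed
      moreover have "H' i j = H i j" "H' (i + 1) j = H (i + 1) j" "V' i j = V i j"
        using 3 True by (simp_all add: H'_def V'_def cl K_def)
      ultimately show ?thesis using cell[of i j] by simp
    qed
  qed
  then have "wiring Q H' V'" unfolding wiring_def by blast
  moreover have "flat a b (c - (b - a) - 2) (d + (b - a) + 2) H' V'"
  proof -
    have "c - (b - a) - 2 \<le> j \<and> j \<le> d + (b - a) + 2" if "H' i j \<or> V' i j" for i j
    proof -
      have "a \<le> ?cl i" "?cl i \<le> b + 1" using ab by auto
      moreover consider "d < j" | "j < c" | "c \<le> j" "j \<le> d" by linarith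
      then show ?thesis
        using that ab cd calculation by cases (auto simp: H'_def V'_def K_def up_def dn_def split: if_splits)
    qed
    moreover have "?cl i = a" if "i \<le> a" for i using that ab by auto
    moreover have "?cl i = b + 1" if "b < i" for i using that ab by auto
    ultimately show ?thesis unfolding flat_def using ab by (simp add: H'_def V'_def)
  qed
  moreover have "H' i j = H i j \<and> V' i j = V i j" if "a \<le> i \<and> i \<le> b \<and> c \<le> j \<and> j \<le> d" for i j
  proof -
    have "?cl i = i" using that by auto
    then show ?thesis using that by (simp add: H'_def V'_def K_def)
  qed
  ultimately show ?thesis by blast
qed

text \<open>
  The ray of row k turns into a staircase at the antidiagonal through \<open>(b + 1, d)\<close>. From there on
  it keeps to a diagonal, and the diagonals of different rows differ by multiples of 2, as
  disjoint staircases require. So all paths stay above a diagonal line.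
\<close>

lemma flat_bend_right:
  assumes Q: "has_staircases Q" and w: "wiring Q H V" and flat: "flat a b c d H V" and cd: "c \<le> d"
  shows "\<exists>H' V'. wiring Q H' V' \<and> (\<forall>i j. i \<le> b \<longrightarrow> H' i j = H i j \<and> V' i j = V i j) \<and>
    (\<forall>i j. i - j > b + 1 + d - 2 * c \<longrightarrow> \<not> H' i j \<and> \<not> V' i j)"
proof -
  have tiles: "Q i j False False False False" "Q i j True False True False"
     "Q i j True True False False" "Q i j False False True True" for i j
    using Q unfolding has_staircases_def by blast+
  define P where "P k \<longleftrightarrow> H (b + 1) k" for k
  have P: "c \<le> k" "k \<le> d" if "P k" for k using flat that unfolding flat_def P_def by blast+
  \<comment> \<open>In row j the antidiagonal is \<open>e i j = 2 * j\<close>. To the right of it, even values \<open>2 * k\<close> belong to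
    the cells in which the path from row k turns up, odd values \<open>2 * k + 1\<close> to those in which it turns right.\<close>
  define e where "e i j = b + 1 + d - (i - j)" for i j :: int
  let ?H = "\<lambda>i j. if i \<le> b then H i j else if 2 * j \<le> e i j then P j else even (e i j) \<and> P (e i j div 2)"
  let ?V = "\<lambda>i j. if i \<le> b then V i j else odd (e i j) \<and> e i j < 2 * j \<and> P (e i j div 2)"
  have "Q i j (?H i j) (?V i (j + 1)) (?H (i + 1) j) (?V i j)" for i j
  proof -
    have cell: "Q i j (H i j) (V i (j + 1)) (H (i + 1) j) (V i j)"
      using w unfolding wiring_def by blast
    consider "i < b" | "i = b" | "i > b" by linarith
    then show ?thesis
    proof cases
      case 1 then show ?thesis using cell by simp
    next
      case 2
      have "?H (i + 1) j = P j"
      proof (cases "2 * j \<le> e (i + 1) j")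
        case True then show ?thesis using 2 by simp
      next
        case False
        then have "j > d" using 2 by (simp add: e_def)
        moreover have "e (i + 1) j = d + j" using 2 by (simp add: e_def)
        moreover have "even (d + j) \<Longrightarrow> (d + j) div 2 > d" using \<open>j > d\<close> by presburger
        ultimately have "\<not> P j" "even (e (i + 1) j) \<Longrightarrow> e (i + 1) j div 2 > d" using P(2)[of j] by auto
        then show ?thesis using False 2 P(2)[of "e (i + 1) j div 2"] by auto
      qed
      then show ?thesis using cell 2 by (simp add: P_def)
    next
      case 3
      have e1: "e (i + 1) j = e i j - 1" "e i (j + 1) = e i j + 1" by (simp_all add: e_def)
      consider k where "e i j = 2 * k" | k where "e i j = 2 * k + 1" by (metis oddE evenE)
      then show ?thesis
      proof cases
        case (1 k)
        then have val: "?H i j = (if j \<le> k then P j else P k)" "?V i (j + 1) = (k \<le> j \<and> P k)"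
          "?H (i + 1) j = (j < k \<and> P j)" "?V i j = False"
          using 3 by (auto simp: e1)
        consider "j < k" | "j = k" | "j > k" by linarith
        then show ?thesis
          unfolding val using tiles by cases (cases "P j"; cases "P k"; simp)+
      next
        case (2 k)
        then have val: "?H i j = (j \<le> k \<and> P j)" "?V i (j + 1) = False"
          "?H (i + 1) j = (if j \<le> k then P j else P k)" "?V i j = (k < j \<and> P k)"
          using 3 by (auto simp: e1)
        consider "j \<le> k" | "j > k" by linarith
        then show ?thesis
          unfolding val using tiles by cases (cases "P j"; cases "P k"; simp)+
      qed
    qed
  qed
  then have "wiring Q ?H ?V" unfolding wiring_def by blast
  moreover have "\<not> ?H i j \<and> \<not> ?V i j" if ij: "i - j > b + 1 + d - 2 * c" for i j
  proof (cases "i \<le> b")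
    case True
    then have "\<not> (H i j \<or> V i j)" using flat_rows[OF flat, of i j] ij cd by auto
    then show ?thesis using True by simp
  next
    case False
    have "e i j < 2 * c" using ij by (simp add: e_def)
    then have "\<not> (2 * j \<le> e i j \<and> P j)" "\<not> P (e i j div 2)" using P(1)[of j] P(1)[of "e i j div 2"] by auto
    then show ?thesis using False by auto
  qed
  ultimately show ?thesis by (intro exI[of _ ?H] exI[of _ ?V]) auto
qed

lemma flat_rotated:
  assumes "flat a b c d H V"
  shows "flat (- b) (- a) (- d) (1 - c) (\<lambda>i j. H (1 - i) (- j)) (\<lambda>i j. V (- i) (1 - j))"
proof -
  have "H (1 - i) (- j) = H (1 - (- b)) (- j)" if "i \<le> - b" for i j
  proof -
    have "b < 1 - i" using that by simp
    then have "H (1 - i) (- j) = H (b + 1) (- j)" using assms unfolding flat_def by blast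
    then show ?thesis by (simp add: add.commute)
  qed
  moreover have "H (1 - i) (- j) = H (1 - (- a + 1)) (- j)" if "- a < i" for i j
  proof -
    have "1 - i \<le> a" using that by simp
    then have "H (1 - i) (- j) = H a (- j)" using assms unfolding flat_def by blast
    then show ?thesis by simp
  qed
  moreover have "- b \<le> i \<and> i \<le> - a" if "V (- i) (1 - j)" for i j
  proof -
    have "a \<le> - i \<and> - i \<le> b" using assms that unfolding flat_def by blast
    then show ?thesis by auto
  qed
  moreover have "- d \<le> j \<and> j \<le> 1 - c" if "H (1 - i) (- j) \<or> V (- i) (1 - j)" for i j
  proof -
    have "c \<le> - j \<and> - j \<le> d \<or> c \<le> 1 - j \<and> 1 - j \<le> d" using assms that unfolding flat_def by blast
    then show ?thesis by auto
  qed
  ultimately show ?thesis unfolding flat_def by blast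
qed

lemma staircase_confinable:
  assumes Q: "has_staircases Q" and low: "lower_turns_right Q"
  shows "confinable Q 0 1" "confinable Q 0 (- 1)" "confinable Q 1 (- 1)" "confinable Q (- 1) 1"
proof -
  have flt: "\<exists>H' V'. wiring Q H' V' \<and> near m a b H V H' V' \<and>
      flat (a - M) (a + M) (b - (3 * M + 2)) (b + (3 * M + 2)) H' V'"
    if "wiring Q H V" "\<bar>m\<bar> \<le> M" for H V a b m M
  proof -
    have M: "M \<ge> 0" using that(2) by auto
    have "a - M \<le> a + M" "b - M \<le> b + M" using M by auto
    from flatten[OF Q low that(1) this] obtain H' V' where
      *: "wiring Q H' V'" "flat (a - M) (a + M) (b - M - (a + M - (a - M)) - 2) (b + M + (a + M - (a - M)) + 2) H' V'"
      "\<And>i j. a - M \<le> i \<and> i \<le> a + M \<and> b - M \<le> j \<and> j \<le> b + M \<Longrightarrow> H' i j = H i j \<and> V' i j = V i j"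
      by blast
    have "b - M - (a + M - (a - M)) - 2 = b - (3 * M + 2)" "b + M + (a + M - (a - M)) + 2 = b + (3 * M + 2)"
      by simp_all
    note *(2)[unfolded this]
    moreover
    have "near m a b H V H' V'"
      unfolding near_def using that(2) by (intro allI impI *(3)) auto
    ultimately show ?thesis using *(1) by blast
  qed
  show "confinable Q 0 1"
    unfolding confinable_def
  proof
    fix m
    show "\<exists>k. \<forall>H V a b. wiring Q H V \<longrightarrow> (\<exists>H' V'. wiring Q H' V' \<and> near m a b H V H' V' \<and>
        (\<forall>i j. 0 * (i - a) + 1 * (j - b) \<ge> k \<longrightarrow> \<not> H' i j \<and> \<not> V' i j))"
    proof (intro exI[of _ "3 * \<bar>m\<bar> + 3"] allI impI)
      fix H V a b assume "wiring Q H V"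
      from flt[OF this order_refl] obtain H' V' where "wiring Q H' V'" "near m a b H V H' V'"
        and fl: "flat (a - \<bar>m\<bar>) (a + \<bar>m\<bar>) (b - (3 * \<bar>m\<bar> + 2)) (b + (3 * \<bar>m\<bar> + 2)) H' V'" by blast
      moreover have "\<not> H' i j \<and> \<not> V' i j" if "0 * (i - a) + 1 * (j - b) \<ge> 3 * \<bar>m\<bar> + 3" for i j
        using flat_rows[OF fl, of i j] that by auto
      ultimately show "\<exists>H' V'. wiring Q H' V' \<and> near m a b H V H' V' \<and>
          (\<forall>i j. 0 * (i - a) + 1 * (j - b) \<ge> 3 * \<bar>m\<bar> + 3 \<longrightarrow> \<not> H' i j \<and> \<not> V' i j)" by blast
    qed
  qed
  show "confinable Q 0 (- 1)"
    unfolding confinable_def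
  proof
    fix m
    show "\<exists>k. \<forall>H V a b. wiring Q H V \<longrightarrow> (\<exists>H' V'. wiring Q H' V' \<and> near m a b H V H' V' \<and>
        (\<forall>i j. 0 * (i - a) + - 1 * (j - b) \<ge> k \<longrightarrow> \<not> H' i j \<and> \<not> V' i j))"
    proof (intro exI[of _ "3 * \<bar>m\<bar> + 3"] allI impI)
      fix H V a b assume "wiring Q H V"
      from flt[OF this order_refl] obtain H' V' where "wiring Q H' V'" "near m a b H V H' V'"
        and fl: "flat (a - \<bar>m\<bar>) (a + \<bar>m\<bar>) (b - (3 * \<bar>m\<bar> + 2)) (b + (3 * \<bar>m\<bar> + 2)) H' V'" by blast
      moreover have "\<not> H' i j \<and> \<not> V' i j" if "0 * (i - a) + - 1 * (j - b) \<ge> 3 * \<bar>m\<bar> + 3" for i j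
        using flat_rows[OF fl, of i j] that by auto
      ultimately show "\<exists>H' V'. wiring Q H' V' \<and> near m a b H V H' V' \<and>
          (\<forall>i j. 0 * (i - a) + - 1 * (j - b) \<ge> 3 * \<bar>m\<bar> + 3 \<longrightarrow> \<not> H' i j \<and> \<not> V' i j)" by blast
    qed
  qed
  show "confinable Q 1 (- 1)"
    unfolding confinable_def
  proof
    fix m
    show "\<exists>k. \<forall>H V a b. wiring Q H V \<longrightarrow> (\<exists>H' V'. wiring Q H' V' \<and> near m a b H V H' V' \<and>
        (\<forall>i j. 1 * (i - a) + - 1 * (j - b) \<ge> k \<longrightarrow> \<not> H' i j \<and> \<not> V' i j))"
    proof (intro exI[of _ "10 * \<bar>m\<bar> + 8"] allI impI)
      fix H V a b assume "wiring Q H V"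
      from flt[OF this order_refl] obtain H1 V1 where 1: "wiring Q H1 V1" "near m a b H V H1 V1"
        "flat (a - \<bar>m\<bar>) (a + \<bar>m\<bar>) (b - (3 * \<bar>m\<bar> + 2)) (b + (3 * \<bar>m\<bar> + 2)) H1 V1" by blast
      from flat_bend_right[OF Q 1(1,3)] obtain H2 V2 where 2: "wiring Q H2 V2"
        "\<And>i j. i \<le> a + \<bar>m\<bar> \<Longrightarrow> H2 i j = H1 i j \<and> V2 i j = V1 i j"
        "\<And>i j. i - j > a + \<bar>m\<bar> + 1 + (b + (3 * \<bar>m\<bar> + 2)) - 2 * (b - (3 * \<bar>m\<bar> + 2)) \<Longrightarrow> \<not> H2 i j \<and> \<not> V2 i j"
        by auto
      have "near m a b H V H2 V2"
        unfolding near_def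
      proof (intro allI impI)
        fix i j assume ij: "\<bar>i - a\<bar> \<le> m \<and> \<bar>j - b\<bar> \<le> m"
        then have "H1 i j = H i j \<and> V1 i j = V i j" using 1(2) unfolding near_def by blast
        moreover have "i \<le> a + \<bar>m\<bar>" using ij by auto
        ultimately show "H2 i j = H i j \<and> V2 i j = V i j" using 2(2)[of i j] by simp
      qed
      moreover have "\<not> H2 i j \<and> \<not> V2 i j" if "1 * (i - a) + - 1 * (j - b) \<ge> 10 * \<bar>m\<bar> + 8" for i j
        by (rule 2(3)) (use that in simp)
      ultimately show "\<exists>H' V'. wiring Q H' V' \<and> near m a b H V H' V' \<and>
          (\<forall>i j. 1 * (i - a) + - 1 * (j - b) \<ge> 10 * \<bar>m\<bar> + 8 \<longrightarrow> \<not> H' i j \<and> \<not> V' i j)"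
        using 2(1) by blast
    qed
  qed
  have rQ: "has_staircases (rotated Q)" using Q unfolding has_staircases_def rotated_def by blast
  show "confinable Q (- 1) 1"
    unfolding confinable_def
  proof
    fix m :: int
    let ?M = "\<bar>m\<bar> + 1"
    show "\<exists>k. \<forall>H V a b. wiring Q H V \<longrightarrow> (\<exists>H' V'. wiring Q H' V' \<and> near m a b H V H' V' \<and>
        (\<forall>i j. - 1 * (i - a) + 1 * (j - b) \<ge> k \<longrightarrow> \<not> H' i j \<and> \<not> V' i j))"
    proof (intro exI[of _ "10 * ?M + 11"] allI impI)
      fix H V a b assume "wiring Q H V"
      from flt[OF this, of m ?M a b] obtain H1 V1 where 1: "wiring Q H1 V1" "near m a b H V H1 V1"
        "flat (a - ?M) (a + ?M) (b - (3 * ?M + 2)) (b + (3 * ?M + 2)) H1 V1" by auto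
      let ?H1 = "\<lambda>i j. H1 (1 - i) (- j)" and ?V1 = "\<lambda>i j. V1 (- i) (1 - j)"
      have w1: "wiring (rotated Q) ?H1 ?V1" using 1(1) by (simp add: wiring_rotated)
      from flat_bend_right[OF rQ w1 flat_rotated[OF 1(3)]] obtain H2 V2 where 2: "wiring (rotated Q) H2 V2"
        "\<And>i j. i \<le> - (a - ?M) \<Longrightarrow> H2 i j = ?H1 i j \<and> V2 i j = ?V1 i j"
        "\<And>i j. i - j > - (a - ?M) + 1 + (1 - (b - (3 * ?M + 2))) - 2 * - (b + (3 * ?M + 2)) \<Longrightarrow> \<not> H2 i j \<and> \<not> V2 i j"
        by auto
      let ?H = "\<lambda>i j. H2 (1 - i) (- j)" and ?V = "\<lambda>i j. V2 (- i) (1 - j)"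
      have "wiring Q ?H ?V" using 2(1) wiring_rotated[of "rotated Q" H2 V2] by (simp add: rotated_rotated)
      moreover have "near m a b H V ?H ?V"
        unfolding near_def
      proof (intro allI impI)
        fix i j assume ij: "\<bar>i - a\<bar> \<le> m \<and> \<bar>j - b\<bar> \<le> m"
        then have "H1 i j = H i j \<and> V1 i j = V i j" using 1(2) unfolding near_def by blast
        moreover have "1 - i \<le> - (a - ?M)" "- i \<le> - (a - ?M)" using ij by auto
        ultimately show "?H i j = H i j \<and> ?V i j = V i j"
          using 2(2)[of "1 - i" "- j"] 2(2)[of "- i" "1 - j"] by simp
      qed
      moreover have "\<not> ?H i j \<and> \<not> ?V i j" if ij: "- 1 * (i - a) + 1 * (j - b) \<ge> 10 * ?M + 11" for i j
      proof
        show "\<not> ?H i j" by (rule conjunct1[OF 2(3)]) (use ij in simp)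
        show "\<not> ?V i j" by (rule conjunct2[OF 2(3)]) (use ij in simp)
      qed
      ultimately show "\<exists>H' V'. wiring Q H' V' \<and> near m a b H V H' V' \<and>
          (\<forall>i j. - 1 * (i - a) + 1 * (j - b) \<ge> 10 * ?M + 11 \<longrightarrow> \<not> H' i j \<and> \<not> V' i j)" by blast
    qed
  qed
qed

section \<open>The eight tilesets\<close>

lemma tile_in_bit_tiles:
  assumes "l \<le> 1" "u \<le> 1" "r \<le> 1" "d \<le> 1"
  shows "tile l u r d \<in> bit_tiles"
proof -
  have "tile l u r d = bit_tile (l = 1) (u = 1) (r = 1) (d = 1)"
    using assms by (auto simp: bit_tile_def le_Suc_eq)
  then show ?thesis unfolding bit_tiles_def by blast
qed

text \<open>
  With straight tiles in both directions the windows are separated by rows and columns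
  (\<open>t = 0\<close>), with staircases by rows and diagonals (\<open>t = 1\<close>).
\<close>

theorem wang_shift_not_L0:
  fixes T s
  defines "Q \<equiv> tile_rule T s"
  assumes T: "finite T" "T \<subseteq> bit_tiles"
    and flux: "flux_grows Q"
    and wires: "routable 0 Q \<or> has_staircases Q \<and> lower_turns_right Q"
  shows "ramified (wang_shift T) \<and> mixing (wang_shift T) \<and> wang_shift T \<notin> L0"
proof -
  let ?X = "wang_shift T"
  have sub: "subshift ?X" using T(1) by (rule subshift_wang_shift)
  have X: "?X = {plane s H V | H V. wiring Q H V}"
    unfolding Q_def using T(2) by (rule wang_shift_eq_planes)
  have inv: "shift p x \<in> ?X" if "x \<in> ?X" for x p using subshift_shift[OF sub that] .
  have tiles: "Q i j False False False False" "Q i j True False True False"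
    "odd (i + j) \<Longrightarrow> Q i j True True False False" "even (i + j) \<Longrightarrow> Q i j False False True True" for i j
    using wires unfolding routable_def has_staircases_def by auto
  have ram: "finitely_ramified ?X" by (rule flux_imp_finitely_ramified[OF X tiles flux])
  have mix: "mixing ?X"
    using wires
  proof
    assume "routable 0 Q"
    note conf = routable_confinable[OF this]
    show ?thesis by (rule confinable_imp_mixing[OF X inv _ conf(3,4), of 0]) (use conf in simp_all)
  next
    assume "has_staircases Q \<and> lower_turns_right Q"
    then have "has_staircases Q" "lower_turns_right Q" by auto
    note conf = staircase_confinable[OF this]
    show ?thesis by (rule confinable_imp_mixing[OF X inv _ conf(1,2), of 1]) (use conf in simp_all)
  qed
  have "?X \<notin> L0" using mixing_finitely_ramified_not_tame[OF sub mix ram] L0_imp_tame by blast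
  then show ?thesis using ram mix finitely_ramified_imp_ramified by blast
qed

lemmas tileset_defs = T1_def T2_def T3_def T4_def T5_def T6_def T7_def T8_def

lemma tilesets_are_bit_tiles:
  assumes "T \<in> {T1, T2, T3, T4, T5, T6, T7, T8}"
  shows "finite T" "T \<subseteq> bit_tiles"
  using assms by (auto simp: tileset_defs tile_in_bit_tiles)

lemma flux_tilesets:
  "T \<in> {T1, T2, T3, T5, T6, T8} \<Longrightarrow> flux_grows (tile_rule T False)"
  "T \<in> {T4, T7} \<Longrightarrow> flux_grows (tile_rule T True)"
  unfolding flux_grows_def all_bool_eq tile_rule_def
  by (auto simp: bit_tile_def tile_def tileset_defs)

lemma routable_tilesets:
  "T \<in> {T2, T5, T6, T8} \<Longrightarrow> routable 0 (tile_rule T False)"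
  "T \<in> {T4, T7} \<Longrightarrow> routable 0 (tile_rule T True)"
  unfolding routable_def tile_rule_def
  by (auto simp: bit_tile_def tile_def tileset_defs)

lemma staircase_tilesets:
  assumes "T \<in> {T1, T3}"
  shows "has_staircases (tile_rule T False)" "lower_turns_right (tile_rule T False)"
  using assms unfolding has_staircases_def lower_turns_right_def tile_rule_def
  by (auto simp: bit_tile_def tile_def tileset_defs)

theorem theorem3p2:
  "\<forall>T \<in> {T1, T2, T3, T4, T5, T6, T7, T8}.
     ramified (wang_shift T) \<and> mixing (wang_shift T) \<and> wang_shift T \<notin> L0"
proof
  fix T assume T: "T \<in> {T1, T2, T3, T4, T5, T6, T7, T8}"
  note tiles = tilesets_are_bit_tiles[OF T]
  consider "T \<in> {T2, T5, T6, T8}" | "T \<in> {T4, T7}" | "T \<in> {T1, T3}" using T by blast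
  then show "ramified (wang_shift T) \<and> mixing (wang_shift T) \<and> wang_shift T \<notin> L0"
  proof cases
    case 1
    then have "T \<in> {T1, T2, T3, T5, T6, T8}" by blast
    from wang_shift_not_L0[OF tiles flux_tilesets(1)[OF this]] routable_tilesets(1)[OF 1]
    show ?thesis by blast
  next
    case 2
    from wang_shift_not_L0[OF tiles flux_tilesets(2)[OF 2]] routable_tilesets(2)[OF 2]
    show ?thesis by blast
  next
    case 3
    then have "T \<in> {T1, T2, T3, T5, T6, T8}" by blast
    from wang_shift_not_L0[OF tiles flux_tilesets(1)[OF this]] staircase_tilesets[OF 3]
    show ?thesis by blast
  qed
qed

end
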